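(* Let $n \geq 3$ be an odd integer and set $m = (n-1)/2$. Let $H_1 = U(n)$ and $H_2 = Sp(m) \times SO(2n-2m)$. Embed $H_1$ into $U(2n)$ via the representation $st \oplus st^*$, i.e. $A \mapsto \mathrm{diag}(A, \bar{A})$ acting on $\mathbb{C}^n \oplus \mathbb{C}^n = \mathbb{C}^{2n}$, where $st$ is the standard representation of $U(n)$ and $st^*$ its contragredient. Embed $H_2$ into $U(2n)$ via $st' \otimes id \oplus id \otimes st''$, i.e. $(B, C) \mapsto \mathrm{diag}(B, C)$ acting on $\mathbb{C}^{2m} \oplus \mathbb{C}^{2n-2m} = \mathbb{C}^{2n}$, where $st'$ is the standard representation of $Sp(m) \subset U(2m)$ and $st''$ is the standard representation of $SO(2n-2m)$ (real orthogonal matrices acting $\mathbb{C}$-linearly on $\mathbb{C}^{2n-2m}$). Let $H_1$ and $H_2$ act isometrically on the round unit sphere $S^{4n-1} \subset \mathbb{C}^{2n}$ through these embeddings. Then the orbit spaces $S^{4n-1}/H_1$ and $S^{4n-1}/H_2$ are isospectral (their invariant spectra coincide) yet non-isometric.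
   Context: For a compact Riemannian manifold $M$ and a compact group $H$ of isometries of $M$, let $C^\infty(M)^H$ denote the smooth functions on $M$ that are constant on $H$-orbits. The $H$-invariant spectrum of $M/H$ is the spectrum (eigenvalues with multiplicities) of the Laplacian of $M$ restricted to $C^\infty(M)^H$. Two orbit spaces $M/H_1$, $M/H_2$ are called isospectral if their $H_1$-invariant and $H_2$-invariant spectra coincide. Orbit spaces carry the quotient metric (distance between orbits) and the smooth structure whose smooth functions $f$ are those with $\pi^* f \in C^\infty(M)^H$; a smooth SRF isometry is an isometry of metric spaces that is smooth with smooth inverse with respect to these structures (a map $\phi$ is smooth if it pulls back smooth functions to smooth functions). *)

theory Defs
  imports "HOL-Analysis.Analysis" "HOL-Combinatorics.Permutations" "HOL-Library.Extended_Nat"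
begin

definition cmat_mult :: "nat \<Rightarrow> (nat \<Rightarrow> nat \<Rightarrow> complex) \<Rightarrow> (nat \<Rightarrow> nat \<Rightarrow> complex) \<Rightarrow> (nat \<Rightarrow> nat \<Rightarrow> complex)" where
  "cmat_mult k A B = (\<lambda>i j. \<Sum>l<k. A i l * B l j)"

definition cmat_id :: "nat \<Rightarrow> nat \<Rightarrow> nat \<Rightarrow> complex" where
  "cmat_id k = (\<lambda>i j. if i = j \<and> i < k then 1 else 0)"

definition cmat_adj :: "(nat \<Rightarrow> nat \<Rightarrow> complex) \<Rightarrow> (nat \<Rightarrow> nat \<Rightarrow> complex)" where
  "cmat_adj A = (\<lambda>i j. cnj (A j i))"

definition cmat_transp :: "(nat \<Rightarrow> nat \<Rightarrow> complex) \<Rightarrow> (nat \<Rightarrow> nat \<Rightarrow> complex)" where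
  "cmat_transp A = (\<lambda>i j. A j i)"

definition cmat_conj :: "(nat \<Rightarrow> nat \<Rightarrow> complex) \<Rightarrow> (nat \<Rightarrow> nat \<Rightarrow> complex)" where
  "cmat_conj A = (\<lambda>i j. cnj (A i j))"

definition cmat_det :: "nat \<Rightarrow> (nat \<Rightarrow> nat \<Rightarrow> complex) \<Rightarrow> complex" where
  "cmat_det k A = (\<Sum>p \<in> {p. p permutes {..<k}}. of_int (sign p) * (\<Prod>i<k. A i (p i)))"

definition is_cmat :: "nat \<Rightarrow> (nat \<Rightarrow> nat \<Rightarrow> complex) \<Rightarrow> bool" where
  "is_cmat k A \<longleftrightarrow> (\<forall>i j. (k \<le> i \<or> k \<le> j) \<longrightarrow> A i j = 0)"

definition unitary_group :: "nat \<Rightarrow> (nat \<Rightarrow> nat \<Rightarrow> complex) set" where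
  "unitary_group k = {A. is_cmat k A \<and> cmat_mult k (cmat_adj A) A = cmat_id k}"

definition symp_J :: "nat \<Rightarrow> nat \<Rightarrow> nat \<Rightarrow> complex" where
  "symp_J m = (\<lambda>i j. if i < m \<and> j = i + m then 1
                     else if m \<le> i \<and> i < 2*m \<and> j + m = i then -1 else 0)"

definition compact_symplectic_group :: "nat \<Rightarrow> (nat \<Rightarrow> nat \<Rightarrow> complex) set" where
  "compact_symplectic_group m = {A \<in> unitary_group (2*m).
      cmat_mult (2*m) (cmat_mult (2*m) (cmat_transp A) (symp_J m)) A = symp_J m}"

definition special_orthogonal_group :: "nat \<Rightarrow> (nat \<Rightarrow> nat \<Rightarrow> complex) set" where
  "special_orthogonal_group k = {A \<in> unitary_group k. (\<forall>i j. A i j \<in> \<real>) \<and> cmat_det k A = 1}"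

definition block_diag :: "nat \<Rightarrow> nat \<Rightarrow> (nat \<Rightarrow> nat \<Rightarrow> complex) \<Rightarrow> (nat \<Rightarrow> nat \<Rightarrow> complex) \<Rightarrow> (nat \<Rightarrow> nat \<Rightarrow> complex)" where
  "block_diag a b A B = (\<lambda>i j. if i < a \<and> j < a then A i j
        else if a \<le> i \<and> i < a + b \<and> a \<le> j \<and> j < a + b then B (i - a) (j - a) else 0)"

definition H1_image :: "nat \<Rightarrow> (nat \<Rightarrow> nat \<Rightarrow> complex) set" where
  "H1_image n = (\<lambda>A. block_diag n n A (cmat_conj A)) ` unitary_group n"

definition H2_image :: "nat \<Rightarrow> nat \<Rightarrow> (nat \<Rightarrow> nat \<Rightarrow> complex) set" where
  "H2_image n m = (\<lambda>(B, C). block_diag (2*m) (2*n - 2*m) B C)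
        ` (compact_symplectic_group m \<times> special_orthogonal_group (2*n - 2*m))"

text \<open>Points of C^N are vectors of type complex^'k, with a fixed enumeration
  e : 'k \<rightarrow> {..<N} of the coordinates.\<close>
definition mat_act :: "('k::finite \<Rightarrow> nat) \<Rightarrow> (nat \<Rightarrow> nat \<Rightarrow> complex) \<Rightarrow> complex^'k \<Rightarrow> complex^'k" where
  "mat_act e M x = (\<chi> i. \<Sum>j\<in>UNIV. M (e i) (e j) * x $ j)"

definition unit_sphere :: "(complex^'k::finite) set" where
  "unit_sphere = {x. norm x = 1}"

definition orbit :: "('k::finite \<Rightarrow> nat) \<Rightarrow> (nat \<Rightarrow> nat \<Rightarrow> complex) set \<Rightarrow> complex^'k \<Rightarrow> (complex^'k) set" where
  "orbit e H x = (\<lambda>h. mat_act e h x) ` H"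

definition invariant_fun :: "('k::finite \<Rightarrow> nat) \<Rightarrow> (nat \<Rightarrow> nat \<Rightarrow> complex) set \<Rightarrow> (complex^'k \<Rightarrow> real) \<Rightarrow> bool" where
  "invariant_fun e H f \<longleftrightarrow> (\<forall>h\<in>H. \<forall>x\<in>unit_sphere. f (mat_act e h x) = f x)"

definition partial :: "'a::real_normed_vector \<Rightarrow> ('a \<Rightarrow> real) \<Rightarrow> 'a \<Rightarrow> real" where
  "partial b F x = deriv (\<lambda>t. F (x + t *\<^sub>R b)) 0"

fun iter_partial :: "'a::real_normed_vector list \<Rightarrow> ('a \<Rightarrow> real) \<Rightarrow> 'a \<Rightarrow> real" where
  "iter_partial [] F = F"
| "iter_partial (b # bs) F = partial b (iter_partial bs F)"

definition smooth_on :: "'a::euclidean_space set \<Rightarrow> ('a \<Rightarrow> real) \<Rightarrow> bool" where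
  "smooth_on U F \<longleftrightarrow> (\<forall>bs. set bs \<subseteq> Basis \<longrightarrow>
      continuous_on U (iter_partial bs F) \<and>
      (\<forall>b\<in>Basis. \<forall>x\<in>U. (\<lambda>t. iter_partial bs F (x + t *\<^sub>R b)) differentiable (at 0)))"

definition euclid_laplacian :: "('a::euclidean_space \<Rightarrow> real) \<Rightarrow> 'a \<Rightarrow> real" where
  "euclid_laplacian F x = (\<Sum>b\<in>Basis. partial b (partial b F) x)"

definition radial_ext :: "('a::real_normed_vector \<Rightarrow> real) \<Rightarrow> 'a \<Rightarrow> real" where
  "radial_ext f y = f (inverse (norm y) *\<^sub>R y)"

text \<open>A function on the round unit sphere is smooth iff its radial extension is smooth on
  the complement of the origin; the Laplace-Beltrami operator of the round sphere is the
  Euclidean Laplacian of the radial extension, restricted to the sphere.\<close>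
definition sphere_smooth :: "('a::euclidean_space \<Rightarrow> real) \<Rightarrow> bool" where
  "sphere_smooth f \<longleftrightarrow> smooth_on (- {0}) (radial_ext f)"

definition sphere_laplacian :: "('a::euclidean_space \<Rightarrow> real) \<Rightarrow> 'a \<Rightarrow> real" where
  "sphere_laplacian f x = euclid_laplacian (radial_ext f) x"

text \<open>Eigenspace of the (nonnegative) Laplacian -\<Delta> on H-invariant smooth functions on the
  sphere, for eigenvalue \<lambda>. Functions on the sphere are represented by functions on C^N
  vanishing off the sphere.\<close>
definition inv_eigenspace :: "('k::finite \<Rightarrow> nat) \<Rightarrow> (nat \<Rightarrow> nat \<Rightarrow> complex) set \<Rightarrow> real \<Rightarrow> (complex^'k \<Rightarrow> real) set" where
  "inv_eigenspace e H lam = {f. (\<forall>x. x \<notin> unit_sphere \<longrightarrow> f x = 0) \<and> sphere_smooth f \<and>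
      invariant_fun e H f \<and> (\<forall>x\<in>unit_sphere. - sphere_laplacian f x = lam * f x)}"

definition lin_indep_funs :: "('a \<Rightarrow> real) set \<Rightarrow> bool" where
  "lin_indep_funs F \<longleftrightarrow> (\<forall>c. (\<forall>x. (\<Sum>f\<in>F. c f * f x) = 0) \<longrightarrow> (\<forall>f\<in>F. c f = 0))"

definition fun_dim :: "('a \<Rightarrow> real) set \<Rightarrow> enat" where
  "fun_dim V = Sup {enat (card F) | F. finite F \<and> F \<subseteq> V \<and> lin_indep_funs F}"

text \<open>Multiplicity of \<lambda> in the H-invariant spectrum (0 if \<lambda> is not an eigenvalue).\<close>
definition inv_multiplicity :: "('k::finite \<Rightarrow> nat) \<Rightarrow> (nat \<Rightarrow> nat \<Rightarrow> complex) set \<Rightarrow> real \<Rightarrow> enat" where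
  "inv_multiplicity e H lam = fun_dim (inv_eigenspace e H lam)"

definition isospectral_orbit_spaces :: "('k::finite \<Rightarrow> nat) \<Rightarrow> (nat \<Rightarrow> nat \<Rightarrow> complex) set \<Rightarrow> (nat \<Rightarrow> nat \<Rightarrow> complex) set \<Rightarrow> bool" where
  "isospectral_orbit_spaces e H1 H2 \<longleftrightarrow> (\<forall>lam. inv_multiplicity e H1 lam = inv_multiplicity e H2 lam)"

definition sphere_dist :: "'a::real_inner \<Rightarrow> 'a \<Rightarrow> real" where
  "sphere_dist x y = arccos (inner x y)"

definition orbit_space :: "('k::finite \<Rightarrow> nat) \<Rightarrow> (nat \<Rightarrow> nat \<Rightarrow> complex) set \<Rightarrow> (complex^'k) set set" where
  "orbit_space e H = orbit e H ` unit_sphere"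

definition orbit_dist :: "(complex^'k::finite) set \<Rightarrow> (complex^'k) set \<Rightarrow> real" where
  "orbit_dist A B = Inf {sphere_dist a b | a b. a \<in> A \<and> b \<in> B}"

definition isometric_orbit_spaces :: "('k::finite \<Rightarrow> nat) \<Rightarrow> (nat \<Rightarrow> nat \<Rightarrow> complex) set \<Rightarrow> (nat \<Rightarrow> nat \<Rightarrow> complex) set \<Rightarrow> bool" where
  "isometric_orbit_spaces e H1 H2 \<longleftrightarrow> (\<exists>\<phi>. bij_betw \<phi> (orbit_space e H1) (orbit_space e H2) \<and>
      (\<forall>A\<in>orbit_space e H1. \<forall>B\<in>orbit_space e H1. orbit_dist (\<phi> A) (\<phi> B) = orbit_dist A B))"

end

theory Submission
  imports Defs "Jordan_Normal_Form.Determinant"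
begin

text \<open>
  Both orbit spaces are images of the sphere under three quadratic invariants \<open>p\<close>. For \<open>U(n)\<close>,
  acting on pairs \<open>(x, y)\<close>, these are \<open>|x|\<^sup>2 - |y|\<^sup>2\<close> and the complex number \<open>2 \<Sum> x\<^sub>i y\<^sub>i\<close>; for
  \<open>Sp(m) \<times> SO(2n-2m)\<close>, acting on pairs \<open>(z', z'')\<close>, they are \<open>|z''|\<^sup>2\<close> and \<open>\<Sum> z''\<^sub>i\<^sup>2\<close>. The fibres of \<open>p\<close>
  are the orbits, and in both cases the sphere Laplacian maps a polynomial in \<open>p\<close> of degree \<open>j\<close> to
  \<open>- 2j(2j+d-2)\<close> times itself plus terms of lower degree, \<open>d = 4n\<close>. Hence every such polynomial can be
  corrected in lower degree to an eigenfunction. Green's formula and the Weierstrass theorem on the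
  image of \<open>p\<close> show that there are no other invariant eigenfunctions, so the eigenspace of
  \<open>2j(2j+d-2)\<close> is isomorphic to the polynomials of degree at most \<open>j\<close> in three variables modulo those
  of degree less than \<open>j\<close>, for either group.

  The quotients are not isometric: in \<open>S\<^sup>4\<^sup>n\<^sup>-\<^sup>1/U(n)\<close> a point has at most one point at distance \<open>\<pi>/2\<close>,
  whereas the orbit \<open>z'' = 0\<close> of the second group has distance \<open>\<pi>/2\<close> from every orbit with \<open>z' = 0\<close>.
\<close>

no_notation scalar_prod (infix "\<bullet>" 70)

section \<open>Directional derivatives and Green's formula\<close>

text \<open>The spherical Laplacian of a function is the Euclidean Laplacian of its radial
  extension, so the analysis takes place on the punctured space with functions homogeneous of degree
  0. Integration over the sphere becomes Lebesgue integration over the annulus 1 < |y| < 2 with a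
  radial weight; degree-0 functions have no radial derivative, so the weight adds no term to Green's
  formula. The two Laplacians do differ on polynomials in \<open>p\<close>: the traces of the
  quadratic forms and the products of their gradients are not the same for the two groups. These
  data enter in lower degree only, whereas the diagonal coefficients depend on the degree and on d
  alone and are pairwise distinct. Polynomials can be carried from one group to the other because
  each image of \<open>p\<close> has interior points, so that a polynomial is determined by its
  values there. An unknown eigenfunction is compared with its projection to the polynomials of
  bounded degree, a space that is finite-dimensional from the outset.\<close>

definition has_partial :: "('a::real_normed_vector \<Rightarrow> real) \<Rightarrow> 'a \<Rightarrow> 'a \<Rightarrow> real \<Rightarrow> bool" where
  "has_partial F b y D \<longleftrightarrow> ((\<lambda>t. F (y + t *\<^sub>R b)) has_real_derivative D) (at 0)"

text \<open>\<open>partial\<close> is defined through \<open>deriv\<close>, which is an unspecified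
  choice where differentiability fails. Derivatives are therefore computed with the relation
  \<open>has_partial\<close> and converted at the end.\<close>

lemma has_partial_imp_partial: "has_partial F b y D \<Longrightarrow> partial b F y = D"
  unfolding has_partial_def partial_def by (rule DERIV_imp_deriv)

lemma eventually_line_in_open:
  fixes y b :: "'a::real_normed_vector"
  assumes "open U" "y \<in> U"
  shows "\<forall>\<^sub>F t in nhds (0::real). y + t *\<^sub>R b \<in> U"
proof -
  have "((\<lambda>t::real. y + t *\<^sub>R b) \<longlongrightarrow> y + 0 *\<^sub>R b) (nhds 0)"
    by (intro tendsto_intros filterlim_ident)
  then show ?thesis
    using topological_tendstoD[OF _ assms(1)] assms(2) by fastforce
qed

lemma has_partial_cong:
  assumes "open U" "y \<in> U" "\<And>z. z \<in> U \<Longrightarrow> F z = G z"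
  shows "has_partial F b y D \<longleftrightarrow> has_partial G b y D"
  unfolding has_partial_def
  by (rule DERIV_cong_ev[OF refl _ refl])
     (use eventually_line_in_open[OF assms(1,2), of b] assms(3) in \<open>auto elim: eventually_mono\<close>)

lemma has_partial_const: "has_partial (\<lambda>_. c) b y 0"
  unfolding has_partial_def by simp

lemma has_partial_coord: "has_partial (\<lambda>y. y \<bullet> c) b y (b \<bullet> c)"
  unfolding has_partial_def by (auto intro!: derivative_eq_intros simp: inner_add_left)

lemma has_partial_add:
  "has_partial F b y D \<Longrightarrow> has_partial G b y E \<Longrightarrow> has_partial (\<lambda>z. F z + G z) b y (D + E)"
  unfolding has_partial_def by (rule DERIV_add)

lemma has_partial_diff:
  "has_partial F b y D \<Longrightarrow> has_partial G b y E \<Longrightarrow> has_partial (\<lambda>z. F z - G z) b y (D - E)"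
  unfolding has_partial_def by (rule DERIV_diff)

lemma has_partial_mult:
  "has_partial F b y D \<Longrightarrow> has_partial G b y E \<Longrightarrow> has_partial (\<lambda>z. F z * G z) b y (D * G y + F y * E)"
  unfolding has_partial_def by (auto intro!: derivative_eq_intros)

lemma has_partial_cmult:
  "has_partial F b y D \<Longrightarrow> has_partial (\<lambda>z. c * F z) b y (c * D)"
  unfolding has_partial_def by (auto intro!: derivative_eq_intros)

lemma has_partial_norm_sq:
  fixes y b :: "'a::real_inner"
  shows "has_partial (\<lambda>y. y \<bullet> y) b y (2 * (y \<bullet> b))"
  unfolding has_partial_def
  by (auto intro!: derivative_eq_intros simp: inner_add_left inner_add_right inner_commute)

lemma has_partial_chain:
  "has_partial F b y D \<Longrightarrow> (g has_real_derivative E) (at (F y)) \<Longrightarrow> has_partial (\<lambda>z. g (F z)) b y (E * D)"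
  unfolding has_partial_def by (rule DERIV_chain2[where g = "\<lambda>t. F (y + t *\<^sub>R b)"]) auto

lemma has_partial_inverse_norm_sq:
  fixes y b :: "'a::real_inner"
  assumes "y \<noteq> 0"
  shows "has_partial (\<lambda>y. inverse (y \<bullet> y)) b y (- 2 * (y \<bullet> b) * (inverse (y \<bullet> y) * inverse (y \<bullet> y)))"
proof -
  have "(inverse has_real_derivative - (inverse (y \<bullet> y) * inverse (y \<bullet> y))) (at (y \<bullet> y))"
    using assms DERIV_inverse'[OF DERIV_ident, of "y \<bullet> y"] by simp
  from has_partial_chain[OF has_partial_norm_sq this, of b] show ?thesis
    by (simp add: mult_ac)
qed

lemma has_partial_along_line:
  assumes "has_partial F b (y + t *\<^sub>R b) D"
  shows "((\<lambda>s. F (y + s *\<^sub>R b)) has_real_derivative D) (at t)"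
proof -
  have "((\<lambda>s. F (y + (s + t) *\<^sub>R b)) has_real_derivative D) (at 0)"
    using assms unfolding has_partial_def by (simp add: algebra_simps)
  then show ?thesis
    using DERIV_shift[of "\<lambda>s. F (y + s *\<^sub>R b)" D 0 t] by simp
qed

lemma iter_partial_append: "iter_partial (bs @ cs) F = iter_partial bs (iter_partial cs F)"
  by (induction bs) auto

lemma smooth_on_continuous: "smooth_on U F \<Longrightarrow> continuous_on U F"
  unfolding smooth_on_def by (metis empty_set empty_subsetI iter_partial.simps(1))

lemma smooth_on_has_partial:
  assumes "smooth_on U F" "b \<in> Basis" "y \<in> U"
  shows "has_partial F b y (partial b F y)"
proof -
  have "(\<lambda>t. iter_partial [] F (y + t *\<^sub>R b)) differentiable (at 0)"
    using assms unfolding smooth_on_def by (metis empty_set empty_subsetI)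
  then show ?thesis
    unfolding has_partial_def partial_def
    by (simp add: DERIV_deriv_iff_real_differentiable)
qed

lemma smooth_on_partial:
  assumes "smooth_on U F" "b \<in> Basis"
  shows "smooth_on U (partial b F)"
proof -
  have "iter_partial bs (partial b F) = iter_partial (bs @ [b]) F" for bs
    by (simp add: iter_partial_append)
  moreover have "set (bs @ [b]) \<subseteq> Basis" if "set bs \<subseteq> Basis" for bs
    using that assms(2) by simp
  ultimately show ?thesis
    using assms(1) unfolding smooth_on_def by metis
qed

section \<open>Rational functions that are smooth away from the origin\<close>

text \<open>Polynomials in the coordinates and 1/|y|^2. The class contains the normalised invariants
  and is stable under directional derivatives off the origin, as an induction over the iterated
  partials in \<open>smooth_on\<close> requires.\<close>

inductive rat_fun :: "('a::euclidean_space \<Rightarrow> real) \<Rightarrow> bool" where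
  const: "rat_fun (\<lambda>_. c)"
| coord: "rat_fun (\<lambda>y. y \<bullet> b)"
| inverse_norm_sq: "rat_fun (\<lambda>y. inverse (y \<bullet> y))"
| add: "rat_fun F \<Longrightarrow> rat_fun G \<Longrightarrow> rat_fun (\<lambda>y. F y + G y)"
| mult: "rat_fun F \<Longrightarrow> rat_fun G \<Longrightarrow> rat_fun (\<lambda>y. F y * G y)"

lemma rat_fun_sum: "(\<And>i. i \<in> I \<Longrightarrow> rat_fun (F i)) \<Longrightarrow> rat_fun (\<lambda>y. \<Sum>i\<in>I. F i y)"
  by (induction I rule: infinite_finite_induct) (auto intro: rat_fun.intros)

lemma rat_fun_continuous_on: "rat_fun F \<Longrightarrow> continuous_on (-{0}) F"
  by (induction rule: rat_fun.induct) (auto intro!: continuous_intros)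

lemma rat_fun_has_partial:
  assumes "rat_fun F"
  shows "\<exists>F'. rat_fun F' \<and> (\<forall>y. y \<noteq> 0 \<longrightarrow> has_partial F b y (F' y))"
  using assms
proof (induction rule: rat_fun.induct)
  case (const c)
  show ?case by (rule exI[of _ "\<lambda>_. 0"]) (auto intro: rat_fun.intros has_partial_const)
next
  case (coord c)
  show ?case by (rule exI[of _ "\<lambda>_. b \<bullet> c"]) (auto intro: rat_fun.intros has_partial_coord)
next
  case inverse_norm_sq
  show ?case
    by (rule exI[of _ "\<lambda>y. - 2 * (y \<bullet> b) * (inverse (y \<bullet> y) * inverse (y \<bullet> y))"])
       (intro conjI rat_fun.intros allI impI has_partial_inverse_norm_sq)
next
  case (add F G)
  then obtain F' G' where "rat_fun F'" "rat_fun G'"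
    "\<And>y. y \<noteq> 0 \<Longrightarrow> has_partial F b y (F' y)" "\<And>y. y \<noteq> 0 \<Longrightarrow> has_partial G b y (G' y)" by blast
  then show ?case
    by (intro exI[of _ "\<lambda>y. F' y + G' y"]) (auto intro: rat_fun.intros has_partial_add)
next
  case (mult F G)
  then obtain F' G' where "rat_fun F'" "rat_fun G'"
    "\<And>y. y \<noteq> 0 \<Longrightarrow> has_partial F b y (F' y)" "\<And>y. y \<noteq> 0 \<Longrightarrow> has_partial G b y (G' y)" by blast
  with mult show ?case
    by (intro exI[of _ "\<lambda>y. F' y * G y + F y * G' y"]) (auto intro!: rat_fun.intros has_partial_mult)
qed

text \<open>The value of a radial extension at the origin is accidental, so agreement with the
  rational formula is demanded off the origin; openness of the complement transfers every iterated
  partial.\<close>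

lemma smooth_on_rat_fun:
  fixes F :: "'a::euclidean_space \<Rightarrow> real"
  assumes "rat_fun F" "\<And>y. y \<noteq> 0 \<Longrightarrow> G y = F y"
  shows "smooth_on (-{0}) G"
proof -
  have key: "\<exists>F'. rat_fun F' \<and> (\<forall>y. y \<noteq> 0 \<longrightarrow> iter_partial bs G y = F' y)" for bs
  proof (induction bs)
    case Nil
    then show ?case using assms by auto
  next
    case (Cons b bs)
    then obtain F' where F': "rat_fun F'" "\<And>y. y \<noteq> 0 \<Longrightarrow> iter_partial bs G y = F' y" by blast
    obtain F'' where F'': "rat_fun F''" "\<And>y. y \<noteq> 0 \<Longrightarrow> has_partial F' b y (F'' y)"
      using rat_fun_has_partial[OF F'(1)] by blast
    have "has_partial (iter_partial bs G) b y (F'' y)" if "y \<noteq> 0" for y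
      using has_partial_cong[of "-{0}" y "iter_partial bs G" F' b "F'' y"] F'(2) F''(2) that by auto
    then show ?case
      using F''(1) has_partial_imp_partial by fastforce
  qed
  show ?thesis
    unfolding smooth_on_def
  proof (intro allI impI conjI ballI)
    fix bs :: "'a list" and b x :: 'a
    assume "set bs \<subseteq> Basis"
    obtain F' where F': "rat_fun F'" "\<And>y. y \<noteq> 0 \<Longrightarrow> iter_partial bs G y = F' y"
      using key by blast
    show "continuous_on (-{0}) (iter_partial bs G)"
      using rat_fun_continuous_on[OF F'(1)] F'(2) continuous_on_cong
      by (metis ComplD singletonI)
    assume "x \<in> -{0}"
    obtain F'' where F'': "\<And>y. y \<noteq> 0 \<Longrightarrow> has_partial F' b y (F'' y)"
      using rat_fun_has_partial[OF F'(1)] by blast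
    have "has_partial (iter_partial bs G) b x (F'' x)"
      using has_partial_cong[of "-{0}" x "iter_partial bs G" F' b "F'' x"] F'(2) F'' \<open>x \<in> -{0}\<close>
      by auto
    then show "(\<lambda>t. iter_partial bs G (x + t *\<^sub>R b)) differentiable (at 0)"
      unfolding has_partial_def using real_differentiable_def by blast
  qed
qed

section \<open>Total differentiability and Euler's identity\<close>

text \<open>From \<open>x\<close> to \<open>x + h\<close> one moves along one coordinate direction
  after another; on each edge the mean value inequality bounds the error of the linear approximation
  by the oscillation of one partial derivative. The induction runs over the set of directions
  already used.\<close>

lemma has_derivative_of_continuous_partials:
  fixes F :: "'a::euclidean_space \<Rightarrow> real"
  assumes U: "open U" "x \<in> U"
    and part: "\<And>b y. b \<in> Basis \<Longrightarrow> y \<in> U \<Longrightarrow> has_partial F b y (F' b y)"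
    and cont: "\<And>b. b \<in> Basis \<Longrightarrow> continuous_on U (F' b)"
  shows "(F has_derivative (\<lambda>h. \<Sum>b\<in>Basis. (h \<bullet> b) * F' b x)) (at x)"
  unfolding has_derivative_at_alt
proof (intro conjI allI impI)
  show "bounded_linear (\<lambda>h. \<Sum>b\<in>Basis. (h \<bullet> b) * F' b x)"
    by (intro bounded_linear_sum bounded_linear_mult_left[THEN bounded_linear_compose] bounded_linear_inner_left)
next
  fix e :: real assume "e > 0"
  \<comment> \<open>Each of the \<open>DIM('a)\<close> edges contributes an error of at most
    \<open>e' * norm h\<close>, which adds up to \<open>e * norm h\<close>.\<close>
  define e' where "e' = e / DIM('a)"
  have e': "e' > 0" using \<open>e > 0\<close> by (simp add: e'_def)
  have "\<forall>\<^sub>F y in nhds x. \<forall>b\<in>Basis. \<bar>F' b y - F' b x\<bar> < e'"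
  proof (rule eventually_ball_finite, simp, intro ballI)
    fix b :: 'a assume "b \<in> Basis"
    then have "(F' b \<longlongrightarrow> F' b x) (nhds x)"
      using cont U by (metis at_within_open continuous_on_def tendsto_at_iff_tendsto_nhds)
    then have "\<forall>\<^sub>F y in nhds x. dist (F' b y) (F' b x) < e'"
      by (rule tendstoD[OF _ e'])
    then show "\<forall>\<^sub>F y in nhds x. \<bar>F' b y - F' b x\<bar> < e'"
      by (simp add: dist_real_def)
  qed
  moreover have "\<forall>\<^sub>F y in nhds x. y \<in> U"
    using U by (simp add: eventually_nhds_in_open)
  ultimately have "\<forall>\<^sub>F y in nhds x. y \<in> U \<and> (\<forall>b\<in>Basis. \<bar>F' b y - F' b x\<bar> < e')"
    by eventually_elim auto
  then obtain d where d: "d > 0"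
    and dU: "\<And>y. dist y x < d \<Longrightarrow> y \<in> U \<and> (\<forall>b\<in>Basis. \<bar>F' b y - F' b x\<bar> < e')"
    unfolding eventually_nhds_metric by blast
  show "\<exists>d>0. \<forall>y. norm (y - x) < d \<longrightarrow>
      norm (F y - F x - (\<Sum>b\<in>Basis. ((y - x) \<bullet> b) * F' b x)) \<le> e * norm (y - x)"
  proof (intro exI[of _ d] conjI allI impI d)
    fix y assume y: "norm (y - x) < d"
    define h where "h = y - x"
    \<comment> \<open>Every point of the path has coordinates relative to \<open>x\<close> bounded
      by those of \<open>h\<close>, so it stays in the ball on which the partials are
      controlled.\<close>
    have near: "dist (x + w) x < d" if "\<And>b. b \<in> Basis \<Longrightarrow> \<bar>w \<bullet> b\<bar> \<le> \<bar>h \<bullet> b\<bar>" for w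
      using norm_le_componentwise[of w h] that y by (simp add: h_def dist_norm)
    have comp: "(\<Sum>b\<in>B. (h \<bullet> b) *\<^sub>R b) \<bullet> c = (if c \<in> B then h \<bullet> c else 0)"
      if "B \<subseteq> Basis" "c \<in> Basis" for B c
    proof -
      have "finite B" using that(1) finite_Basis by (rule finite_subset)
      have "(\<Sum>b\<in>B. (h \<bullet> b) *\<^sub>R b) \<bullet> c = (\<Sum>b\<in>B. if b = c then h \<bullet> c else 0)"
        unfolding inner_sum_left
        by (rule sum.cong) (use that in \<open>auto simp: inner_Basis\<close>)
      then show ?thesis using \<open>finite B\<close> by simp
    qed
    have "\<bar>F (x + (\<Sum>b\<in>B. (h \<bullet> b) *\<^sub>R b)) - F x - (\<Sum>b\<in>B. (h \<bullet> b) * F' b x)\<bar> \<le> (\<Sum>b\<in>B. e' * \<bar>h \<bullet> b\<bar>)"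
      if "finite B" "B \<subseteq> Basis" for B
      using that
    proof (induction B rule: finite_induct)
      case empty
      then show ?case by simp
    next
      case (insert c B)
      define z where "z = (\<Sum>b\<in>B. (h \<bullet> b) *\<^sub>R b)"
      have cB: "c \<in> Basis" "B \<subseteq> Basis" using insert by auto
      define S where "S = closed_segment 0 (h \<bullet> c)"
      have inS: "\<bar>t\<bar> \<le> \<bar>h \<bullet> c\<bar>" if "t \<in> S" for t
        using that unfolding S_def closed_segment_eq_real_ivl by (auto split: if_splits)
      have near': "dist (x + z + t *\<^sub>R c) x < d" if "t \<in> S" for t
        unfolding add.assoc
      proof (rule near)
        fix b :: 'a assume "b \<in> Basis"
        then show "\<bar>(z + t *\<^sub>R c) \<bullet> b\<bar> \<le> \<bar>h \<bullet> b\<bar>"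
          using comp[OF cB(2)] cB(1) inS[OF that] insert(2)
          by (cases "b = c") (simp_all add: z_def inner_add_left inner_Basis)
      qed
      have deriv: "((\<lambda>t. F (x + z + t *\<^sub>R c) - t * F' c x) has_field_derivative
            (F' c (x + z + t *\<^sub>R c) - F' c x)) (at t within S)" if "t \<in> S" for t
      proof (rule DERIV_diff)
        show "((\<lambda>t. F (x + z + t *\<^sub>R c)) has_field_derivative F' c (x + z + t *\<^sub>R c)) (at t within S)"
          by (rule has_field_derivative_at_within, rule has_partial_along_line, rule part)
             (use cB(1) dU[OF near'[OF that]] in auto)
        show "((\<lambda>t. t * F' c x) has_field_derivative F' c x) (at t within S)"
          using DERIV_cmult_right[OF DERIV_ident, of "F' c x" t S] by simp
      qed
      have A: "norm ((F (x + z + (h \<bullet> c) *\<^sub>R c) - (h \<bullet> c) * F' c x) - (F (x + z + 0 *\<^sub>R c) - 0 * F' c x))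
          \<le> e' * norm (h \<bullet> c - 0)"
      proof (rule field_differentiable_bound[where S = S, OF _ deriv])
        show "norm (F' c (x + z + t *\<^sub>R c) - F' c x) \<le> e'" if "t \<in> S" for t
          using dU[OF near'[OF that]] cB(1) by (simp only: real_norm_def less_imp_le)
      qed (simp_all add: S_def)
      have E1: "x + (\<Sum>b\<in>insert c B. (h \<bullet> b) *\<^sub>R b) = x + z + (h \<bullet> c) *\<^sub>R c"
        using insert by (simp add: z_def)
      have E2: "(\<Sum>b\<in>insert c B. (h \<bullet> b) * F' b x) = (h \<bullet> c) * F' c x + (\<Sum>b\<in>B. (h \<bullet> b) * F' b x)"
        "(\<Sum>b\<in>insert c B. e' * \<bar>h \<bullet> b\<bar>) = e' * \<bar>h \<bullet> c\<bar> + (\<Sum>b\<in>B. e' * \<bar>h \<bullet> b\<bar>)"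
        using insert by simp_all
      have "\<bar>F (x + z) - F x - (\<Sum>b\<in>B. (h \<bullet> b) * F' b x)\<bar> \<le> (\<Sum>b\<in>B. e' * \<bar>h \<bullet> b\<bar>)"
        using insert.IH[OF cB(2)] by (simp only: z_def)
      then show ?case
        using A unfolding E1 E2 real_norm_def scale_zero_left add_0_right mult_zero_left diff_0_right
        by linarith
    qed
    from this[OF finite_Basis order_refl] have "\<bar>F (x + h) - F x - (\<Sum>b\<in>Basis. (h \<bullet> b) * F' b x)\<bar> \<le> (\<Sum>b\<in>Basis. e' * \<bar>h \<bullet> b\<bar>)"
      by (simp add: euclidean_representation)
    also have "\<dots> \<le> (\<Sum>b\<in>(Basis::'a set). e' * norm h)"
      by (intro sum_mono mult_left_mono Basis_le_norm) (use e' in auto)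
    also have "\<dots> = e * norm h"
      by (simp add: e'_def)
    finally show "norm (F y - F x - (\<Sum>b\<in>Basis. ((y - x) \<bullet> b) * F' b x)) \<le> e * norm (y - x)"
      by (simp add: h_def)
  qed
qed

text \<open>\<open>F\<close> is constant on rays, so its derivative in direction \<open>y\<close>
  vanishes. This direction is in general not a basis vector, hence the passage through total
  differentiability.\<close>

lemma euler_identity:
  fixes F :: "'a::euclidean_space \<Rightarrow> real"
  assumes "smooth_on (-{0}) F" "\<And>r y. r > 0 \<Longrightarrow> F (r *\<^sub>R y) = F y" "y \<noteq> 0"
  shows "(\<Sum>b\<in>Basis. (y \<bullet> b) * partial b F y) = 0"
proof -
  have "(F has_derivative (\<lambda>h. \<Sum>b\<in>Basis. (h \<bullet> b) * partial b F y)) (at y)"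
    by (rule has_derivative_of_continuous_partials[of "-{0}"])
       (use assms in \<open>auto intro!: smooth_on_has_partial[of "-{0}"] smooth_on_continuous smooth_on_partial\<close>)
  then have D: "(F has_derivative (\<lambda>h. \<Sum>b\<in>Basis. (h \<bullet> b) * partial b F y)) (at (y + 0 *\<^sub>R y))"
    by simp
  have "((\<lambda>t::real. y + t *\<^sub>R y) has_derivative (\<lambda>t. t *\<^sub>R y)) (at 0)"
    by (auto intro!: derivative_eq_intros)
  from has_derivative_compose[OF this D]
  have "((\<lambda>t. F (y + t *\<^sub>R y)) has_real_derivative (\<Sum>b\<in>Basis. (y \<bullet> b) * partial b F y)) (at 0)"
    unfolding has_field_derivative_def
    by (rule has_derivative_eq_rhs) (auto simp: sum_distrib_right sum_distrib_left mult_ac fun_eq_iff)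
  moreover have "((\<lambda>t. F (y + t *\<^sub>R y)) has_real_derivative 0) (at 0)"
  proof (rule DERIV_cong_ev[THEN iffD2, OF refl _ refl, of _ "\<lambda>_. F y"])
    have "\<forall>\<^sub>F t in nhds (0::real). t > -1"
      by (rule order_tendstoD(1)[OF filterlim_ident]) simp
    then show "\<forall>\<^sub>F t in nhds 0. F (y + t *\<^sub>R y) = F y"
    proof eventually_elim
      case (elim t)
      have "y + t *\<^sub>R y = (1 + t) *\<^sub>R y" by (simp add: algebra_simps)
      then show ?case using assms(2)[of "1 + t" y] elim by simp
    qed
  qed simp
  ultimately show ?thesis using DERIV_unique by blast
qed


lemma radial_ext_scale: "r > 0 \<Longrightarrow> radial_ext f (r *\<^sub>R y) = radial_ext f y"
  unfolding radial_ext_def by (cases "y = 0") (auto simp: field_simps)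

lemma radial_ext_unit: "norm x = 1 \<Longrightarrow> radial_ext f x = f x"
  unfolding radial_ext_def by simp

text \<open>Differentiation lowers the degree of homogeneity by one. Used with \<open>c = 1\<close>
  for a degree-0 function and with \<open>c = inverse r\<close> for its first partials.\<close>

lemma has_partial_scale:
  fixes F :: "'a::real_normed_vector \<Rightarrow> real"
  assumes hom: "\<And>z. z \<noteq> 0 \<Longrightarrow> F (r *\<^sub>R z) = c * F z" and "r > 0" "y \<noteq> 0" "has_partial F b y D"
  shows "has_partial F b (r *\<^sub>R y) (c * D / r)"
proof -
  have "((\<lambda>t. c * F (y + (t / r) *\<^sub>R b)) has_real_derivative c * (D * (1 / r))) (at 0)"
  proof (intro DERIV_cmult DERIV_chain2[where g = "\<lambda>t. t / r"])
    show "((\<lambda>t. F (y + t *\<^sub>R b)) has_real_derivative D) (at (0 / r))"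
      using assms(4) by (simp add: has_partial_def)
  qed (use \<open>r > 0\<close> in \<open>auto intro!: derivative_eq_intros\<close>)
  moreover have "\<forall>\<^sub>F t in nhds 0. F (r *\<^sub>R y + t *\<^sub>R b) = c * F (y + (t / r) *\<^sub>R b)"
  proof -
    have "\<forall>\<^sub>F t in nhds 0. r *\<^sub>R y + t *\<^sub>R b \<in> -{0}"
      by (rule eventually_line_in_open) (use assms in auto)
    then show ?thesis
    proof eventually_elim
      case (elim t)
      have eq: "r *\<^sub>R y + t *\<^sub>R b = r *\<^sub>R (y + (t / r) *\<^sub>R b)"
        using \<open>r > 0\<close> by (simp add: scaleR_right_distrib)
      then show ?case
        using elim hom[of "y + (t / r) *\<^sub>R b"] by auto
    qed
  qed
  ultimately show ?thesis
    unfolding has_partial_def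
    by (subst DERIV_cong_ev[OF refl _ refl]) auto
qed

text \<open>The Laplacian of a degree-0 function has degree -2; the factor
  \<open>y \<bullet> y\<close> restores degree 0, so that the eigenvalue equation extends from the
  sphere to the punctured space.\<close>

definition radial_eigen :: "real \<Rightarrow> ('a::euclidean_space \<Rightarrow> real) \<Rightarrow> bool" where
  "radial_eigen lam F \<longleftrightarrow> smooth_on (-{0}) F \<and> (\<forall>r y. r > 0 \<longrightarrow> F (r *\<^sub>R y) = F y)
     \<and> (\<forall>y. y \<noteq> 0 \<longrightarrow> (y \<bullet> y) * euclid_laplacian F y = - lam * F y)"

lemma radial_eigen_radial_ext:
  fixes f :: "'a::euclidean_space \<Rightarrow> real"
  assumes "sphere_smooth f" "\<And>x. norm x = 1 \<Longrightarrow> - sphere_laplacian f x = lam * f x"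
  shows "radial_eigen lam (radial_ext f)"
proof -
  define F where "F = radial_ext f"
  have sm: "smooth_on (-{0}) F" using assms(1) by (simp add: sphere_smooth_def F_def)
  have hom: "F (r *\<^sub>R y) = F y" if "r > 0" for r y
    using radial_ext_scale[OF that] by (simp add: F_def)
  have hom1: "partial b F (r *\<^sub>R y) = inverse r * partial b F y" if "r > 0" "y \<noteq> 0" "b \<in> Basis" for r y b
    using has_partial_imp_partial[OF has_partial_scale[of F r 1 y b, OF _ that(1,2) smooth_on_has_partial[OF sm that(3)]]]
      hom that by (simp add: field_simps)
  have hom2: "partial b (partial b F) (r *\<^sub>R y) = partial b (partial b F) y / r\<^sup>2"
    if "r > 0" "y \<noteq> 0" "b \<in> Basis" for r y b
    using has_partial_imp_partial[OF has_partial_scale[of "partial b F" r "inverse r" y b, OF _ that(1,2)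
          smooth_on_has_partial[OF smooth_on_partial[OF sm that(3)] that(3)]]]
      hom1 that by (simp add: field_simps power2_eq_square)
  have "(y \<bullet> y) * euclid_laplacian F y = - lam * F y" if "y \<noteq> 0" for y
  proof -
    define x where "x = inverse (norm y) *\<^sub>R y"
    have x: "norm x = 1" "x \<noteq> 0" "y = norm y *\<^sub>R x" using that by (auto simp: x_def)
    have "(y \<bullet> y) * euclid_laplacian F y = (norm y)\<^sup>2 * euclid_laplacian F (norm y *\<^sub>R x)"
      using x(3) by (simp add: power2_norm_eq_inner)
    also have "\<dots> = euclid_laplacian F x"
      unfolding euclid_laplacian_def sum_distrib_left
      by (rule sum.cong[OF refl], subst hom2) (use that x(2) in auto)
    also have "\<dots> = - lam * F x"
      using assms(2)[OF x(1)] radial_ext_unit[OF x(1), of f] unfolding sphere_laplacian_def F_def by simp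
    also have "F x = F y" unfolding x_def using hom that by simp
    finally show ?thesis .
  qed
  then show ?thesis
    using sm hom unfolding radial_eigen_def F_def by blast
qed

section \<open>Green's formula on an annulus\<close>

lemma integrable_continuous_compact_support:
  fixes h :: "'a::euclidean_space \<Rightarrow> real"
  assumes "continuous_on UNIV h" "\<And>x. norm x > R \<Longrightarrow> h x = 0"
  shows "integrable lborel h"
proof -
  have "integrable lborel (\<lambda>x. indicator (cball 0 R) x *\<^sub>R h x)"
    by (rule borel_integrable_compact) (use assms(1) continuous_on_subset in auto)
  also have "(\<lambda>x. indicator (cball 0 R) x *\<^sub>R h x) = h"
    using assms(2) by (auto simp: indicator_def fun_eq_iff not_le)
  finally show ?thesis .
qed

text \<open>Translation invariance makes the integral of each difference quotient vanish, and
  dominated convergence carries this over to the derivative.\<close>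

lemma integral_partial_eq_0:
  fixes h k :: "'a::euclidean_space \<Rightarrow> real"
  assumes part: "\<And>x. has_partial h b x (k x)" and b: "b \<in> Basis"
    and ch: "continuous_on UNIV h" and ck: "continuous_on UNIV k"
    and sh: "\<And>x. norm x > R \<Longrightarrow> h x = 0" and sk: "\<And>x. norm x > R \<Longrightarrow> k x = 0"
  shows "integral\<^sup>L lborel k = 0"
proof -
  have "compact (k ` cball 0 R)"
    by (intro compact_continuous_image continuous_on_subset[OF ck]) auto
  then obtain M0 where M0: "\<And>x. x \<in> cball 0 R \<Longrightarrow> \<bar>k x\<bar> \<le> M0"
    using compact_imp_bounded bounded_iff by (metis image_eqI real_norm_def)
  define M where "M = max M0 0"
  have M: "\<bar>k x\<bar> \<le> M" for x
    using M0[of x] sk[of x] by (cases "norm x \<le> R") (auto simp: M_def)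
  \<comment> \<open>The step 1/(i+1) is at most 1, so every quotient vanishes outside the ball of
    radius \<open>R + 1\<close>; the mean value inequality bounds it by \<open>M\<close>.\<close>
  define q where "q i x = (h (x + inverse (Suc i) *\<^sub>R b) - h x) * Suc i" for i x
  have inth: "integrable lborel h"
    by (rule integrable_continuous_compact_support[OF ch sh])
  have shift: "integral\<^sup>L lborel (\<lambda>x. h (x + c)) = integral\<^sup>L lborel h" "integrable lborel (\<lambda>x. h (x + c))" for c
  proof -
    have m: "h \<in> borel_measurable borel" using ch by (rule borel_measurable_continuous_onI)
    show "integral\<^sup>L lborel (\<lambda>x. h (x + c)) = integral\<^sup>L lborel h"
      using integral_distr[of "(+) c" lborel borel h] m by (simp add: lborel_distr_plus add.commute)
    show "integrable lborel (\<lambda>x. h (x + c))"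
      using integrable_distr_eq[of "(+) c" lborel borel h] m inth by (simp add: lborel_distr_plus add.commute)
  qed
  have q0: "integral\<^sup>L lborel (q i) = 0" for i
    unfolding q_def using shift inth by (simp del: of_nat_Suc)
  have "(\<lambda>i. integral\<^sup>L lborel (q i)) \<longlonglongrightarrow> integral\<^sup>L lborel k"
  proof (rule integral_dominated_convergence[where w = "\<lambda>x. M * indicator (cball 0 (R + 1)) x"])
    show "k \<in> borel_measurable lborel"
      using borel_measurable_continuous_onI[OF ck] by simp
    show "q i \<in> borel_measurable lborel" for i
      unfolding q_def using shift(2) inth by (intro borel_measurable_times borel_measurable_diff) auto
    show "integrable lborel (\<lambda>x. M * indicator (cball 0 (R + 1)) (x::'a))"
      by (intro integrable_mult_right integrable_real_indicator emeasure_lborel_cball_finite) simp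
    show "AE x in lborel. (\<lambda>i. q i x) \<longlonglongrightarrow> k x"
    proof (rule AE_I2)
      fix x
      have "((\<lambda>t. (h (x + t *\<^sub>R b) - h x) / t) \<longlongrightarrow> k x) (at 0)"
        using part[of x] unfolding has_partial_def DERIV_def by simp
      moreover have "filterlim (\<lambda>i. inverse (real (Suc i))) (at 0) sequentially"
        unfolding filterlim_at using LIMSEQ_inverse_real_of_nat by auto
      ultimately have "(\<lambda>i. (h (x + inverse (real (Suc i)) *\<^sub>R b) - h x) / inverse (real (Suc i))) \<longlonglongrightarrow> k x"
        by (rule filterlim_compose)
      then show "(\<lambda>i. q i x) \<longlonglongrightarrow> k x"
        unfolding q_def by (simp add: divide_inverse)
    qed
    show "AE x in lborel. norm (q i x) \<le> M * indicator (cball 0 (R + 1)) x" for i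
    proof (rule AE_I2)
      fix x :: 'a
      define t where "t = inverse (real (Suc i))"
      have t: "0 < t" "t \<le> 1" by (auto simp: t_def field_simps)
      have qt: "q i x = (h (x + t *\<^sub>R b) - h x) / t" by (simp add: q_def t_def divide_inverse)
      show "norm (q i x) \<le> M * indicator (cball 0 (R + 1)) x"
      proof (cases "norm x \<le> R + 1")
        case True
        have "norm (h (x + t *\<^sub>R b) - h (x + 0 *\<^sub>R b)) \<le> M * norm (t - 0)"
          by (rule field_differentiable_bound[where S = UNIV, OF _ has_partial_along_line[OF part]])
             (use M in auto)
        then show ?thesis using True t by (simp add: qt field_simps)
      next
        case False
        have "norm (t *\<^sub>R b) \<le> 1" using b t by simp
        then have "norm (x + t *\<^sub>R b) > R"
          using False norm_triangle_ineq4[of "x + t *\<^sub>R b" "t *\<^sub>R b"] by simp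
        then show ?thesis using False sh by (simp add: qt)
      qed
    qed
  qed
  then show ?thesis using q0 by (simp add: LIMSEQ_const_iff)
qed

text \<open>Positive exactly for 1 < s < 4, that is on the annulus 1 < |y| < 2 when
  \<open>s = y \<bullet> y\<close>. Squaring the positive part gives a continuous derivative, enough
  for a field that is differentiated once.\<close>

definition bump :: "real \<Rightarrow> real" where
  "bump s = (max 0 ((s - 1) * (4 - s)))\<^sup>2"

lemma DERIV_pos_part_sq: "((\<lambda>s::real. (max 0 s)\<^sup>2) has_real_derivative 2 * max 0 s) (at s)"
proof (cases s "0::real" rule: linorder_cases)
  case less
  have "((\<lambda>s::real. (max 0 s)\<^sup>2) has_real_derivative 0) (at s)"
  proof (rule DERIV_cong_ev[THEN iffD2, OF refl _ refl, of _ "\<lambda>_. 0"])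
    show "\<forall>\<^sub>F x in nhds s. (max 0 x)\<^sup>2 = 0"
      using eventually_nhds_in_open[of "{..<0}" s] less by (auto elim!: eventually_mono)
  qed simp
  then show ?thesis using less by simp
next
  case equal
  have "((\<lambda>h::real. max 0 h) \<longlongrightarrow> max 0 0) (at 0)"
    by (intro tendsto_intros)
  then have "((\<lambda>h::real. (max 0 h)\<^sup>2 / h) \<longlongrightarrow> 0) (at 0)"
    by (rule tendsto_eq_rhs[OF Lim_transform_eventually])
       (auto simp: max_def power2_eq_square intro!: always_eventually)
  then show ?thesis using equal by (simp add: DERIV_def)
next
  case greater
  have "((\<lambda>s::real. (max 0 s)\<^sup>2) has_real_derivative 2 * s) (at s)"
  proof (rule DERIV_cong_ev[THEN iffD2, OF refl _ refl, of _ "\<lambda>s. s\<^sup>2"])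
    show "\<forall>\<^sub>F x in nhds s. (max 0 x)\<^sup>2 = x\<^sup>2"
      using eventually_nhds_in_open[of "{0<..}" s] greater by (auto elim!: eventually_mono)
  qed (auto intro!: derivative_eq_intros)
  then show ?thesis using greater by simp
qed

definition bump' :: "real \<Rightarrow> real" where
  "bump' s = 2 * max 0 ((s - 1) * (4 - s)) * (5 - 2 * s)"

lemma DERIV_bump: "(bump has_real_derivative bump' s) (at s)"
  unfolding bump_def bump'_def
  by (rule DERIV_chain2[OF DERIV_pos_part_sq]) (auto intro!: derivative_eq_intros)

lemma continuous_bump: "continuous_on A bump" "continuous_on A bump'"
  unfolding bump_def[abs_def] bump'_def[abs_def] by (intro continuous_intros)+

lemma bump_nonneg: "bump s \<ge> 0"
  by (simp add: bump_def)

lemma bump_outside: "s \<le> 1 \<or> 4 \<le> s \<Longrightarrow> bump s = 0" "s \<le> 1 \<or> 4 \<le> s \<Longrightarrow> bump' s = 0"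
  by (auto simp: bump_def bump'_def mult_nonpos_nonneg mult_nonneg_nonpos max_absorb1)

lemma bump_pos: "1 < s \<Longrightarrow> s < 4 \<Longrightarrow> bump s > 0"
  by (auto simp: bump_def)

text \<open>The quotient cancels the factor \<open>y \<bullet> y\<close> of
  \<open>radial_eigen\<close>; \<open>bump\<close> vanishes near the origin, so no singularity
  arises.\<close>

definition annulus_weight :: "'a::euclidean_space \<Rightarrow> real" where
  "annulus_weight y = bump (y \<bullet> y) / (y \<bullet> y)"

lemma norm_gt_2_imp: "norm y > 2 \<Longrightarrow> y \<bullet> y \<ge> (4::real)"
  using power_mono[of 2 "norm y" 2] by (simp add: power2_norm_eq_inner)

lemma continuous_on_UNIV_glue:
  fixes h :: "'a::euclidean_space \<Rightarrow> real"
  assumes "continuous_on (-{0}) h" "\<And>y. y \<bullet> y < 1 \<Longrightarrow> h y = 0"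
  shows "continuous_on UNIV h"
proof -
  have op: "open {y::'a. y \<bullet> y < 1}"
    by (intro open_Collect_less continuous_intros)
  have "continuous_on {y::'a. y \<bullet> y < 1} h"
    by (rule continuous_on_eq[of _ "\<lambda>_. 0"]) (use assms(2) in auto)
  then have "continuous_on (-{0} \<union> {y. y \<bullet> y < 1}) h"
    using assms(1) op by (intro continuous_on_open_Un) auto
  moreover have "-{0} \<union> {y::'a. y \<bullet> y < 1} = UNIV" by auto
  ultimately show ?thesis by simp
qed

lemma annulus_weight_continuous:
  fixes F :: "'a::euclidean_space \<Rightarrow> real"
  assumes "continuous_on (-{0}) F"
  shows "continuous_on UNIV (\<lambda>y. annulus_weight y * F y)"
  by (rule continuous_on_UNIV_glue)
     (auto simp: annulus_weight_def bump_outside intro!: continuous_intros assms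
        continuous_on_compose2[OF continuous_bump(1)[of UNIV]])

lemma annulus_weight_integrable:
  fixes F :: "'a::euclidean_space \<Rightarrow> real"
  assumes "continuous_on (-{0}) F"
  shows "integrable lborel (\<lambda>y. annulus_weight y * F y)"
  by (rule integrable_continuous_compact_support[OF annulus_weight_continuous[OF assms], of 2])
     (auto simp: annulus_weight_def bump_outside norm_gt_2_imp)

text \<open>For continuous functions of degree 0, polar coordinates turn this into a positive
  multiple of the L2 inner product on the sphere.\<close>

definition wip :: "('a::euclidean_space \<Rightarrow> real) \<Rightarrow> ('a \<Rightarrow> real) \<Rightarrow> real" where
  "wip F G = integral\<^sup>L lborel (\<lambda>y. annulus_weight y * (F y * G y))"

text \<open>The divergence of \<open>bump\<close> times (F grad G - G grad F) integrates to 0. The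
  derivative of \<open>bump\<close> meets radial derivatives only, which vanish by Euler's identity,
  and the rest is \<open>lam - mu\<close> times the integrand of \<open>wip\<close>.\<close>

lemma wip_radial_eigen_orthogonal:
  fixes F G :: "'a::euclidean_space \<Rightarrow> real"
  assumes F: "radial_eigen lam F" and G: "radial_eigen mu G" and neq: "lam \<noteq> mu"
  shows "wip F G = 0"
proof -
  have sF: "smooth_on (-{0}) F" and sG: "smooth_on (-{0}) G"
    using F G by (auto simp: radial_eigen_def)
  \<comment> \<open>\<open>h b\<close> is the component of the field in direction \<open>b\<close>,
    and \<open>k b\<close> is its contribution to the divergence.\<close>
  define h where "h b y = bump (y \<bullet> y) * (F y * partial b G y - G y * partial b F y)" for b y
  define k where "k b y = bump' (y \<bullet> y) * (2 * (y \<bullet> b)) * (F y * partial b G y - G y * partial b F y)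
     + bump (y \<bullet> y) * (F y * partial b (partial b G) y - G y * partial b (partial b F) y)" for b y
  have cont: "continuous_on (-{0}) F" "continuous_on (-{0}) G"
    "b \<in> Basis \<Longrightarrow> continuous_on (-{0}) (partial b F)" "b \<in> Basis \<Longrightarrow> continuous_on (-{0}) (partial b G)"
    "b \<in> Basis \<Longrightarrow> continuous_on (-{0}) (partial b (partial b F))"
    "b \<in> Basis \<Longrightarrow> continuous_on (-{0}) (partial b (partial b G))" for b
    using sF sG by (auto intro!: smooth_on_continuous smooth_on_partial)
  have ch: "continuous_on UNIV (h b)" if "b \<in> Basis" for b
    unfolding h_def
    by (rule continuous_on_UNIV_glue)
       (use that in \<open>auto simp: bump_outside intro!: continuous_intros cont
          continuous_on_compose2[OF continuous_bump(1)[of UNIV]]\<close>)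
  have ck: "continuous_on UNIV (k b)" if "b \<in> Basis" for b
    unfolding k_def
    by (rule continuous_on_UNIV_glue)
       (use that in \<open>auto simp: bump_outside intro!: continuous_intros cont
          continuous_on_compose2[OF continuous_bump(1)[of UNIV]] continuous_on_compose2[OF continuous_bump(2)[of UNIV]]\<close>)
  have part: "has_partial (h b) b y (k b y)" if "b \<in> Basis" for b y
  proof (cases "y = 0")
    case True
    have op: "open {y::'a. y \<bullet> y < 1}"
      by (intro open_Collect_less continuous_intros)
    have "has_partial (h b) b y 0 \<longleftrightarrow> has_partial (\<lambda>_. 0) b y 0"
      by (rule has_partial_cong[OF op]) (use True in \<open>auto simp: h_def bump_outside\<close>)
    then show ?thesis using True by (simp add: k_def bump_outside has_partial_const)
  next
    case False
    then have "y \<in> -{0}" by simp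
    note D = smooth_on_has_partial[OF sF that this] smooth_on_has_partial[OF sG that this]
      smooth_on_has_partial[OF smooth_on_partial[OF sF that] that this]
      smooth_on_has_partial[OF smooth_on_partial[OF sG that] that this]
    show ?thesis
      using has_partial_mult[OF has_partial_chain[OF has_partial_norm_sq[of b y] DERIV_bump]
          has_partial_diff[OF has_partial_mult[OF D(1,4)] has_partial_mult[OF D(2,3)]]]
      unfolding h_def k_def by (simp add: algebra_simps)
  qed
  have supp: "h b y = 0" "k b y = 0" if "norm y > 2" for b y
    using norm_gt_2_imp[OF that] by (auto simp: h_def k_def bump_outside)
  have int0: "integral\<^sup>L lborel (k b) = 0" if "b \<in> Basis" for b
    by (rule integral_partial_eq_0[OF part[OF that] that ch[OF that] ck[OF that] supp])
  have "integrable lborel (k b)" if "b \<in> Basis" for b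
    by (rule integrable_continuous_compact_support[OF ck[OF that] supp(2)])
  then have "integral\<^sup>L lborel (\<lambda>y. \<Sum>b\<in>Basis. k b y) = 0"
    using int0 by simp
  moreover have "(\<Sum>b\<in>Basis. k b y) = (lam - mu) * (annulus_weight y * (F y * G y))" for y
  proof (cases "y = 0")
    case True
    then show ?thesis by (simp add: k_def annulus_weight_def bump_outside)
  next
    case False
    have eF: "(\<Sum>b\<in>Basis. (y \<bullet> b) * partial b F y) = 0" and eG: "(\<Sum>b\<in>Basis. (y \<bullet> b) * partial b G y) = 0"
      using euler_identity[OF _ _ False] F G by (auto simp: radial_eigen_def)
    have "(\<Sum>b\<in>Basis. k b y) =
       2 * bump' (y \<bullet> y) * (F y * (\<Sum>b\<in>Basis. (y \<bullet> b) * partial b G y) - G y * (\<Sum>b\<in>Basis. (y \<bullet> b) * partial b F y))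
       + bump (y \<bullet> y) * (F y * euclid_laplacian G y - G y * euclid_laplacian F y)"
      unfolding k_def euclid_laplacian_def sum.distrib sum_distrib_left sum_subtractf[symmetric]
      by (simp add: sum_distrib_left sum.distrib[symmetric] algebra_simps)
    also have "\<dots> = bump (y \<bullet> y) * (F y * euclid_laplacian G y - G y * euclid_laplacian F y)"
      using eF eG by simp
    also have "\<dots> = annulus_weight y * (F y * ((y \<bullet> y) * euclid_laplacian G y) - G y * ((y \<bullet> y) * euclid_laplacian F y))"
      using False by (simp add: annulus_weight_def field_simps)
    also have "\<dots> = (lam - mu) * (annulus_weight y * (F y * G y))"
      using F G False by (simp add: radial_eigen_def algebra_simps)
    finally show ?thesis .
  qed
  ultimately have "(lam - mu) * wip F G = 0"
    unfolding wip_def by simp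
  then show ?thesis using neq by simp
qed

text \<open>The integrand is continuous and non-negative, so its non-zero set is open and
  negligible, hence empty. The ray through \<open>y\<close> meets the annulus, where the weight is
  positive.\<close>

lemma wip_self_eq_0:
  fixes F :: "'a::euclidean_space \<Rightarrow> real"
  assumes F: "continuous_on (-{0}) F" "\<And>r y. r > 0 \<Longrightarrow> F (r *\<^sub>R y) = F y" and "wip F F = 0" "y \<noteq> 0"
  shows "F y = 0"
proof (rule ccontr)
  assume "F y \<noteq> 0"
  define k where "k z = annulus_weight z * (F z * F z)" for z
  have c: "continuous_on UNIV k" unfolding k_def
    by (rule annulus_weight_continuous) (intro continuous_intros F)
  have nn: "k z \<ge> 0" for z by (simp add: k_def annulus_weight_def bump_nonneg)
  have "integrable lborel k" unfolding k_def
    by (rule annulus_weight_integrable) (intro continuous_intros F)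
  then have "AE z in lborel. k z = 0"
    using integral_nonneg_eq_0_iff_AE[of lborel k] nn assms(3) unfolding wip_def k_def[symmetric] by simp
  then have "negligible {z. k z \<noteq> 0}"
    unfolding negligible_iff_null_sets eventually_ae_filter
    by (auto simp: null_sets_completionI intro: null_sets_completion_subset)
  moreover have "open {z. k z \<noteq> 0}"
    by (intro open_Collect_neq c continuous_intros)
  ultimately have empty: "{z. k z \<noteq> 0} = {}"
    using open_not_negligible by blast
  \<comment> \<open>The factor 3/2 is a radius strictly between 1 and 2.\<close>
  define z where "z = (3/2 / norm y) *\<^sub>R y"
  have zz: "z \<bullet> z = 9/4"
    using assms(4) by (simp add: z_def power2_norm_eq_inner[symmetric] power2_eq_square)
  have "F z = F y"
    using F(2)[of "3/2 / norm y" y] assms(4) unfolding z_def by simp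
  then have "k z \<noteq> 0"
    using \<open>F y \<noteq> 0\<close> bump_pos[of "9/4"] unfolding k_def annulus_weight_def zz by simp
  with empty show False by blast
qed

section \<open>Polynomials, the Laplacian and orthogonal projection\<close>

text \<open>Real polynomials of total degree below \<open>j\<close>. The strict bound makes
  \<open>poly_lt 0\<close> the zero space, and the part of degree exactly \<open>j\<close> can be
  read as \<open>poly_lt (Suc j)\<close> modulo \<open>poly_lt j\<close>.\<close>

inductive poly_lt :: "nat \<Rightarrow> ('v::euclidean_space \<Rightarrow> real) \<Rightarrow> bool" where
  zero: "poly_lt 0 (\<lambda>_. 0)"
| const: "poly_lt (Suc 0) (\<lambda>_. c)"
| add: "poly_lt j f \<Longrightarrow> poly_lt j g \<Longrightarrow> poly_lt j (\<lambda>v. f v + g v)"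
| scale: "poly_lt j f \<Longrightarrow> poly_lt j (\<lambda>v. c * f v)"
| coord: "poly_lt j f \<Longrightarrow> b \<in> Basis \<Longrightarrow> poly_lt (Suc j) (\<lambda>v. (v \<bullet> b) * f v)"
| Suc: "poly_lt j f \<Longrightarrow> poly_lt (Suc j) f"

lemma poly_lt_mono: "poly_lt i f \<Longrightarrow> i \<le> j \<Longrightarrow> poly_lt j f"
  by (induction j) (auto simp: le_Suc_eq intro: poly_lt.Suc)

lemma poly_lt_0: "poly_lt 0 f \<Longrightarrow> f = (\<lambda>_. 0)"
  by (induction "0::nat" f rule: poly_lt.induct) auto

lemma poly_lt_zero: "poly_lt j (\<lambda>_. 0)"
  using poly_lt_mono[OF poly_lt.zero] by simp

lemma poly_lt_diff: "poly_lt j f \<Longrightarrow> poly_lt j g \<Longrightarrow> poly_lt j (\<lambda>v. f v - g v)"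
  using poly_lt.add[OF _ poly_lt.scale[of j g "-1"]] by simp

lemma poly_lt_sum: "(\<And>i. i \<in> I \<Longrightarrow> poly_lt j (f i)) \<Longrightarrow> poly_lt j (\<lambda>v. \<Sum>i\<in>I. f i v)"
  by (induction I rule: infinite_finite_induct) (auto intro: poly_lt_zero poly_lt.add)

lemma poly_lt_linear_mult:
  assumes "poly_lt j f"
  shows "poly_lt (Suc j) (\<lambda>v. (l \<bullet> v) * f v)"
proof -
  have "(\<lambda>v. (l \<bullet> v) * f v) = (\<lambda>v. \<Sum>b\<in>Basis. (l \<bullet> b) * ((v \<bullet> b) * f v))"
    by (subst euclidean_inner) (simp add: sum_distrib_right sum_distrib_left mult_ac)
  then show ?thesis
    using assms by (auto intro!: poly_lt_sum poly_lt.scale poly_lt.coord)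
qed

lemma poly_lt_mult:
  assumes "poly_lt i f" "poly_lt j g"
  shows "poly_lt (i + j) (\<lambda>v. f v * g v)"
  using assms(1)
proof (induction rule: poly_lt.induct)
  case zero
  then show ?case by (simp add: poly_lt_zero)
next
  case (const c)
  then show ?case using assms(2) by (auto intro: poly_lt.scale poly_lt.Suc)
next
  case (add i f f')
  then show ?case using poly_lt.add[OF add.IH] by (simp add: distrib_right)
next
  case (scale i f c)
  then show ?case using poly_lt.scale[OF scale.IH, of c] by (simp add: mult.assoc)
next
  case (coord i f b)
  then show ?case using poly_lt.coord[OF coord.IH, of b] by (simp add: mult.assoc)
next
  case (Suc i f)
  then show ?case by (auto intro: poly_lt.Suc)
qed

text \<open>Bridge from the Stone-Weierstrass theorem, whose polynomials carry no degree.\<close>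

lemma real_polynomial_function_imp_poly_lt:
  "real_polynomial_function f \<Longrightarrow> \<exists>j. poly_lt j f"
proof (induction rule: real_polynomial_function.induct)
  case (linear f)
  then interpret bounded_linear f .
  have "f v = (\<Sum>b\<in>Basis. f b * ((v \<bullet> b) * 1))" for v
    by (subst euclidean_representation[of v, symmetric], subst sum)
       (simp add: scaleR mult.commute)
  then have "f = (\<lambda>v. \<Sum>b\<in>Basis. f b * ((v \<bullet> b) * 1))" by blast
  moreover have "poly_lt (Suc (Suc 0)) (\<lambda>v. \<Sum>b\<in>Basis. f b * ((v \<bullet> b) * 1))"
    by (intro poly_lt_sum poly_lt.scale poly_lt.coord poly_lt.const)
  ultimately show ?case by metis
next
  case (const c)
  then show ?case using poly_lt.const by blast
next
  case (add f g)
  then obtain i j where "poly_lt i f" "poly_lt j g" by blast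
  then show ?case
    using poly_lt.add[OF poly_lt_mono[of i f "max i j"] poly_lt_mono[of j g "max i j"]] by auto
next
  case (mult f g)
  then show ?case using poly_lt_mult by blast
qed

lemma poly_lt_on_line:
  assumes "poly_lt j f"
  shows "\<exists>q. \<forall>t. f (v + t *\<^sub>R w) = poly q t"
  using assms
proof (induction rule: poly_lt.induct)
  case zero
  show ?case by (rule exI[of _ 0]) simp
next
  case (const c)
  show ?case by (rule exI[of _ "[:c:]"]) simp
next
  case (add j f g)
  then show ?case by (metis poly_add)
next
  case (scale j f c)
  then show ?case by (metis poly_smult)
next
  case (coord j f b)
  then obtain q where "\<And>t. f (v + t *\<^sub>R w) = poly q t" by blast
  then show ?case
    by (intro exI[of _ "[:v \<bullet> b, w \<bullet> b:] * q"]) (simp add: inner_add_left algebra_simps)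
next
  case (Suc j f)
  then show ?case by blast
qed

text \<open>On the line from a point of \<open>U\<close> to any \<open>w\<close> the function is a
  univariate polynomial with an interval of zeros.\<close>

lemma poly_lt_vanish_on_open:
  assumes "poly_lt j f" "open U" "U \<noteq> {}" "\<And>v. v \<in> U \<Longrightarrow> f v = 0"
  shows "f = (\<lambda>_. 0)"
proof
  fix w
  obtain v where v: "v \<in> U" using assms(3) by blast
  obtain q where q: "\<And>t. f (v + t *\<^sub>R (w - v)) = poly q t"
    using poly_lt_on_line[OF assms(1)] by blast
  have "\<forall>\<^sub>F t in nhds 0. poly q t = 0"
    using eventually_line_in_open[OF assms(2) v, of "w - v"]
    by eventually_elim (use assms(4) in \<open>simp flip: q\<close>)
  then obtain d where d: "d > 0" "\<And>t. \<bar>t\<bar> < d \<Longrightarrow> poly q t = 0"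
    unfolding eventually_nhds_metric by (auto simp: dist_real_def)
  have "infinite {0<..<d}" using d(1) by (rule infinite_Ioo)
  moreover have "{0<..<d} \<subseteq> {t. poly q t = 0}" using d(2) by auto
  ultimately have "q = 0"
    using poly_roots_finite infinite_super by blast
  then show "f w = 0" using q[of 1] by simp
qed

section \<open>Calculus rules for the Laplacian off the origin\<close>

lemma laplacian_cong:
  assumes "\<And>z. z \<noteq> 0 \<Longrightarrow> F z = G z" "y \<noteq> 0" "smooth_on (-{0}) F"
  shows "euclid_laplacian F y = euclid_laplacian G y"
proof -
  have 1: "has_partial G b z (partial b F z)" if "b \<in> Basis" "z \<noteq> 0" for b z
    using has_partial_cong[of "-{0}" z F G b] assms(1) smooth_on_has_partial[OF assms(3) that(1)] that
    by auto
  have "has_partial (partial b G) b y (partial b (partial b F) y)" if "b \<in> Basis" for b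
    using has_partial_cong[of "-{0}" y "partial b G" "partial b F" b] has_partial_imp_partial[OF 1[OF that]]
      smooth_on_has_partial[OF smooth_on_partial[OF assms(3) that] that] assms(2) by auto
  then show ?thesis
    unfolding euclid_laplacian_def by (intro sum.cong refl) (metis has_partial_imp_partial)
qed

lemma laplacian_add:
  assumes "smooth_on (-{0}) F" "smooth_on (-{0}) G" "y \<noteq> 0"
  shows "euclid_laplacian (\<lambda>z. F z + G z) y = euclid_laplacian F y + euclid_laplacian G y"
proof -
  have 1: "partial b (\<lambda>z. F z + G z) z = partial b F z + partial b G z" if "b \<in> Basis" "z \<noteq> 0" for b z
    using that by (intro has_partial_imp_partial has_partial_add)
      (auto intro!: smooth_on_has_partial[of "-{0}"] assms)
  have "partial b (partial b (\<lambda>z. F z + G z)) y = partial b (partial b F) y + partial b (partial b G) y"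
    if b: "b \<in> Basis" for b
  proof (rule has_partial_imp_partial, subst has_partial_cong[of "-{0}" y _ "\<lambda>z. partial b F z + partial b G z"])
    show "has_partial (\<lambda>z. partial b F z + partial b G z) b y (partial b (partial b F) y + partial b (partial b G) y)"
      using b assms by (intro has_partial_add) (auto intro!: smooth_on_has_partial[of "-{0}"] smooth_on_partial)
  qed (use 1 b assms in auto)
  then show ?thesis
    unfolding euclid_laplacian_def by (simp add: sum.distrib)
qed

lemma laplacian_mult:
  assumes "smooth_on (-{0}) F" "smooth_on (-{0}) G" "y \<noteq> 0"
  shows "euclid_laplacian (\<lambda>z. F z * G z) y = G y * euclid_laplacian F y
     + 2 * (\<Sum>b\<in>Basis. partial b F y * partial b G y) + F y * euclid_laplacian G y"
proof -
  have 1: "partial b (\<lambda>z. F z * G z) z = partial b F z * G z + F z * partial b G z" if "b \<in> Basis" "z \<noteq> 0" for b z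
    using that by (intro has_partial_imp_partial has_partial_mult)
      (auto intro!: smooth_on_has_partial[of "-{0}"] assms)
  have "partial b (partial b (\<lambda>z. F z * G z)) y =
     G y * partial b (partial b F) y + 2 * (partial b F y * partial b G y) + F y * partial b (partial b G) y"
    if b: "b \<in> Basis" for b
  proof (rule has_partial_imp_partial,
      subst has_partial_cong[of "-{0}" y _ "\<lambda>z. partial b F z * G z + F z * partial b G z"])
    have "has_partial (\<lambda>z. partial b F z * G z + F z * partial b G z) b y
      ((partial b (partial b F) y * G y + partial b F y * partial b G y)
        + (partial b F y * partial b G y + F y * partial b (partial b G) y))"
      using b assms by (intro has_partial_add has_partial_mult)
        (auto intro!: smooth_on_has_partial[of "-{0}"] smooth_on_partial)
    then show "has_partial (\<lambda>z. partial b F z * G z + F z * partial b G z) b y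
      (G y * partial b (partial b F) y + 2 * (partial b F y * partial b G y) + F y * partial b (partial b G) y)"
      by (simp add: algebra_simps)
  qed (use 1 b assms in auto)
  then show ?thesis
    unfolding euclid_laplacian_def by (simp add: sum.distrib sum_distrib_left)
qed

lemma laplacian_const: "euclid_laplacian (\<lambda>_. c) y = 0"
proof -
  have "partial b (\<lambda>_. c) = (\<lambda>_. 0)" for b :: 'a and c
    using has_partial_imp_partial[OF has_partial_const] by blast
  then show ?thesis by (simp add: euclid_laplacian_def)
qed

lemma laplacian_scale:
  assumes "smooth_on (-{0}) F" "y \<noteq> 0"
  shows "euclid_laplacian (\<lambda>z. c * F z) y = c * euclid_laplacian F y"
proof -
  have "partial b (\<lambda>_. c) = (\<lambda>_. 0)" for b :: 'a
    using has_partial_imp_partial[OF has_partial_const] by blast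
  then show ?thesis
    using laplacian_mult[OF smooth_on_rat_fun[OF rat_fun.const] assms(1,2), of "\<lambda>_. c" c]
    by (simp add: laplacian_const)
qed

section \<open>The weighted inner product and orthogonal projection\<close>

lemma wip_add_right:
  assumes "continuous_on (-{0}) F" "continuous_on (-{0}) G" "continuous_on (-{0}) H"
  shows "wip F (\<lambda>y. G y + H y) = wip F G + wip F H"
proof -
  have "wip F (\<lambda>y. G y + H y) = integral\<^sup>L lborel (\<lambda>y. annulus_weight y * (F y * G y) + annulus_weight y * (F y * H y))"
    unfolding wip_def by (simp add: algebra_simps)
  also have "\<dots> = wip F G + wip F H"
    unfolding wip_def
    by (intro Bochner_Integration.integral_add annulus_weight_integrable continuous_intros assms)
  finally show ?thesis .
qed

lemma wip_scale_right: "wip F (\<lambda>y. c * G y) = c * wip F G"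
proof -
  have "(\<lambda>y. annulus_weight y * (F y * (c * G y))) = (\<lambda>y. c * (annulus_weight y * (F y * G y)))"
    by (auto simp: mult_ac)
  then show ?thesis unfolding wip_def by (simp only: integral_mult_right_zero)
qed

lemma wip_commute: "wip F G = wip G F"
  unfolding wip_def by (simp only: mult.commute[of "F _"])

lemma wip_diff_right:
  assumes "continuous_on (-{0}) F" "continuous_on (-{0}) G" "continuous_on (-{0}) H"
  shows "wip F (\<lambda>y. G y - H y) = wip F G - wip F H"
  using wip_add_right[OF assms(1,2), of "\<lambda>y. (-1) * H y"] wip_scale_right[of F "-1" H] assms(3)
  by (simp add: continuous_on_minus)

lemma wip_diff_left:
  assumes "continuous_on (-{0}) F" "continuous_on (-{0}) G" "continuous_on (-{0}) H"
  shows "wip (\<lambda>y. G y - H y) F = wip G F - wip H F"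
  using wip_diff_right[OF assms] by (simp add: wip_commute)

text \<open>The weighted square vanishes almost everywhere, and with it every weighted product.
  Functions supported off the annulus have norm 0, so a projection has to cope with null
  vectors.\<close>

lemma wip_radical:
  assumes "continuous_on (-{0}) F" "continuous_on (-{0}) G" "wip F F = 0"
  shows "wip G F = 0"
proof -
  have "AE y in lborel. annulus_weight y * (F y * F y) = 0"
    using integral_nonneg_eq_0_iff_AE[OF annulus_weight_integrable, of "\<lambda>y. F y * F y"] assms
    by (auto simp: wip_def annulus_weight_def bump_nonneg intro!: continuous_intros)
  then have "AE y in lborel. annulus_weight y * (G y * F y) = 0"
    by eventually_elim auto
  then show ?thesis
    unfolding wip_def by (rule integral_eq_zero_AE)
qed

text \<open>The third clause says that the projection lies in the span of \<open>S\<close>.\<close>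

lemma wip_projection:
  assumes "finite S" and "\<And>s. s \<in> S \<Longrightarrow> s \<in> M"
    and cont: "\<And>s. s \<in> M \<Longrightarrow> continuous_on (-{0}) s"
    and zero: "(\<lambda>_. 0) \<in> M"
    and comb: "\<And>s t c. s \<in> M \<Longrightarrow> t \<in> M \<Longrightarrow> (\<lambda>y. s y + c * t y) \<in> M"
    and "continuous_on (-{0}) F"
  shows "\<exists>G\<in>M. (\<forall>s\<in>S. wip (\<lambda>y. F y - G y) s = 0)
     \<and> (\<forall>X. continuous_on (-{0}) X \<longrightarrow> (\<forall>s\<in>S. wip X s = 0) \<longrightarrow> wip X G = 0)"
  using assms(1,2,6)
proof (induction S arbitrary: F rule: finite_induct)
  case empty
  show ?case by (rule bexI[OF _ zero]) (simp add: wip_def)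
next
  case (insert s S)
  have sM: "s \<in> M" using insert by auto
  obtain G where G: "G \<in> M" "\<And>t. t \<in> S \<Longrightarrow> wip (\<lambda>y. F y - G y) t = 0"
      "\<And>X. continuous_on (-{0}) X \<Longrightarrow> \<forall>t\<in>S. wip X t = 0 \<Longrightarrow> wip X G = 0"
    using insert.IH[of F] insert.prems by auto
  obtain H where H: "H \<in> M" "\<And>t. t \<in> S \<Longrightarrow> wip (\<lambda>y. s y - H y) t = 0"
      "\<And>X. continuous_on (-{0}) X \<Longrightarrow> \<forall>t\<in>S. wip X t = 0 \<Longrightarrow> wip X H = 0"
    using insert.IH[of s] insert.prems cont[OF sM] by auto
  \<comment> \<open>Gram-Schmidt: \<open>s\<close> minus its projection to the earlier vectors,
    written with the factor -1 to match \<open>comb\<close>.\<close>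
  define s' where "s' = (\<lambda>y. s y + (-1) * H y)"
  have s': "s' \<in> M" unfolding s'_def by (rule comb[OF sM H(1)])
  define D where "D = (\<lambda>y. F y - G y)"
  have cD: "continuous_on (-{0}) D" unfolding D_def
    using insert.prems cont[OF G(1)] by (intro continuous_intros)
  \<comment> \<open>If \<open>wip s' s' = 0\<close>, division by zero gives \<open>c = 0\<close>,
    and \<open>wip_radical\<close> makes the numerator vanish as well.\<close>
  define c where "c = wip D s' / wip s' s'"
  define G' where "G' = (\<lambda>y. G y + c * s' y)"
  have G': "G' \<in> M" unfolding G'_def by (rule comb[OF G(1) s'])
  have FG': "(\<lambda>y. F y - G' y) = (\<lambda>y. D y - c * s' y)" by (auto simp: G'_def D_def)
  have cs: "continuous_on (-{0}) (\<lambda>y. c * s' y)" using cont[OF s'] by (intro continuous_intros)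
  have orth: "wip (\<lambda>y. F y - G' y) t = wip D t - c * wip s' t" if "t \<in> M" for t
    unfolding FG' using wip_diff_left[OF cont[OF that] cD cs] wip_scale_right[of t c s']
    by (simp add: wip_commute)
  have S0: "wip (\<lambda>y. F y - G' y) t = 0" if "t \<in> S" for t
    using orth[of t] G(2)[OF that] H(2)[OF that] insert.prems(1) that by (simp add: D_def s'_def)
  have "wip (\<lambda>y. F y - G' y) s' = 0"
    using orth[OF s'] wip_radical[OF cont[OF s'] cD] by (auto simp: c_def)
  \<comment> \<open>The span clause for \<open>H\<close> extends orthogonality from \<open>S\<close>
    to \<open>H\<close>, and then to \<open>s = s' + H\<close>.\<close>
  moreover have "wip (\<lambda>y. F y - G' y) H = 0"
    using S0 by (intro H(3)) (auto intro!: continuous_intros insert.prems cont[OF G'])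
  moreover have seq: "s = (\<lambda>y. s' y + H y)" by (auto simp: s'_def)
  have "wip X s = wip X s' + wip X H" if "continuous_on (-{0}) X" for X
    by (subst seq, rule wip_add_right[OF that cont[OF s'] cont[OF H(1)]])
  note split = this
  ultimately have "wip (\<lambda>y. F y - G' y) s = 0"
    by (subst split) (auto intro!: continuous_intros insert.prems cont[OF G'])
  moreover have "wip X G' = 0" if X: "continuous_on (-{0}) X" "\<forall>t\<in>insert s S. wip X t = 0" for X
  proof -
    have "wip X s' = 0" using split[OF X(1)] H(3)[OF X(1)] X(2) by simp
    then show ?thesis
      unfolding G'_def using wip_add_right[OF X(1) cont[OF G(1)] cs] G(3)[OF X(1)] X(2)
      by (simp add: wip_scale_right)
  qed
  ultimately show ?case using S0 G' by (intro bexI[of _ G']) auto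
qed

section \<open>Quadratic invariants\<close>

text \<open>The setting shared by both groups, with the groups forgotten. \<open>Q b\<close> is the
  self-adjoint operator of the quadratic form \<open>p y \<bullet> b\<close>;
  \<open>prod_closed\<close> makes products of gradients expressible by the invariants, so that
  polynomials in \<open>p\<close> are stable under the Laplacian; \<open>image_open\<close> makes a
  polynomial recoverable from its values on the sphere.\<close>

locale quadratic_invariants =
  fixes p :: "'a::euclidean_space \<Rightarrow> 'v::euclidean_space" and Q :: "'v \<Rightarrow> 'a \<Rightarrow> 'a"
  assumes lin: "\<And>b. b \<in> Basis \<Longrightarrow> linear (Q b)"
    and self_adjoint: "\<And>b x y. b \<in> Basis \<Longrightarrow> Q b x \<bullet> y = x \<bullet> Q b y"
    and p_eq: "\<And>b y. b \<in> Basis \<Longrightarrow> p y \<bullet> b = y \<bullet> Q b y"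
    and prod_closed: "\<And>b c. b \<in> Basis \<Longrightarrow> c \<in> Basis \<Longrightarrow>
        \<exists>l0 l. \<forall>y. Q b y \<bullet> Q c y = l0 * (y \<bullet> y) + l \<bullet> p y"
    and image_open: "\<exists>U. open U \<and> U \<noteq> {} \<and> U \<subseteq> p ` sphere 0 1"
begin

text \<open>The degree-0 extension of \<open>p\<close> from the unit sphere.\<close>

definition u :: "'a \<Rightarrow> 'v" where
  "u y = inverse (y \<bullet> y) *\<^sub>R p y"

lemma p_scale: "p (r *\<^sub>R y) = r\<^sup>2 *\<^sub>R p y"
  by (rule euclidean_eqI) (simp add: p_eq linear_cmul[OF lin] power2_eq_square)

lemma u_scale: "r > 0 \<Longrightarrow> u (r *\<^sub>R y) = u y"
  unfolding u_def p_scale by (simp add: power2_eq_square divide_simps)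

lemma u_unit: "norm x = 1 \<Longrightarrow> u x = p x"
  unfolding u_def by (simp flip: power2_norm_eq_inner)

lemma u_normalize: "y \<noteq> 0 \<Longrightarrow> u y = p (inverse (norm y) *\<^sub>R y)"
  using u_scale[of "inverse (norm y)" y] u_unit[of "inverse (norm y) *\<^sub>R y"] by simp

lemma u_comp: "b \<in> Basis \<Longrightarrow> u y \<bullet> b = inverse (y \<bullet> y) * (y \<bullet> Q b y)"
  by (simp add: u_def p_eq)

lemma poly_zero_on_sphere:
  assumes "poly_lt j g" "\<And>y. y \<noteq> 0 \<Longrightarrow> g (u y) = 0"
  shows "g = (\<lambda>_. 0)"
proof -
  obtain U where U: "open U" "U \<noteq> {}" "U \<subseteq> p ` sphere 0 1" using image_open by blast
  show ?thesis
  proof (rule poly_lt_vanish_on_open[OF assms(1) U(1,2)])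
    fix v assume "v \<in> U"
    then obtain x where "norm x = 1" "v = p x" using U(3) by auto
    moreover from this have "x \<noteq> 0" by auto
    ultimately show "g v = 0" using assms(2)[of x] u_unit[of x] by simp
  qed
qed

lemma rat_fun_u:
  assumes "b \<in> Basis"
  shows "rat_fun (\<lambda>y. u y \<bullet> b)"
proof -
  have "(\<lambda>y. u y \<bullet> b) = (\<lambda>y. inverse (y \<bullet> y) * (\<Sum>i\<in>Basis. (y \<bullet> i) * (y \<bullet> Q b i)))"
  proof
    fix y
    have "y \<bullet> Q b y = (\<Sum>i\<in>Basis. (y \<bullet> i) * (y \<bullet> Q b i))"
      by (subst (2) euclidean_representation[of y, symmetric])
         (simp add: linear_sum[OF lin[OF assms]] linear_cmul[OF lin[OF assms]] inner_sum_right)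
    then show "u y \<bullet> b = inverse (y \<bullet> y) * (\<Sum>i\<in>Basis. (y \<bullet> i) * (y \<bullet> Q b i))"
      by (simp add: u_comp assms)
  qed
  then show ?thesis by (auto intro!: rat_fun.intros rat_fun_sum)
qed

lemma rat_fun_poly_u: "poly_lt j g \<Longrightarrow> rat_fun (\<lambda>y. g (u y))"
  by (induction rule: poly_lt.induct) (auto intro: rat_fun.intros rat_fun_u)

lemma smooth_poly_u: "poly_lt j g \<Longrightarrow> smooth_on (-{0}) (\<lambda>y. g (u y))"
  by (rule smooth_on_rat_fun[OF rat_fun_poly_u]) auto

lemma continuous_poly_u: "poly_lt j g \<Longrightarrow> continuous_on (-{0}) (\<lambda>y. g (u y))"
  by (rule rat_fun_continuous_on[OF rat_fun_poly_u])

text \<open>The gradient of \<open>u y \<bullet> b\<close>, from the quotient rule for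
  \<open>y \<bullet> Q b y\<close> over \<open>y \<bullet> y\<close>; the second term removes the
  radial component.\<close>

definition grad :: "'v \<Rightarrow> 'a \<Rightarrow> 'a" where
  "grad b y = (2 * inverse (y \<bullet> y)) *\<^sub>R Q b y - (2 * inverse (y \<bullet> y) * (u y \<bullet> b)) *\<^sub>R y"

lemma has_partial_quadratic:
  assumes "b \<in> Basis"
  shows "has_partial (\<lambda>y. y \<bullet> Q b y) i y (2 * (Q b y \<bullet> i))"
proof -
  have "(y + t *\<^sub>R i) \<bullet> Q b (y + t *\<^sub>R i) = y \<bullet> Q b y + t * (2 * (Q b y \<bullet> i)) + t\<^sup>2 * (i \<bullet> Q b i)" for t
    using self_adjoint[OF assms, of y i] self_adjoint[OF assms, of i y]
    by (simp add: linear_add[OF lin[OF assms]] linear_cmul[OF lin[OF assms]] inner_add_left inner_add_right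
        inner_commute algebra_simps power2_eq_square)
  then show ?thesis
    unfolding has_partial_def by (auto intro!: derivative_eq_intros)
qed

lemma has_partial_u:
  assumes "b \<in> Basis" "y \<noteq> 0"
  shows "has_partial (\<lambda>y. u y \<bullet> b) i y (grad b y \<bullet> i)"
proof -
  have eq: "(\<lambda>y. u y \<bullet> b) = (\<lambda>y. inverse (y \<bullet> y) * (y \<bullet> Q b y))"
    using u_comp[OF assms(1)] by blast
  show ?thesis
    using has_partial_mult[OF has_partial_inverse_norm_sq[OF assms(2)] has_partial_quadratic[OF assms(1)], of i]
    unfolding eq grad_def by (simp add: u_comp[OF assms(1)] inner_diff_left algebra_simps)
qed

lemma grad_orthogonal: "b \<in> Basis \<Longrightarrow> y \<noteq> 0 \<Longrightarrow> grad b y \<bullet> y = 0"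
  using self_adjoint[of b y y] by (simp add: grad_def inner_diff_left u_comp)

text \<open>Since \<open>grad b y\<close> is orthogonal to \<open>y\<close>, only the
  \<open>Q c y\<close> part of the other gradient contributes.\<close>

lemma grad_inner:
  assumes "b \<in> Basis" "c \<in> Basis" "y \<noteq> 0"
  shows "(y \<bullet> y) * (grad b y \<bullet> grad c y) = 4 * (inverse (y \<bullet> y) * (Q b y \<bullet> Q c y) - (u y \<bullet> b) * (u y \<bullet> c))"
proof -
  have "grad b y \<bullet> grad c y = grad b y \<bullet> ((2 * inverse (y \<bullet> y)) *\<^sub>R Q c y)"
    using grad_orthogonal[OF assms(1,3)] by (simp add: grad_def[of c] inner_diff_right)
  also have "\<dots> = 4 * inverse (y \<bullet> y) * (inverse (y \<bullet> y) * (Q b y \<bullet> Q c y) - (u y \<bullet> b) * (inverse (y \<bullet> y) * (y \<bullet> Q c y)))"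
    unfolding grad_def by (simp add: inner_diff_left algebra_simps)
  finally have "(y \<bullet> y) * (grad b y \<bullet> grad c y) = ((y \<bullet> y) * inverse (y \<bullet> y))
      * (4 * (inverse (y \<bullet> y) * (Q b y \<bullet> Q c y) - (u y \<bullet> b) * (inverse (y \<bullet> y) * (y \<bullet> Q c y))))"
    by (simp only: mult_ac)
  then show ?thesis
    using assms(3) by (simp add: u_comp[OF assms(2)])
qed

text \<open>The trace of \<open>Q b\<close> enters as a constant, hence in lower degree; the
  coefficient \<open>2 * DIM('a)\<close> equals \<open>lam 1\<close>.\<close>

lemma laplacian_u:
  assumes b: "b \<in> Basis" and y: "y \<noteq> 0"
  shows "(y \<bullet> y) * euclid_laplacian (\<lambda>y. u y \<bullet> b) y
     = 2 * (\<Sum>i\<in>Basis. Q b i \<bullet> i) - 2 * DIM('a) * (u y \<bullet> b)"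
proof -
  define w where "w = inverse (y \<bullet> y)"
  \<comment> \<open>The second derivative along \<open>i\<close> by the product rule, arranged so
    that summation over \<open>Basis\<close> turns each term into the trace, an inner product or a
    multiple of the dimension.\<close>
  define D where "D i = 2 * (w * (Q b i \<bullet> i)) - 4 * w * w * ((Q b y \<bullet> i) * (y \<bullet> i))
     + 4 * w * w * (u y \<bullet> b) * ((y \<bullet> i) * (y \<bullet> i)) - 2 * w * ((grad b y \<bullet> i) * (y \<bullet> i))
     - 2 * w * (u y \<bullet> b)" for i
  have p1: "partial i (\<lambda>y. u y \<bullet> b) z = grad b z \<bullet> i" if "z \<noteq> 0" for i z
    using has_partial_imp_partial[OF has_partial_u[OF b that]] .
  have "partial i (partial i (\<lambda>y. u y \<bullet> b)) y = D i" if i: "i \<in> Basis" for i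
  proof (rule has_partial_imp_partial, subst has_partial_cong[of "-{0}" y _ "\<lambda>z. grad b z \<bullet> i"])
    have Qi: "has_partial (\<lambda>z. Q b z \<bullet> i) i y (Q b i \<bullet> i)"
    proof -
      have "(\<lambda>z. Q b z \<bullet> i) = (\<lambda>z. z \<bullet> Q b i)" using self_adjoint[OF b] by blast
      then show ?thesis
        using has_partial_coord[where b = i and c = "Q b i" and y = y] by (simp only: inner_commute[of i "Q b i"])
    qed
    have E1: "has_partial (\<lambda>z. 2 * (inverse (z \<bullet> z) * (Q b z \<bullet> i)) - 2 * (inverse (z \<bullet> z) * ((u z \<bullet> b) * (z \<bullet> i)))) i y
      (2 * ((- 2 * (y \<bullet> i) * (w * w)) * (Q b y \<bullet> i) + w * (Q b i \<bullet> i))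
       - 2 * ((- 2 * (y \<bullet> i) * (w * w)) * ((u y \<bullet> b) * (y \<bullet> i))
          + w * ((grad b y \<bullet> i) * (y \<bullet> i) + (u y \<bullet> b) * (i \<bullet> i))))"
      unfolding w_def by (intro has_partial_diff has_partial_cmult has_partial_mult has_partial_inverse_norm_sq[OF y]
          Qi has_partial_u[OF b y] has_partial_coord)
    have E2: "(\<lambda>z. 2 * (inverse (z \<bullet> z) * (Q b z \<bullet> i)) - 2 * (inverse (z \<bullet> z) * ((u z \<bullet> b) * (z \<bullet> i))))
        = (\<lambda>z. grad b z \<bullet> i)"
      by (auto simp: grad_def inner_diff_left)
    have ii: "i \<bullet> i = 1" using i by (simp add: inner_Basis)
    have "2 * ((- 2 * Y * (w * w)) * q + w * r) - 2 * ((- 2 * Y * (w * w)) * (a * Y) + w * (g * Y + a * 1))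
      = 2 * (w * r) - 4 * w * w * (q * Y) + 4 * w * w * a * (Y * Y) - 2 * w * (g * Y) - 2 * w * a"
      for Y q r a g :: real
      by (simp add: algebra_simps)
    then show "has_partial (\<lambda>z. grad b z \<bullet> i) i y (D i)"
      using E1 unfolding E2 ii D_def by (simp only:)
  qed (use p1 y in auto)
  then have "euclid_laplacian (\<lambda>y. u y \<bullet> b) y = (\<Sum>i\<in>Basis. D i)"
    unfolding euclid_laplacian_def by simp
  also have "\<dots> = 2 * w * (\<Sum>i\<in>Basis. Q b i \<bullet> i) - 4 * w * w * (\<Sum>i\<in>Basis. (Q b y \<bullet> i) * (y \<bullet> i))
     + 4 * w * w * (u y \<bullet> b) * (\<Sum>i\<in>Basis. (y \<bullet> i) * (y \<bullet> i)) - 2 * w * (\<Sum>i\<in>Basis. (grad b y \<bullet> i) * (y \<bullet> i))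
     - DIM('a) * (2 * w * (u y \<bullet> b))"
    unfolding D_def by (simp add: sum_subtractf sum.distrib sum_distrib_left mult.assoc)
  also have "\<dots> = 2 * w * (\<Sum>i\<in>Basis. Q b i \<bullet> i) - 4 * w * w * (Q b y \<bullet> y)
     + 4 * w * w * (u y \<bullet> b) * (y \<bullet> y) - 2 * w * (grad b y \<bullet> y) - DIM('a) * (2 * w * (u y \<bullet> b))"
    by (simp only: euclidean_inner[symmetric])
  finally have E: "euclid_laplacian (\<lambda>y. u y \<bullet> b) y = 2 * w * (\<Sum>i\<in>Basis. Q b i \<bullet> i) - 4 * w * w * (Q b y \<bullet> y)
     + 4 * w * w * (u y \<bullet> b) * (y \<bullet> y) - 2 * w * (grad b y \<bullet> y) - DIM('a) * (2 * w * (u y \<bullet> b))" .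
  have "(u y \<bullet> b) * (y \<bullet> y) = Q b y \<bullet> y"
    using y self_adjoint[OF b, of y y] by (simp add: u_comp[OF b])
  then have E': "4 * w * w * (u y \<bullet> b) * (y \<bullet> y) = 4 * w * w * (Q b y \<bullet> y)"
    by (simp only: mult.assoc)
  have "euclid_laplacian (\<lambda>y. u y \<bullet> b) y = w * (2 * (\<Sum>i\<in>Basis. Q b i \<bullet> i) - 2 * DIM('a) * (u y \<bullet> b))"
    unfolding E E' grad_orthogonal[OF b y] by (simp add: right_diff_distrib)
  moreover have "(y \<bullet> y) * w = 1" using y by (simp add: w_def)
  ultimately show ?thesis by (simp only: mult.assoc[symmetric] mult_1_left)
qed

text \<open>The eigenvalue l(l + d - 2) of the spherical harmonics of degree l = 2j: degree
  \<open>j\<close> in the quadratic invariants is degree \<open>2j\<close> in the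
  coordinates.\<close>

definition lam :: "nat \<Rightarrow> real" where
  "lam j = 2 * real j * (2 * real j + DIM('a) - 2)"

lemma lam_strict_mono: "i < j \<Longrightarrow> lam i < lam j"
proof (rule lift_Suc_mono_less[of lam])
  fix n
  have "lam (Suc n) - lam n = 2 * DIM('a) + 8 * n"
    unfolding lam_def by (simp add: algebra_simps)
  then show "lam n < lam (Suc n)" using DIM_positive[where 'a='a] by linarith
qed

lemma lam_inj: "lam i = lam j \<Longrightarrow> i = j"
  using lam_strict_mono[of i j] lam_strict_mono[of j i] by linarith

section \<open>Triangular action on polynomials in the invariants\<close>

definition gam :: "'v \<Rightarrow> ('v \<Rightarrow> real) \<Rightarrow> 'a \<Rightarrow> real" where
  "gam b g y = (y \<bullet> y) * (\<Sum>i\<in>Basis. (grad b y \<bullet> i) * partial i (\<lambda>z. g (u z)) y)"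

text \<open>On the unit sphere the carre du champ is \<open>\<Gamma>(u\<^sub>b, u\<^sub>c) = 4 (q\<^sub>b\<^sub>c(u) - u\<^sub>b u\<^sub>c)\<close> with \<open>q\<^sub>b\<^sub>c\<close> affine,
  so both \<open>\<Gamma>(u\<^sub>b, \<cdot>)\<close> and the Laplacian are triangular for the filtration by degree.\<close>

lemma gradient_poly:
  assumes "poly_lt j g" "b \<in> Basis"
  shows "\<exists>r. poly_lt j r \<and> (\<forall>y. y \<noteq> 0 \<longrightarrow>
     gam b g y = - 4 * (real j - 1) * (u y \<bullet> b) * g (u y) + r (u y))"
  using assms(1)
proof (induction rule: poly_lt.induct)
  case zero
  have "partial i (\<lambda>z. 0) y = 0" for i y :: 'a
    by (rule has_partial_imp_partial[OF has_partial_const])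
  then show ?case by (intro exI[of _ "\<lambda>_. 0"]) (simp add: gam_def poly_lt.zero)
next
  case (const c)
  have "partial i (\<lambda>z. c) y = 0" for i y :: 'a
    by (rule has_partial_imp_partial[OF has_partial_const])
  then show ?case by (intro exI[of _ "\<lambda>_. 0"]) (simp add: gam_def poly_lt.const)
next
  case (add j f g)
  obtain r s where rs: "poly_lt j r" "poly_lt j s"
    "\<And>y. y \<noteq> 0 \<Longrightarrow> gam b f y = - 4 * (real j - 1) * (u y \<bullet> b) * f (u y) + r (u y)"
    "\<And>y. y \<noteq> 0 \<Longrightarrow> gam b g y = - 4 * (real j - 1) * (u y \<bullet> b) * g (u y) + s (u y)" using add.IH by blast
  have "partial i (\<lambda>z. f (u z) + g (u z)) y = partial i (\<lambda>z. f (u z)) y + partial i (\<lambda>z. g (u z)) y"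
    if "i \<in> Basis" "y \<noteq> 0" for i y
    using that by (intro has_partial_imp_partial has_partial_add)
      (auto intro!: smooth_on_has_partial[of "-{0}"] smooth_poly_u add.hyps)
  then have E: "gam b (\<lambda>v. f v + g v) y = gam b f y + gam b g y" if "y \<noteq> 0" for y
    using that by (simp add: gam_def distrib_left sum.distrib)
  have "gam b (\<lambda>v. f v + g v) y = - 4 * (real j - 1) * (u y \<bullet> b) * (f (u y) + g (u y)) + (r (u y) + s (u y))" if "y \<noteq> 0" for y
    unfolding E[OF that] rs(3,4)[OF that] by (simp add: algebra_simps)
  then show ?case
    using rs(1,2) by (intro exI[of _ "\<lambda>v. r v + s v"]) (auto intro: poly_lt.add)
next
  case (scale j f c)
  obtain r where r: "poly_lt j r"
    "\<And>y. y \<noteq> 0 \<Longrightarrow> gam b f y = - 4 * (real j - 1) * (u y \<bullet> b) * f (u y) + r (u y)" using scale.IH by blast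
  have "partial i (\<lambda>z. c * f (u z)) y = c * partial i (\<lambda>z. f (u z)) y"
    if "i \<in> Basis" "y \<noteq> 0" for i y
    using that by (intro has_partial_imp_partial has_partial_cmult)
      (auto intro!: smooth_on_has_partial[of "-{0}"] smooth_poly_u scale.hyps)
  then have E: "gam b (\<lambda>v. c * f v) y = c * gam b f y" if "y \<noteq> 0" for y
    using that by (simp add: gam_def sum_distrib_left mult_ac)
  have "gam b (\<lambda>v. c * f v) y = - 4 * (real j - 1) * (u y \<bullet> b) * (c * f (u y)) + c * r (u y)" if "y \<noteq> 0" for y
    unfolding E[OF that] r(2)[OF that] by (simp add: algebra_simps)
  then show ?case
    using r(1) by (intro exI[of _ "\<lambda>v. c * r v"]) (auto intro: poly_lt.scale)
next
  \<comment> \<open>The new factor brings its own gradient product with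
    \<open>u y \<bullet> b\<close>, which is affine in \<open>u\<close> minus a product of two
    coordinates of \<open>u\<close>. That product moves the coefficient from
    \<open>-4 (j - 1)\<close> to \<open>-4 j\<close>.\<close>
  case (coord j f c)
  obtain r where r: "poly_lt j r"
    "\<And>y. y \<noteq> 0 \<Longrightarrow> gam b f y = - 4 * (real j - 1) * (u y \<bullet> b) * f (u y) + r (u y)" using coord.IH by blast
  obtain l0 l where l: "\<And>y. Q b y \<bullet> Q c y = l0 * (y \<bullet> y) + l \<bullet> p y"
    using prod_closed[OF assms(2) coord.hyps(2)] by blast
  have "partial i (\<lambda>z. (u z \<bullet> c) * f (u z)) y = (grad c y \<bullet> i) * f (u y) + (u y \<bullet> c) * partial i (\<lambda>z. f (u z)) y"
    if "i \<in> Basis" "y \<noteq> 0" for i y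
    using that by (intro has_partial_imp_partial has_partial_mult)
      (auto intro!: smooth_on_has_partial[of "-{0}"] smooth_poly_u coord.hyps has_partial_u)
  then have "gam b (\<lambda>v. (v \<bullet> c) * f v) y
     = ((y \<bullet> y) * (grad b y \<bullet> grad c y)) * f (u y)
      + (u y \<bullet> c) * gam b f y" if "y \<noteq> 0" for y
    using that
    by (simp add: gam_def euclidean_inner[of "grad b y" "grad c y"] sum_distrib_left sum_distrib_right
        sum.distrib distrib_left mult_ac)
  moreover have "(y \<bullet> y) * (grad b y \<bullet> grad c y) = 4 * (l0 + l \<bullet> u y - (u y \<bullet> b) * (u y \<bullet> c))" if "y \<noteq> 0" for y
    using that unfolding grad_inner[OF assms(2) coord.hyps(2) that] l u_def
    by (simp add: algebra_simps)
  ultimately have "gam b (\<lambda>v. (v \<bullet> c) * f v) y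
     = 4 * (l0 + l \<bullet> u y - (u y \<bullet> b) * (u y \<bullet> c)) * f (u y)
      + (u y \<bullet> c) * (- 4 * (real j - 1) * (u y \<bullet> b) * f (u y) + r (u y))" if "y \<noteq> 0" for y
    using r(2) that by simp
  then have "gam b (\<lambda>v. (v \<bullet> c) * f v) y = - 4 * (real (Suc j) - 1) * (u y \<bullet> b) * ((u y \<bullet> c) * f (u y))
      + ((4 * l0) * f (u y) + 4 * ((l \<bullet> u y) * f (u y)) + (u y \<bullet> c) * r (u y))" if "y \<noteq> 0" for y
    using that by (simp add: algebra_simps)
  moreover have "poly_lt (Suc j) (\<lambda>v. (4 * l0) * f v + 4 * ((l \<bullet> v) * f v) + (v \<bullet> c) * r v)"
    by (intro poly_lt.add poly_lt.scale poly_lt_linear_mult poly_lt.coord poly_lt.Suc[OF coord.hyps(1)]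
        coord.hyps r)
  ultimately show ?case by blast
next
  \<comment> \<open>A larger degree bound changes the prescribed coefficient by -4; the remainder
    absorbs the difference, a coordinate times \<open>f\<close>, which still fits into
    \<open>poly_lt (Suc j)\<close>.\<close>
  case (Suc j f)
  obtain r where r: "poly_lt j r"
    "\<And>y. y \<noteq> 0 \<Longrightarrow> gam b f y = - 4 * (real j - 1) * (u y \<bullet> b) * f (u y) + r (u y)" using Suc.IH by blast
  have "poly_lt (Suc j) (\<lambda>v. r v + 4 * ((v \<bullet> b) * f v))"
    by (intro poly_lt.add poly_lt.scale poly_lt.Suc[OF r(1)] poly_lt.coord Suc.hyps assms(2))
  moreover have "gam b f y = - 4 * (real (Suc j) - 1) * (u y \<bullet> b) * f (u y) + (r (u y) + 4 * ((u y \<bullet> b) * f (u y)))" if "y \<noteq> 0" for y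
    unfolding r(2)[OF that] by (simp add: algebra_simps)
  ultimately show ?case by blast
qed

definition lapl :: "('v \<Rightarrow> real) \<Rightarrow> 'a \<Rightarrow> real" where
  "lapl g y = (y \<bullet> y) * euclid_laplacian (\<lambda>z. g (u z)) y"

lemma lapl_add:
  "poly_lt i f \<Longrightarrow> poly_lt j g \<Longrightarrow> y \<noteq> 0 \<Longrightarrow> lapl (\<lambda>v. f v + g v) y = lapl f y + lapl g y"
  unfolding lapl_def using laplacian_add[OF smooth_poly_u smooth_poly_u] by (simp add: distrib_left)

lemma lapl_scale: "poly_lt i f \<Longrightarrow> y \<noteq> 0 \<Longrightarrow> lapl (\<lambda>v. c * f v) y = c * lapl f y"
  unfolding lapl_def using laplacian_scale[OF smooth_poly_u] by simp

lemma lapl_diff: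
  "poly_lt i f \<Longrightarrow> poly_lt j g \<Longrightarrow> y \<noteq> 0 \<Longrightarrow> lapl (\<lambda>v. f v - g v) y = lapl f y - lapl g y"
  using lapl_add[of i f j "\<lambda>v. (-1) * g v" y] lapl_scale[of j g y "-1"] poly_lt.scale[of j g "-1"] by simp

lemma lapl_sum:
  assumes "\<And>k. k \<in> K \<Longrightarrow> poly_lt j (f k)" "y \<noteq> 0"
  shows "lapl (\<lambda>v. \<Sum>k\<in>K. f k v) y = (\<Sum>k\<in>K. lapl (f k) y)"
  using assms(1)
proof (induction K rule: infinite_finite_induct)
  case (insert k K)
  have "poly_lt j (\<lambda>v. \<Sum>k\<in>K. f k v)" using insert.prems by (intro poly_lt_sum) auto
  then show ?case
    using insert assms(2) lapl_add[of j "f k" j "\<lambda>v. \<Sum>k\<in>K. f k v" y] by simp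
qed (simp_all add: lapl_def laplacian_const)

text \<open>By the product rule, one more coordinate factor adds to the eigenvalue \<open>2d\<close>
  from its own Laplacian and \<open>8 (j - 1)\<close> from the cross term, where d is
  \<open>DIM('a)\<close>; this is the increment of \<open>lam\<close>. The coefficient is formed
  with real subtraction, the degree of the remainder with truncated subtraction.\<close>

lemma laplacian_poly:
  assumes "poly_lt j g"
  shows "\<exists>s. poly_lt (j - 1) s \<and> (\<forall>y. y \<noteq> 0 \<longrightarrow>
     lapl g y = - (2 * (real j - 1) * (2 * (real j - 1) + DIM('a) - 2)) * g (u y) + s (u y))"
  using assms
proof (induction rule: poly_lt.induct)
  case zero
  then show ?case by (intro exI[of _ "\<lambda>_. 0"]) (simp add: lapl_def laplacian_const poly_lt.zero)
next
  case (const c)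
  then show ?case by (intro exI[of _ "\<lambda>_. 0"]) (simp add: lapl_def laplacian_const poly_lt.zero)
next
  case (add j f g)
  let ?m = "2 * (real j - 1) * (2 * (real j - 1) + DIM('a) - 2)"
  obtain r s where rs: "poly_lt (j - 1) r" "poly_lt (j - 1) s"
    "\<And>y. y \<noteq> 0 \<Longrightarrow> lapl f y = - ?m * f (u y) + r (u y)"
    "\<And>y. y \<noteq> 0 \<Longrightarrow> lapl g y = - ?m * g (u y) + s (u y)" using add.IH by blast
  have "lapl (\<lambda>v. f v + g v) y = - ?m * (f (u y) + g (u y)) + (r (u y) + s (u y))" if "y \<noteq> 0" for y
    unfolding lapl_add[OF add.hyps that] rs(3,4)[OF that] by (simp add: algebra_simps)
  then show ?case
    using poly_lt.add[OF rs(1,2)] by blast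
next
  case (scale j f c)
  let ?m = "2 * (real j - 1) * (2 * (real j - 1) + DIM('a) - 2)"
  obtain r where r: "poly_lt (j - 1) r"
    "\<And>y. y \<noteq> 0 \<Longrightarrow> lapl f y = - ?m * f (u y) + r (u y)" using scale.IH by blast
  have "lapl (\<lambda>v. c * f v) y = - ?m * (c * f (u y)) + c * r (u y)" if "y \<noteq> 0" for y
    unfolding lapl_scale[OF scale.hyps that] r(2)[OF that] by (simp add: algebra_simps)
  then show ?case
    using poly_lt.scale[OF r(1), of c] by blast
next
  case (coord j f c)
  let ?m = "2 * (real j - 1) * (2 * (real j - 1) + DIM('a) - 2)"
  let ?t = "\<Sum>i\<in>Basis. Q c i \<bullet> i"
  obtain s where s: "poly_lt (j - 1) s"
    "\<And>y. y \<noteq> 0 \<Longrightarrow> lapl f y = - ?m * f (u y) + s (u y)" using coord.IH by blast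
  obtain r where r: "poly_lt j r"
    "\<And>y. y \<noteq> 0 \<Longrightarrow> gam c f y = - 4 * (real j - 1) * (u y \<bullet> c) * f (u y) + r (u y)"
    using gradient_poly[OF coord.hyps] by blast
  \<comment> \<open>For \<open>j = 0\<close> the truncated \<open>j - 1\<close> is 0 again, so
    multiplication by a coordinate would overshoot the bound; there \<open>s\<close> is
    zero.\<close>
  have "poly_lt j (\<lambda>v. (v \<bullet> c) * s v)"
  proof (cases j)
    case 0
    then show ?thesis using s(1) poly_lt_0[of s] by (simp add: poly_lt.zero)
  next
    case (Suc k)
    then show ?thesis using s(1) coord.hyps(2) by (auto intro: poly_lt.coord)
  qed
  then have "poly_lt (Suc j - 1) (\<lambda>v. (2 * ?t) * f v + 2 * r v + (v \<bullet> c) * s v)"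
    unfolding diff_Suc_1 by (intro poly_lt.add poly_lt.scale coord.hyps(1) r(1))
  moreover have "lapl (\<lambda>v. (v \<bullet> c) * f v) y = - (2 * (real (Suc j) - 1) * (2 * (real (Suc j) - 1) + DIM('a) - 2))
      * ((u y \<bullet> c) * f (u y)) + ((2 * ?t) * f (u y) + 2 * r (u y) + (u y \<bullet> c) * s (u y))" if y: "y \<noteq> 0" for y
  proof -
    have "smooth_on (-{0}) (\<lambda>y. u y \<bullet> c)"
      by (rule smooth_on_rat_fun[OF rat_fun_u[OF coord.hyps(2)]]) auto
    from laplacian_mult[OF this smooth_poly_u[OF coord.hyps(1)] y]
    have "lapl (\<lambda>v. (v \<bullet> c) * f v) y = (y \<bullet> y) * (f (u y) * euclid_laplacian (\<lambda>y. u y \<bullet> c) y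
      + 2 * (\<Sum>i\<in>Basis. partial i (\<lambda>y. u y \<bullet> c) y * partial i (\<lambda>z. f (u z)) y)
      + (u y \<bullet> c) * euclid_laplacian (\<lambda>z. f (u z)) y)"
      unfolding lapl_def by (simp only:)
    moreover have "k * (a * b + 2 * q + w * d) = a * (k * b) + 2 * (k * q) + w * (k * d)" for k a b q w d :: real
      by (simp add: algebra_simps)
    ultimately have E: "lapl (\<lambda>v. (v \<bullet> c) * f v) y = f (u y) * ((y \<bullet> y) * euclid_laplacian (\<lambda>y. u y \<bullet> c) y)
      + 2 * ((y \<bullet> y) * (\<Sum>i\<in>Basis. partial i (\<lambda>y. u y \<bullet> c) y * partial i (\<lambda>z. f (u z)) y)) + (u y \<bullet> c) * lapl f y"
      unfolding lapl_def by (simp only:)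
    have pd: "partial i (\<lambda>y. u y \<bullet> c) y = grad c y \<bullet> i" for i
      by (rule has_partial_imp_partial[OF has_partial_u[OF coord.hyps(2) y]])
    \<comment> \<open>The three contributions of the product rule as an identity in independent
      reals: \<open>t\<close> stands for \<open>j\<close>, \<open>d\<close> for the dimension,
      \<open>T\<close> for the trace, \<open>w\<close> for the coordinate.\<close>
    have "a * (2 * T - 2 * d * w) + 2 * (- 4 * (t - 1) * w * a + r) + w * (- (2 * (t - 1) * (2 * (t - 1) + d - 2)) * a + q)
      = - (2 * (t + 1 - 1) * (2 * (t + 1 - 1) + d - 2)) * (w * a) + (2 * T * a + 2 * r + w * q)"
      for a T d w t r q :: real
      by (simp add: algebra_simps)
    then show ?thesis
      unfolding E pd gam_def[symmetric] laplacian_u[OF coord.hyps(2) y] r(2)[OF y] s(2)[OF y] of_nat_Suc of_nat_mult of_nat_numeral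
      by (simp only: add.commute[of 1 "real j"])
  qed
  ultimately show ?case by blast
next
  case (Suc j f)
  let ?m = "2 * (real j - 1) * (2 * (real j - 1) + DIM('a) - 2)"
  let ?m' = "2 * (real (Suc j) - 1) * (2 * (real (Suc j) - 1) + DIM('a) - 2)"
  obtain s where s: "poly_lt (j - 1) s"
    "\<And>y. y \<noteq> 0 \<Longrightarrow> lapl f y = - ?m * f (u y) + s (u y)" using Suc.IH by blast
  have "poly_lt (Suc j - 1) (\<lambda>v. s v + (?m' - ?m) * f v)"
    unfolding diff_Suc_1 by (intro poly_lt.add poly_lt.scale Suc.hyps poly_lt_mono[OF s(1)] diff_le_self)
  moreover have "lapl f y = - ?m' * f (u y) + (s (u y) + (?m' - ?m) * f (u y))" if "y \<noteq> 0" for y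
  proof -
    have "- m * a + q = - m' * a + (q + (m' - m) * a)" for m m' a q :: real
      by (simp add: algebra_simps)
    then show ?thesis unfolding s(2)[OF that] .
  qed
  ultimately show ?case by blast
qed

lemma lapl_leading:
  assumes "poly_lt (Suc j) g"
  obtains s where "poly_lt j s" "\<And>y. y \<noteq> 0 \<Longrightarrow> lapl g y = - lam j * g (u y) + s (u y)"
proof -
  from laplacian_poly[OF assms] obtain s where s: "poly_lt j s"
    "\<And>y. y \<noteq> 0 \<Longrightarrow> lapl g y = - (2 * (real (Suc j) - 1) * (2 * (real (Suc j) - 1) + DIM('a) - 2)) * g (u y) + s (u y)"
    by auto
  have "real (Suc j) - 1 = real j" by simp
  show ?thesis
    by (rule that[of s, OF s(1)], unfold lam_def)
       (use s(2)[unfolded \<open>real (Suc j) - 1 = real j\<close>] in blast)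
qed

end

text \<open>Constancy on the fibres of \<open>p\<close> replaces invariance, which frees the
  spectral comparison from the groups; the two notions agree once orbits are known to be
  fibres.\<close>

definition fibre_eigenspace :: "('a::euclidean_space \<Rightarrow> 'v) \<Rightarrow> real \<Rightarrow> ('a \<Rightarrow> real) set" where
  "fibre_eigenspace p mu = {f. (\<forall>x. norm x \<noteq> 1 \<longrightarrow> f x = 0) \<and> sphere_smooth f \<and>
     (\<forall>x y. norm x = 1 \<longrightarrow> norm y = 1 \<longrightarrow> p x = p y \<longrightarrow> f x = f y) \<and>
     (\<forall>x. norm x = 1 \<longrightarrow> - sphere_laplacian f x = mu * f x)}"

context quadratic_invariants
begin

section \<open>Polynomial eigenfunctions and their completeness\<close>

definition eig :: "nat \<Rightarrow> ('v \<Rightarrow> real) \<Rightarrow> bool" where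
  "eig j g \<longleftrightarrow> poly_lt (Suc j) g \<and> (\<forall>y. y \<noteq> 0 \<longrightarrow> lapl g y = - lam j * g (u y))"

text \<open>The Laplacian plus \<open>lam j\<close> is triangular on polynomials of degree below
  \<open>j\<close>, with diagonal entries \<open>lam j - lam i\<close> for \<open>i < j\<close>, all
  non-zero. It is inverted from the top degree downwards.\<close>

lemma lapl_solve:
  assumes "poly_lt i g" "i \<le> j"
  shows "\<exists>h. poly_lt i h \<and> (\<forall>y. y \<noteq> 0 \<longrightarrow> lapl h y + lam j * h (u y) = g (u y))"
  using assms
proof (induction i arbitrary: g)
  case 0
  then show ?case
    using poly_lt_0[of g] by (intro exI[of _ "\<lambda>_. 0"]) (simp add: poly_lt.zero lapl_def laplacian_const)
next
  case (Suc i)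
  obtain s where s: "poly_lt i s" "\<And>y. y \<noteq> 0 \<Longrightarrow> lapl g y = - lam i * g (u y) + s (u y)"
    using lapl_leading[OF Suc.prems(1)] by blast
  obtain h where h: "poly_lt i h" "\<And>y. y \<noteq> 0 \<Longrightarrow> lapl h y + lam j * h (u y) = s (u y)"
    using Suc.IH[OF s(1)] Suc.prems(2) by auto
  define c where "c = lam j - lam i"
  have c: "c \<noteq> 0" using lam_strict_mono[of i j] Suc.prems(2) by (simp add: c_def)
  have "poly_lt (Suc i) (\<lambda>v. inverse c * (g v - h v))"
    by (intro poly_lt.scale poly_lt_diff Suc.prems poly_lt.Suc h)
  moreover have "lapl (\<lambda>v. inverse c * (g v - h v)) y + lam j * (inverse c * (g (u y) - h (u y))) = g (u y)"
    if "y \<noteq> 0" for y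
  proof -
    have "lapl (\<lambda>v. inverse c * (g v - h v)) y = inverse c * (lapl g y - lapl h y)"
      using lapl_scale[OF poly_lt_diff[OF Suc.prems(1) poly_lt.Suc[OF h(1)]] that]
        lapl_diff[OF Suc.prems(1) h(1) that] by simp
    then have "lapl (\<lambda>v. inverse c * (g v - h v)) y + lam j * (inverse c * (g (u y) - h (u y)))
      = inverse c * (lapl g y + lam j * g (u y) - (lapl h y + lam j * h (u y)))"
      by (simp add: algebra_simps)
    also have "\<dots> = inverse c * (c * g (u y))"
      unfolding h(2)[OF that] s(2)[OF that] c_def by (simp add: algebra_simps)
    finally show ?thesis using c by simp
  qed
  ultimately show ?case by blast
qed

text \<open>The inverse applied to the lower-order error \<open>s\<close> is the correction
  \<open>h\<close>, so every leading part is realised by an eigenfunction.\<close>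

lemma eig_with_leading_part:
  assumes "poly_lt (Suc j) g"
  obtains h where "poly_lt j h" "eig j (\<lambda>v. g v - h v)"
proof -
  obtain s where s: "poly_lt j s" "\<And>y. y \<noteq> 0 \<Longrightarrow> lapl g y = - lam j * g (u y) + s (u y)"
    using lapl_leading[OF assms] by blast
  obtain h where h: "poly_lt j h" "\<And>y. y \<noteq> 0 \<Longrightarrow> lapl h y + lam j * h (u y) = s (u y)"
    using lapl_solve[OF s(1)] by blast
  have "lapl (\<lambda>v. g v - h v) y = - lam j * (g (u y) - h (u y))" if "y \<noteq> 0" for y
    using lapl_diff[OF assms h(1) that] s(2)[OF that] h(2)[OF that] by (simp add: algebra_simps)
  then have "eig j (\<lambda>v. g v - h v)"
    unfolding eig_def using assms h(1) by (auto intro: poly_lt_diff poly_lt.Suc)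
  with h(1) show ?thesis by (rule that)
qed

text \<open>Comparison of \<open>lam j\<close> with the leading coefficient \<open>lam i\<close>
  expresses \<open>g\<close> through its remainder, which has smaller degree. Hence a polynomial
  eigenfunction is determined by its leading part.\<close>

lemma eigen_low_degree_zero:
  assumes "poly_lt i g" "i \<le> j" "\<And>y. y \<noteq> 0 \<Longrightarrow> lapl g y = - lam j * g (u y)"
  shows "g = (\<lambda>_. 0)"
  using assms
proof (induction i)
  case 0
  then show ?case by (simp add: poly_lt_0)
next
  case (Suc i)
  obtain s where s: "poly_lt i s" "\<And>y. y \<noteq> 0 \<Longrightarrow> lapl g y = - lam i * g (u y) + s (u y)"
    using lapl_leading[OF Suc.prems(1)] by blast
  define c where "c = lam i - lam j"
  have c: "c \<noteq> 0" using lam_strict_mono[of i j] Suc.prems(2) by (simp add: c_def)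
  have ps: "poly_lt i (\<lambda>v. inverse c * s v)" using s(1) by (rule poly_lt.scale)
  have "g (u y) - inverse c * s (u y) = 0" if "y \<noteq> 0" for y
  proof -
    have "c * g (u y) = s (u y)"
      using s(2)[OF that] Suc.prems(3)[OF that] by (simp add: c_def algebra_simps)
    then show ?thesis using c by (simp add: field_simps)
  qed
  then have "(\<lambda>v. g v - inverse c * s v) = (\<lambda>_. 0)"
    by (intro poly_zero_on_sphere[OF poly_lt_diff[OF Suc.prems(1) poly_lt.Suc[OF ps]]])
  then have "g = (\<lambda>v. inverse c * s v)" by (auto simp: fun_eq_iff)
  then show ?case using Suc.IH ps Suc.prems(2,3) by auto
qed

lemma radial_eigen_eig:
  assumes "eig j g"
  shows "radial_eigen (lam j) (\<lambda>y. g (u y))"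
  using assms smooth_poly_u[of "Suc j" g] u_scale
  unfolding radial_eigen_def eig_def lapl_def by auto

text \<open>Eigenpolynomials of degree below \<open>k\<close> span all polynomials of degree below
  \<open>k\<close>: split off one with the same leading part and descend.\<close>

lemma orthogonal_to_polys:
  assumes X: "continuous_on (-{0}) X" and "\<And>i h. i < k \<Longrightarrow> eig i h \<Longrightarrow> wip X (\<lambda>y. h (u y)) = 0"
    and "poly_lt k g"
  shows "wip X (\<lambda>y. g (u y)) = 0"
  using assms(2,3)
proof (induction k arbitrary: g)
  case 0
  then show ?case using poly_lt_0[of g] by (simp add: wip_def)
next
  case (Suc k)
  obtain h where h: "poly_lt k h" "eig k (\<lambda>v. g v - h v)"
    using eig_with_leading_part[OF Suc.prems(2)] by blast
  have "wip X (\<lambda>y. (g (u y) - h (u y)) + h (u y)) = wip X (\<lambda>y. g (u y) - h (u y)) + wip X (\<lambda>y. h (u y))"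
    using h continuous_poly_u[of "Suc k" "\<lambda>v. g v - h v"] continuous_poly_u[OF h(1)]
    by (intro wip_add_right X) (auto simp: eig_def)
  moreover have "wip X (\<lambda>y. g (u y) - h (u y)) = 0"
    using Suc.prems(1)[OF _ h(2)] by simp
  moreover have "wip X (\<lambda>y. h (u y)) = 0"
    by (rule Suc.IH[OF _ h(1)]) (rule Suc.prems(1), simp_all)
  ultimately show ?case by simp
qed

lemma continuous_on_p: "continuous_on A p"
proof (subst continuous_on_componentwise, intro ballI)
  fix b :: 'v assume b: "b \<in> Basis"
  have "continuous_on A (\<lambda>y. y \<bullet> Q b y)"
    using linear_continuous_on[OF linear_conv_bounded_linear[THEN iffD1, OF lin[OF b]]]
    by (intro continuous_intros)
  then show "continuous_on A (\<lambda>y. p y \<bullet> b)" by (simp add: p_eq b)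
qed

text \<open>\<open>F\<close> descends to a function on the compact image of the sphere; the descent
  is continuous because \<open>p\<close> maps compact sets to closed ones. Stone-Weierstrass then
  applies on the image.\<close>

lemma approximation_on_sphere:
  assumes F: "continuous_on (sphere 0 1) F"
    and fib: "\<And>x y. norm x = 1 \<Longrightarrow> norm y = 1 \<Longrightarrow> p x = p y \<Longrightarrow> F x = F y" and "e > 0"
  obtains j g where "poly_lt j g" "\<And>x. norm x = 1 \<Longrightarrow> \<bar>F x - g (p x)\<bar> < e"
proof -
  define S where "S = sphere (0::'a) 1"
  define f where "f v = F (SOME x. norm x = 1 \<and> p x = v)" for v
  have f: "f (p x) = F x" if "norm x = 1" for x
  proof -
    have "norm (SOME z. norm z = 1 \<and> p z = p x) = 1 \<and> p (SOME z. norm z = 1 \<and> p z = p x) = p x"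
      by (rule someI[of _ x]) (use that in simp)
    then show ?thesis unfolding f_def using fib that by blast
  qed
  have comp: "compact (p ` S)"
    unfolding S_def by (intro compact_continuous_image continuous_on_p compact_sphere)
  have "continuous_on (p ` S) f"
    unfolding continuous_on_closed_invariant
  proof (intro allI impI)
    fix B :: "real set" assume "closed B"
    define A where "A = p ` (S \<inter> F -` B)"
    have "closed (S \<inter> F -` B)"
      unfolding S_def by (rule continuous_closed_preimage[OF F closed_sphere \<open>closed B\<close>])
    then have "compact (S \<inter> (S \<inter> F -` B))"
      unfolding S_def by (rule compact_Int_closed[OF compact_sphere])
    then have "compact (S \<inter> F -` B)" by (simp add: Int_assoc[symmetric])
    then have "closed A"
      unfolding A_def by (intro compact_imp_closed compact_continuous_image continuous_on_p)
    moreover have "A \<inter> p ` S = f -` B \<inter> p ` S"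
      unfolding A_def S_def using f by fastforce
    ultimately show "\<exists>A. closed A \<and> A \<inter> p ` S = f -` B \<inter> p ` S" by blast
  qed
  from Stone_Weierstrass_real_polynomial_function[OF comp this \<open>e > 0\<close>]
  obtain g where g: "real_polynomial_function g" "\<And>v. v \<in> p ` S \<Longrightarrow> \<bar>f v - g v\<bar> < e" by blast
  obtain j where "poly_lt j g" using real_polynomial_function_imp_poly_lt[OF g(1)] by blast
  moreover have "\<bar>F x - g (p x)\<bar> < e" if "norm x = 1" for x
    using g(2)[of "p x"] f[OF that] that by (simp add: S_def)
  ultimately show ?thesis using that by blast
qed

text \<open>Orthogonality replaces one factor of \<open>wip F F\<close> by the uniformly small
  \<open>F y - g (u y)\<close>, so \<open>wip F F\<close> is at most \<open>e\<close> times the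
  weighted L1 norm of \<open>F\<close>, for every \<open>e\<close>.\<close>

lemma orthogonal_to_all_polys_zero:
  assumes F: "continuous_on (-{0}) F" and hom: "\<And>r y. r > 0 \<Longrightarrow> F (r *\<^sub>R y) = F y"
    and fib: "\<And>x y. norm x = 1 \<Longrightarrow> norm y = 1 \<Longrightarrow> p x = p y \<Longrightarrow> F x = F y"
    and orth: "\<And>j g. poly_lt j g \<Longrightarrow> wip F (\<lambda>y. g (u y)) = 0" and "y \<noteq> 0"
  shows "F y = 0"
proof (rule wip_self_eq_0[OF F hom _ \<open>y \<noteq> 0\<close>])
  define C where "C = integral\<^sup>L lborel (\<lambda>y. annulus_weight y * \<bar>F y\<bar>)"
  have int: "integrable lborel (\<lambda>y. annulus_weight y * \<bar>F y\<bar>)"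
    by (rule annulus_weight_integrable) (intro continuous_intros F)
  have bound: "wip F F \<le> e * C" if "e > 0" for e
  proof -
    have "continuous_on (sphere 0 1) F" by (rule continuous_on_subset[OF F]) auto
    from approximation_on_sphere[OF this fib \<open>e > 0\<close>]
    obtain j g where g: "poly_lt j g" "\<And>x. norm x = 1 \<Longrightarrow> \<bar>F x - g (p x)\<bar> < e" by blast
    have near: "\<bar>F z - g (u z)\<bar> < e" if "z \<noteq> 0" for z
      using g(2)[of "inverse (norm z) *\<^sub>R z"] hom[of "inverse (norm z)" z] u_normalize[OF that] that by simp
    have cg: "continuous_on (-{0}) (\<lambda>z. g (u z))" by (rule continuous_poly_u[OF g(1)])
    have "wip F F = wip F (\<lambda>z. F z - g (u z))"
      using wip_diff_right[OF F F cg] orth[OF g(1)] by simp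
    also have "\<dots> \<le> integral\<^sup>L lborel (\<lambda>y. e * (annulus_weight y * \<bar>F y\<bar>))"
      unfolding wip_def
    proof (rule integral_mono)
      show "integrable lborel (\<lambda>y. annulus_weight y * (F y * (F y - g (u y))))"
        by (rule annulus_weight_integrable) (intro continuous_intros F cg)
      show "integrable lborel (\<lambda>y. e * (annulus_weight y * \<bar>F y\<bar>))" using int by simp
      fix z
      show "annulus_weight z * (F z * (F z - g (u z))) \<le> e * (annulus_weight z * \<bar>F z\<bar>)"
      proof (cases "z = 0")
        case True
        then show ?thesis by (simp add: annulus_weight_def)
      next
        case False
        have "F z * (F z - g (u z)) \<le> \<bar>F z\<bar> * \<bar>F z - g (u z)\<bar>"
          by (metis abs_ge_self abs_mult)
        also have "\<dots> \<le> \<bar>F z\<bar> * e"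
          using near[OF False] by (intro mult_left_mono) auto
        finally have "annulus_weight z * (F z * (F z - g (u z))) \<le> annulus_weight z * (\<bar>F z\<bar> * e)"
          by (intro mult_left_mono) (auto simp: annulus_weight_def bump_nonneg)
        then show ?thesis by (simp add: mult_ac)
      qed
    qed
    also have "\<dots> = e * C" by (simp add: C_def)
    finally show ?thesis .
  qed
  have "wip F F \<ge> 0"
    unfolding wip_def by (intro Bochner_Integration.integral_nonneg) (simp add: annulus_weight_def bump_nonneg)
  moreover have "wip F F \<le> 0"
  proof (rule field_le_epsilon)
    fix e :: real assume "e > 0"
    have "C \<ge> 0"
      unfolding C_def by (intro Bochner_Integration.integral_nonneg) (simp add: annulus_weight_def bump_nonneg)
    \<comment> \<open>The denominator \<open>C + 1\<close> covers the case
      \<open>C = 0\<close>.\<close>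
    have "wip F F \<le> e / (C + 1) * C" using bound[of "e / (C + 1)"] \<open>e > 0\<close> \<open>C \<ge> 0\<close> by simp
    also have "\<dots> \<le> 0 + e" using \<open>e > 0\<close> \<open>C \<ge> 0\<close> by (simp add: field_simps)
    finally show "wip F F \<le> 0 + e" .
  qed
  ultimately show "wip F F = 0" by simp
qed

text \<open>The monomials of degree below \<open>j\<close>, a finite spanning set in the form that
  \<open>wip_projection\<close> takes.\<close>

fun gens :: "nat \<Rightarrow> ('v \<Rightarrow> real) set" where
  "gens 0 = {}"
| "gens (Suc j) = insert (\<lambda>_. 1) (gens j \<union> (\<Union>b\<in>Basis. (\<lambda>f v. (v \<bullet> b) * f v) ` gens j))"

lemma finite_gens: "finite (gens j)"
  by (induction j) auto

lemma poly_lt_gens: "f \<in> gens j \<Longrightarrow> poly_lt j f"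
proof (induction j arbitrary: f)
  case (Suc j)
  then show ?case
    by (auto intro: poly_lt.Suc poly_lt.coord poly_lt_mono[OF poly_lt.const])
qed simp

text \<open>Spanning is expressed dually, as orthogonality. \<open>X\<close> is generalised in the
  induction because the \<open>coord\<close> case moves the coordinate factor from the polynomial to
  \<open>X\<close>.\<close>

lemma orthogonal_gens:
  assumes "poly_lt j g" "continuous_on (-{0}) X" "\<And>f. f \<in> gens j \<Longrightarrow> wip X (\<lambda>y. f (u y)) = 0"
  shows "wip X (\<lambda>y. g (u y)) = 0"
  using assms
proof (induction arbitrary: X rule: poly_lt.induct)
  case zero
  then show ?case by (simp add: wip_def)
next
  case (const c)
  then show ?case using wip_scale_right[of X c "\<lambda>_. 1"] by simp
next
  case (add j f g)
  show ?case
    using wip_add_right[OF add.prems(1) continuous_poly_u[OF add.hyps(1)] continuous_poly_u[OF add.hyps(2)]]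
      add.IH(1)[OF add.prems] add.IH(2)[OF add.prems] by simp
next
  case (scale j f c)
  then show ?case using wip_scale_right[of X c "\<lambda>y. f (u y)"] by simp
next
  case (coord j f b)
  have move: "wip X (\<lambda>y. (u y \<bullet> b) * f (u y)) = wip (\<lambda>y. X y * (u y \<bullet> b)) (\<lambda>y. f (u y))" for f :: "'v \<Rightarrow> real"
    by (simp add: wip_def mult.assoc)
  have "continuous_on (-{0}) (\<lambda>y. X y * (u y \<bullet> b))"
    by (rule continuous_on_mult[OF coord.prems(1) rat_fun_continuous_on[OF rat_fun_u[OF coord.hyps(2)]]])
  moreover have "wip (\<lambda>y. X y * (u y \<bullet> b)) (\<lambda>y. h (u y)) = 0" if "h \<in> gens j" for h
  proof -
    have "(\<lambda>v. (v \<bullet> b) * h v) \<in> gens (Suc j)" using that coord.hyps(2) by auto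
    then show ?thesis using coord.prems(2) move[of h] by fastforce
  qed
  ultimately show ?case unfolding move by (rule coord.IH)
next
  case (Suc j f)
  then show ?case by auto
qed

text \<open>For \<open>mu = lam j\<close> let \<open>X\<close> be \<open>F\<close> minus its
  projection to degree at most \<open>j\<close>. It is orthogonal to eigenpolynomials of degree up
  to \<open>j\<close> by construction, and to those of higher degree because Green's formula
  separates them from both \<open>F\<close> and the projection. Density forces \<open>X = 0\<close>.
  For other \<open>mu\<close> the argument applies to \<open>F\<close> itself.\<close>

theorem radial_eigen_is_poly:
  assumes F: "radial_eigen mu F"
    and fib: "\<And>x y. norm x = 1 \<Longrightarrow> norm y = 1 \<Longrightarrow> p x = p y \<Longrightarrow> F x = F y"
  shows "(\<exists>j g. mu = lam j \<and> eig j g \<and> (\<forall>y. y \<noteq> 0 \<longrightarrow> F y = g (u y)))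
     \<or> (mu \<notin> range lam \<and> (\<forall>y. y \<noteq> 0 \<longrightarrow> F y = 0))"
proof -
  have cF: "continuous_on (-{0}) F" and hom: "\<And>r y. r > 0 \<Longrightarrow> F (r *\<^sub>R y) = F y"
    using F smooth_on_continuous by (auto simp: radial_eigen_def)
  have orthF: "wip F (\<lambda>y. h (u y)) = 0" if "eig i h" "lam i \<noteq> mu" for i h
    using wip_radial_eigen_orthogonal[OF F radial_eigen_eig[OF that(1)]] that(2) by auto
  show ?thesis
  proof (cases "mu \<in> range lam")
    case False
    have "wip F (\<lambda>y. g (u y)) = 0" if "poly_lt j g" for j g
      by (rule orthogonal_to_polys[OF cF _ that]) (use orthF False in auto)
    then show ?thesis
      using orthogonal_to_all_polys_zero[OF cF hom fib] False by blast
  next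
    case True
    then obtain j where j: "mu = lam j" by blast
    define M where "M = {\<lambda>y. g (u y) | g. poly_lt (Suc j) g}"
    have "\<exists>G\<in>M. (\<forall>s\<in>(\<lambda>g y. g (u y)) ` gens (Suc j). wip (\<lambda>y. F y - G y) s = 0)
     \<and> (\<forall>X. continuous_on (-{0}) X \<longrightarrow> (\<forall>s\<in>(\<lambda>g y. g (u y)) ` gens (Suc j). wip X s = 0) \<longrightarrow> wip X G = 0)"
    proof (rule wip_projection)
      show "finite ((\<lambda>g y. g (u y)) ` gens (Suc j))" using finite_gens by blast
      show "s \<in> M" if "s \<in> (\<lambda>g y. g (u y)) ` gens (Suc j)" for s
        using that poly_lt_gens[of _ "Suc j"] unfolding M_def by blast
      show "continuous_on (-{0}) s" if "s \<in> M" for s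
        using that continuous_poly_u unfolding M_def by blast
      show "(\<lambda>_. 0) \<in> M" unfolding M_def using poly_lt_zero[of "Suc j"] by force
      show "(\<lambda>y. s y + c * t y) \<in> M" if st: "s \<in> M" "t \<in> M" for s t c
      proof -
        obtain g h where "poly_lt (Suc j) g" "poly_lt (Suc j) h" "s = (\<lambda>y. g (u y))" "t = (\<lambda>y. h (u y))"
          using st unfolding M_def by blast
        then show ?thesis
          unfolding M_def using poly_lt.add[OF _ poly_lt.scale[of "Suc j" h c], of g] by force
      qed
    qed (rule cF)
    then obtain g where g: "poly_lt (Suc j) g"
      "\<And>f. f \<in> gens (Suc j) \<Longrightarrow> wip (\<lambda>y. F y - g (u y)) (\<lambda>y. f (u y)) = 0"
      unfolding M_def by blast
    have cg: "continuous_on (-{0}) (\<lambda>y. g (u y))" by (rule continuous_poly_u[OF g(1)])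
    define X where "X = (\<lambda>y. F y - g (u y))"
    have cX: "continuous_on (-{0}) X" unfolding X_def by (intro continuous_intros cF cg)
    have "wip X (\<lambda>y. h (u y)) = 0" if h: "eig i h" for i h
    proof (cases "i \<le> j")
      case True
      then have "poly_lt (Suc j) h" using h poly_lt_mono[of "Suc i" h "Suc j"] by (simp add: eig_def)
      then show ?thesis using orthogonal_gens[OF _ cX] g(2) unfolding X_def by blast
    next
      case False
      have ch: "continuous_on (-{0}) (\<lambda>y. h (u y))"
        using h continuous_poly_u unfolding eig_def by blast
      \<comment> \<open>\<open>g\<close> is a combination of eigenpolynomials of degree at most
        \<open>j\<close>, whose eigenvalues are all below \<open>lam i\<close>.\<close>
      have "wip (\<lambda>y. h (u y)) (\<lambda>y. g (u y)) = 0"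
      proof (rule orthogonal_to_polys[OF ch _ g(1)])
        fix k f assume "k < Suc j" "eig k f"
        then show "wip (\<lambda>y. h (u y)) (\<lambda>y. f (u y)) = 0"
          using wip_radial_eigen_orthogonal[OF radial_eigen_eig[OF h] radial_eigen_eig[of k f]]
            lam_strict_mono[of k i] False by simp
      qed
      moreover have "wip F (\<lambda>y. h (u y)) = 0"
        using orthF[OF h] lam_strict_mono[of j i] False j by simp
      ultimately show ?thesis
        unfolding X_def using wip_diff_left[OF ch cF cg] by (simp add: wip_commute)
    qed
    then have orthX: "wip X (\<lambda>y. h (u y)) = 0" if "poly_lt k h" for k h
      using orthogonal_to_polys[OF cX _ that] by blast
    have X0: "X y = 0" if "y \<noteq> 0" for y
    proof (rule orthogonal_to_all_polys_zero[OF cX _ _ orthX that])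
      show "X (r *\<^sub>R y) = X y" if "r > 0" for r y
        using hom[OF that] u_scale[OF that] by (simp add: X_def)
      show "X x = X y" if "norm x = 1" "norm y = 1" "p x = p y" for x y
        using fib[OF that] that by (simp add: X_def u_unit)
    qed
    then have Fg: "F y = g (u y)" if "y \<noteq> 0" for y
      using that by (simp add: X_def)
    have "lapl g y = - lam j * g (u y)" if "y \<noteq> 0" for y
    proof -
      have "euclid_laplacian F y = euclid_laplacian (\<lambda>z. g (u z)) y"
        using F Fg that by (intro laplacian_cong) (auto simp: radial_eigen_def)
      moreover have "(y \<bullet> y) * euclid_laplacian F y = - mu * F y"
        using F that unfolding radial_eigen_def by blast
      ultimately show ?thesis
        using Fg[OF that] j by (simp add: lapl_def)
    qed
    then have "eig j g" using g(1) by (simp add: eig_def)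
    then show ?thesis using j Fg by blast
  qed
qed

lemma fibre_eigenspace_cases:
  assumes "f \<in> fibre_eigenspace p mu"
  shows "(\<exists>j g. mu = lam j \<and> eig j g \<and> (\<forall>x. norm x = 1 \<longrightarrow> f x = g (p x)))
     \<or> (mu \<notin> range lam \<and> f = (\<lambda>_. 0))"
proof -
  have f: "\<And>x. norm x \<noteq> 1 \<Longrightarrow> f x = 0" "sphere_smooth f"
    "\<And>x y. norm x = 1 \<Longrightarrow> norm y = 1 \<Longrightarrow> p x = p y \<Longrightarrow> f x = f y"
    "\<And>x. norm x = 1 \<Longrightarrow> - sphere_laplacian f x = mu * f x"
    using assms unfolding fibre_eigenspace_def mem_Collect_eq by blast+
  have "(\<exists>j g. mu = lam j \<and> eig j g \<and> (\<forall>y. y \<noteq> 0 \<longrightarrow> radial_ext f y = g (u y)))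
     \<or> (mu \<notin> range lam \<and> (\<forall>y. y \<noteq> 0 \<longrightarrow> radial_ext f y = 0))"
  proof (rule radial_eigen_is_poly[OF radial_eigen_radial_ext[OF f(2,4)]])
    show "radial_ext f x = radial_ext f y" if "norm x = 1" "norm y = 1" "p x = p y" for x y
      using f(3)[OF that] radial_ext_unit[OF that(1), of f] radial_ext_unit[OF that(2), of f] by simp
  qed
  then show ?thesis
  proof (elim disjE exE conjE)
    fix j g assume *: "mu = lam j" "eig j g" "\<forall>y. y \<noteq> 0 \<longrightarrow> radial_ext f y = g (u y)"
    have "f x = g (p x)" if "norm x = 1" for x
    proof -
      have "x \<noteq> 0" using that by auto
      then show ?thesis using *(3) radial_ext_unit[OF that, of f] u_unit[OF that] by simp
    qed
    then show ?thesis using * by blast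
  next
    assume *: "mu \<notin> range lam" "\<forall>y. y \<noteq> 0 \<longrightarrow> radial_ext f y = 0"
    have "f x = 0" for x
    proof (cases "norm x = 1")
      case True
      then have "x \<noteq> 0" by auto
      then show ?thesis using *(2) radial_ext_unit[OF True, of f] by simp
    qed (rule f(1))
    then show ?thesis using *(1) by blast
  qed
qed

lemma eig_in_fibre_eigenspace:
  assumes "eig j g"
  shows "(\<lambda>x. if norm x = 1 then g (p x) else 0) \<in> fibre_eigenspace p (lam j)"
proof -
  let ?f = "\<lambda>x. if norm x = 1 then g (p x) else 0"
  have ext: "radial_ext ?f y = g (u y)" if "y \<noteq> 0" for y
    using that by (simp add: radial_ext_def u_normalize)
  have pl: "poly_lt (Suc j) g" using assms by (simp add: eig_def)
  have sm: "sphere_smooth ?f"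
    unfolding sphere_smooth_def by (rule smooth_on_rat_fun[OF rat_fun_poly_u[OF pl] ext])
  have "- sphere_laplacian ?f x = lam j * ?f x" if "norm x = 1" for x
  proof -
    have x: "x \<noteq> 0" "x \<bullet> x = 1" using that by (auto simp: norm_eq_1)
    have "sphere_laplacian ?f x = euclid_laplacian (\<lambda>z. g (u z)) x"
      unfolding sphere_laplacian_def
      by (rule laplacian_cong[OF ext x(1)]) (use sm in \<open>simp_all add: sphere_smooth_def\<close>)
    also have "\<dots> = - lam j * g (u x)"
    proof -
      have "lapl g x = - lam j * g (u x)" using assms x(1) unfolding eig_def by blast
      then show ?thesis by (simp add: lapl_def x(2))
    qed
    finally show ?thesis using that by (simp add: u_unit)
  qed
  then show ?thesis
    unfolding fibre_eigenspace_def using sm by auto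
qed

end

section \<open>Comparison of multiplicities\<close>

text \<open>The polynomial representing an eigenfunction for \<open>p\<close> is corrected in lower
  degree to one for \<open>p'\<close>. If a combination vanishes after correction, its polynomial
  has degree below \<open>j\<close>, yet it solves the equation for \<open>lam j\<close> on the
  \<open>p\<close> side, so it is zero. Both interpretations share \<open>lam\<close>, which depends
  on \<open>DIM('a)\<close> only.\<close>

lemma fun_dim_fibre_eigenspace_le:
  fixes p p' :: "'a::euclidean_space \<Rightarrow> 'v::euclidean_space"
  assumes "quadratic_invariants p Q" "quadratic_invariants p' Q'"
  shows "fun_dim (fibre_eigenspace p mu) \<le> fun_dim (fibre_eigenspace p' mu)"
proof -
  interpret A: quadratic_invariants p Q by fact
  interpret B: quadratic_invariants p' Q' by fact
  have "\<exists>F'. finite F' \<and> F' \<subseteq> fibre_eigenspace p' mu \<and> lin_indep_funs F' \<and> card F' = card F"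
    if F: "finite F" "F \<subseteq> fibre_eigenspace p mu" "lin_indep_funs F" for F
  proof (cases "mu \<in> range A.lam")
    case False
    \<comment> \<open>Off the spectrum the eigenspace contains only the zero function, which is not
      independent, so \<open>F\<close> is empty.\<close>
    then have "F \<subseteq> {\<lambda>_. 0}" using F(2) A.fibre_eigenspace_cases by blast
    moreover have "(\<lambda>_. 0) \<notin> F"
    proof
      assume "(\<lambda>_. 0) \<in> F"
      with \<open>F \<subseteq> {\<lambda>_. 0}\<close> have "F = {\<lambda>_. 0}" by blast
      then show False using F(3) unfolding lin_indep_funs_def by (auto dest: spec[of _ "\<lambda>_. 1"])
    qed
    ultimately have "F = {}" by blast
    then show ?thesis by (intro exI[of _ "{}"]) (auto simp: lin_indep_funs_def)
  next
    case True
    then obtain j where j: "mu = A.lam j" by blast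
    have "\<forall>f\<in>F. \<exists>g. A.eig j g \<and> (\<forall>x. norm x = 1 \<longrightarrow> f x = g (p x))"
      using A.fibre_eigenspace_cases A.lam_inj F(2) j by blast
    then obtain g where g: "\<And>f. f \<in> F \<Longrightarrow> A.eig j (g f)"
      "\<And>f x. f \<in> F \<Longrightarrow> norm x = 1 \<Longrightarrow> f x = g f (p x)" by metis
    have pg: "poly_lt (Suc j) (g f)" if "f \<in> F" for f using g(1)[OF that] by (simp add: A.eig_def)
    have "\<forall>f\<in>F. \<exists>h. poly_lt j h \<and> B.eig j (\<lambda>v. g f v - h v)"
    proof
      fix f assume "f \<in> F"
      from B.eig_with_leading_part[OF pg[OF this]]
      show "\<exists>h. poly_lt j h \<and> B.eig j (\<lambda>v. g f v - h v)" by blast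
    qed
    from bchoice[OF this] obtain h where h: "\<And>f. f \<in> F \<Longrightarrow> poly_lt j (h f)"
      "\<And>f. f \<in> F \<Longrightarrow> B.eig j (\<lambda>v. g f v - h f v)" by blast
    define T where "T f = (\<lambda>x. if norm x = 1 then g f (p' x) - h f (p' x) else 0)" for f
    have TV: "T f \<in> fibre_eigenspace p' mu" if "f \<in> F" for f
      using B.eig_in_fibre_eigenspace[OF h(2)[OF that]] unfolding T_def j .
    have indep: "\<forall>f\<in>F. c f = 0" if c: "\<And>x. (\<Sum>f\<in>F. c f * T f x) = 0" for c
    proof -
      define G where "G = (\<lambda>v. \<Sum>f\<in>F. c f * g f v)"
      define H where "H = (\<lambda>v. \<Sum>f\<in>F. c f * h f v)"
      have pG: "poly_lt (Suc j) G" unfolding G_def using pg by (intro poly_lt_sum poly_lt.scale) auto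
      have pH: "poly_lt j H" unfolding H_def using h by (intro poly_lt_sum poly_lt.scale) auto
      \<comment> \<open>Vanishing on the image of \<open>p'\<close> gives \<open>G = H\<close> as
        polynomials, with \<open>H\<close> of degree below \<open>j\<close>; this identity can then
        be read on the \<open>p\<close> side.\<close>
      have "(\<lambda>v. G v - H v) = (\<lambda>_. 0)"
      proof (rule B.poly_zero_on_sphere[OF poly_lt_diff[OF pG poly_lt.Suc[OF pH]]])
        fix y :: 'a assume "y \<noteq> 0"
        define x where "x = inverse (norm y) *\<^sub>R y"
        have x: "norm x = 1" using \<open>y \<noteq> 0\<close> by (simp add: x_def)
        have "G (p' x) - H (p' x) = (\<Sum>f\<in>F. c f * T f x)"
          unfolding G_def H_def T_def using x by (simp add: sum_subtractf right_diff_distrib)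
        then show "G (B.u y) - H (B.u y) = 0"
          using c[of x] B.u_normalize[OF \<open>y \<noteq> 0\<close>] by (simp add: x_def)
      qed
      then have "G = H" by (auto simp: fun_eq_iff)
      moreover have "A.lapl G y = - A.lam j * G (A.u y)" if "y \<noteq> 0" for y
      proof -
        have "A.lapl G y = (\<Sum>f\<in>F. A.lapl (\<lambda>v. c f * g f v) y)"
          unfolding G_def using pg by (intro A.lapl_sum[OF _ that] poly_lt.scale) auto
        also have "\<dots> = (\<Sum>f\<in>F. c f * (- A.lam j * g f (A.u y)))"
          using A.lapl_scale[OF pg that] g(1) that by (intro sum.cong refl) (auto simp: A.eig_def)
        finally show ?thesis by (simp add: G_def sum_distrib_left mult_ac sum_negf)
      qed
      ultimately have "G = (\<lambda>_. 0)"
        using A.eigen_low_degree_zero[of j G j] pH by auto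
      moreover have "(\<Sum>f\<in>F. c f * f x) = (if norm x = 1 then G (p x) else 0)" for x
      proof (cases "norm x = 1")
        case True
        then show ?thesis unfolding G_def using g(2)[OF _ True] by (auto intro!: sum.cong)
      next
        case False
        have "f x = 0" if "f \<in> F" for f
          using F(2) that False unfolding fibre_eigenspace_def by blast
        then show ?thesis using False by (auto intro!: sum.neutral)
      qed
      ultimately have "\<forall>x. (\<Sum>f\<in>F. c f * f x) = 0" by simp
      then show ?thesis using F(3) unfolding lin_indep_funs_def by blast
    qed
    have inj: "inj_on T F"
    proof (rule inj_onI, rule ccontr)
      fix f1 f2 assume f12: "f1 \<in> F" "f2 \<in> F" "T f1 = T f2" "f1 \<noteq> f2"
      define c where "c f = (if f = f1 then 1 else if f = f2 then -1 else (0::real))" for f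
      have "(\<Sum>f\<in>F. c f * T f x) = 0" for x
      proof -
        have "(\<Sum>f\<in>F. c f * T f x) = (\<Sum>f\<in>{f1, f2}. c f * T f x)"
          by (rule sum.mono_neutral_right) (use f12 F(1) in \<open>auto simp: c_def\<close>)
        also have "\<dots> = 0" using f12 by (simp add: c_def)
        finally show ?thesis .
      qed
      from indep[OF this] f12(1) show False by (auto simp: c_def)
    qed
    have "lin_indep_funs (T ` F)"
      unfolding lin_indep_funs_def
    proof (intro allI impI)
      fix c assume "\<forall>x. (\<Sum>k\<in>T ` F. c k * k x) = 0"
      then have "(\<Sum>f\<in>F. c (T f) * T f x) = 0" for x
        using inj by (simp add: sum.reindex)
      from indep[OF this] show "\<forall>k\<in>T ` F. c k = 0" by blast
    qed
    then show ?thesis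
      using F(1) TV card_image[OF inj] by (intro exI[of _ "T ` F"]) auto
  qed
  note transfer = this
  show ?thesis
    unfolding fun_dim_def
  proof (rule Sup_subset_mono, rule subsetI, unfold mem_Collect_eq)
    fix k assume "\<exists>F. k = enat (card F) \<and> finite F \<and> F \<subseteq> fibre_eigenspace p mu \<and> lin_indep_funs F"
    then obtain F where "k = enat (card F)" "finite F" "F \<subseteq> fibre_eigenspace p mu" "lin_indep_funs F"
      by blast
    with transfer[of F] show "\<exists>F'. k = enat (card F') \<and> finite F' \<and> F' \<subseteq> fibre_eigenspace p' mu \<and> lin_indep_funs F'"
      by metis
  qed
qed

section \<open>Transitivity of the classical groups\<close>

definition hip :: "nat \<Rightarrow> (nat \<Rightarrow> complex) \<Rightarrow> (nat \<Rightarrow> complex) \<Rightarrow> complex" where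
  "hip k x y = (\<Sum>i<k. cnj (x i) * y i)"

definition mat_vec :: "nat \<Rightarrow> (nat \<Rightarrow> nat \<Rightarrow> complex) \<Rightarrow> (nat \<Rightarrow> complex) \<Rightarrow> nat \<Rightarrow> complex" where
  "mat_vec k A x = (\<lambda>i. \<Sum>j<k. A i j * x j)"

lemma hip_cong: "(\<And>i. i < k \<Longrightarrow> x i = x' i) \<Longrightarrow> (\<And>i. i < k \<Longrightarrow> y i = y' i) \<Longrightarrow> hip k x y = hip k x' y'"
  unfolding hip_def by (intro sum.cong) auto

lemma cnj_hip: "cnj (hip k x y) = hip k y x"
  unfolding hip_def by (simp add: mult.commute)

lemma hip_diff_left: "hip k (\<lambda>i. x i - y i) z = hip k x z - hip k y z"
  unfolding hip_def by (simp add: left_diff_distrib sum_subtractf)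

lemma hip_diff_right: "hip k z (\<lambda>i. x i - y i) = hip k z x - hip k z y"
  unfolding hip_def by (simp add: right_diff_distrib sum_subtractf)

lemma hip_self: "hip k x x = of_real (\<Sum>i<k. (cmod (x i))\<^sup>2)"
  unfolding hip_def of_real_sum by (intro sum.cong refl) (simp add: complex_norm_square mult.commute flip: of_real_power)

lemma hip_self_eq_0: "hip k x x = 0 \<Longrightarrow> i < k \<Longrightarrow> x i = 0"
proof -
  assume "hip k x x = 0" "i < k"
  then have "(\<Sum>i<k. (cmod (x i))\<^sup>2) = 0" unfolding hip_self of_real_eq_0_iff by blast
  then have "(cmod (x i))\<^sup>2 = 0" using \<open>i < k\<close> by (subst (asm) sum_nonneg_eq_0_iff) auto
  then show ?thesis by simp
qed

text \<open>Entries outside the \<open>k\<close> by \<open>k\<close> block vanish by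
  \<open>is_cmat\<close>, so the equation between functions on all indices reduces to orthonormality
  of the columns.\<close>

lemma unitary_groupI:
  assumes "is_cmat k A" "\<And>i j. i < k \<Longrightarrow> j < k \<Longrightarrow> (\<Sum>l<k. cnj (A l i) * A l j) = (if i = j then 1 else 0)"
  shows "A \<in> unitary_group k"
proof -
  have "cmat_mult k (cmat_adj A) A i j = cmat_id k i j" for i j
  proof (cases "i < k \<and> j < k")
    case True
    then show ?thesis using assms(2)[of i j] by (simp add: cmat_mult_def cmat_adj_def cmat_id_def)
  next
    case False
    then have "cnj (A l i) * A l j = 0" for l
      using assms(1) by (auto simp: is_cmat_def not_less)
    then have "cmat_mult k (cmat_adj A) A i j = 0"
      by (simp only: cmat_mult_def cmat_adj_def sum.neutral_const)
    then show ?thesis using False by (auto simp: cmat_id_def)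
  qed
  then show ?thesis using assms(1) by (auto simp: unitary_group_def fun_eq_iff)
qed

lemma unitary_groupD:
  assumes "A \<in> unitary_group k"
  shows "is_cmat k A" "i < k \<Longrightarrow> (\<Sum>l<k. cnj (A l i) * A l j) = (if i = j then 1 else 0)"
proof -
  show "is_cmat k A" using assms by (simp add: unitary_group_def)
  have "cmat_mult k (cmat_adj A) A i j = cmat_id k i j"
    using assms by (simp add: unitary_group_def)
  then show "i < k \<Longrightarrow> (\<Sum>l<k. cnj (A l i) * A l j) = (if i = j then 1 else 0)"
    by (simp add: cmat_mult_def cmat_adj_def cmat_id_def)
qed

lemma hip_mat_vec:
  assumes "A \<in> unitary_group k"
  shows "hip k (mat_vec k A x) (mat_vec k A y) = hip k x y"
proof -
  have "hip k (mat_vec k A x) (mat_vec k A y)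
      = (\<Sum>i<k. \<Sum>j<k. \<Sum>l<k. cnj (x j) * y l * (cnj (A i j) * A i l))"
    unfolding hip_def mat_vec_def cnj_sum sum_product by (simp add: mult_ac)
  also have "\<dots> = (\<Sum>j<k. \<Sum>l<k. \<Sum>i<k. cnj (x j) * y l * (cnj (A i j) * A i l))"
    by (subst sum.swap) (intro sum.cong refl sum.swap)
  also have "\<dots> = (\<Sum>j<k. \<Sum>l<k. cnj (x j) * y l * (if j = l then 1 else 0))"
    by (intro sum.cong refl) (simp add: sum_distrib_left[symmetric] unitary_groupD(2)[OF assms])
  also have "\<dots> = hip k x y"
    unfolding hip_def by (intro sum.cong refl) (simp add: if_distrib cong: if_cong)
  finally show ?thesis .
qed

lemma mat_vec_cmat_mult: "mat_vec k (cmat_mult k A B) x = mat_vec k A (mat_vec k B x)"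
proof
  fix i
  have "mat_vec k (cmat_mult k A B) x i = (\<Sum>j<k. \<Sum>l<k. A i l * B l j * x j)"
    by (simp add: mat_vec_def cmat_mult_def sum_distrib_right)
  also have "\<dots> = (\<Sum>l<k. \<Sum>j<k. A i l * B l j * x j)" by (rule sum.swap)
  also have "\<dots> = mat_vec k A (mat_vec k B x) i"
    by (simp add: mat_vec_def sum_distrib_left mult.assoc)
  finally show "mat_vec k (cmat_mult k A B) x i = mat_vec k A (mat_vec k B x) i" .
qed

lemma mat_vec_cong: "(\<And>j. j < k \<Longrightarrow> x j = y j) \<Longrightarrow> mat_vec k A x = mat_vec k A y"
  unfolding mat_vec_def by (auto intro!: sum.cong)

lemma unitary_group_mult:
  assumes "A \<in> unitary_group k" "B \<in> unitary_group k"
  shows "cmat_mult k A B \<in> unitary_group k"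
proof (rule unitary_groupI)
  show "is_cmat k (cmat_mult k A B)"
    using unitary_groupD(1)[OF assms(1)] unitary_groupD(1)[OF assms(2)]
    by (auto simp: is_cmat_def cmat_mult_def)
next
  fix i j assume "i < k" "j < k"
  have "(\<Sum>l<k. cnj (cmat_mult k A B l i) * cmat_mult k A B l j)
      = hip k (mat_vec k A (\<lambda>q. B q i)) (mat_vec k A (\<lambda>q. B q j))"
    by (simp add: hip_def mat_vec_def cmat_mult_def)
  also have "\<dots> = (\<Sum>l<k. cnj (B l i) * B l j)"
    using hip_mat_vec[OF assms(1)] by (simp add: hip_def)
  finally show "(\<Sum>l<k. cnj (cmat_mult k A B l i) * cmat_mult k A B l j) = (if i = j then 1 else 0)"
    using unitary_groupD(2)[OF assms(2) \<open>i < k\<close>] by simp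
qed

lemma unitary_group_id: "cmat_id k \<in> unitary_group k"
proof (rule unitary_groupI)
  fix i j assume "i < k" "j < k"
  have "(\<Sum>l<k. cnj (cmat_id k l i) * cmat_id k l j) = (\<Sum>l<k. if l = i then (if i = j then 1 else 0) else 0)"
    by (intro sum.cong refl) (auto simp: cmat_id_def)
  then show "(\<Sum>l<k. cnj (cmat_id k l i) * cmat_id k l j) = (if i = j then 1 else 0)"
    using \<open>i < k\<close> by simp
qed (auto simp: is_cmat_def cmat_id_def)

lemma mat_vec_id: "i < k \<Longrightarrow> mat_vec k (cmat_id k) x i = x i"
proof -
  assume "i < k"
  have "mat_vec k (cmat_id k) x i = (\<Sum>j<k. if j = i then x j else 0)"
    unfolding mat_vec_def using \<open>i < k\<close> by (intro sum.cong) (auto simp: cmat_id_def)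
  then show ?thesis using \<open>i < k\<close> by simp
qed

text \<open>For \<open>|x| = |y|\<close> and \<open>u = x - y\<close>, the matrix \<open>I - u u\<^sup>* / (u\<^sup>* x)\<close> is unitary and maps \<open>x\<close> to \<open>y\<close>.\<close>

lemma unitary_reflection:
  assumes "hip k x x = hip k y y"
  shows "\<exists>A\<in>unitary_group k. (\<forall>i<k. mat_vec k A x i = y i)
    \<and> (\<forall>z. hip k (\<lambda>i. x i - y i) z = 0 \<longrightarrow> (\<forall>i<k. mat_vec k A z i = z i))
    \<and> ((\<forall>i. x i \<in> \<real> \<and> y i \<in> \<real>) \<longrightarrow> (\<forall>i j. A i j \<in> \<real>))"
proof (cases "\<forall>i<k. x i = y i")
  case True
  show ?thesis
    by (rule bexI[OF _ unitary_group_id]) (use True mat_vec_id in \<open>auto simp: cmat_id_def\<close>)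
next
  case False
  define u where "u = (\<lambda>i. x i - y i)"
  define s where "s = hip k u x"
  have "cnj s = hip k x u" by (simp only: s_def cnj_hip)
  \<comment> \<open>Equality of the norms of \<open>x\<close> and \<open>y\<close> gives this
    identity. It makes \<open>s\<close> non-zero and is exactly the condition for
    \<open>I - u u\<^sup>* / s\<close> to be unitary.\<close>
  then have N: "hip k u u = s + cnj s"
    using assms unfolding s_def u_def hip_diff_left hip_diff_right by simp
  have "hip k u u \<noteq> 0"
  proof
    assume "hip k u u = 0"
    then have "\<forall>i<k. u i = 0" using hip_self_eq_0 by blast
    with False show False by (auto simp: u_def)
  qed
  then have s0: "s \<noteq> 0" using N by auto
  define A where "A = (\<lambda>i j. if i < k \<and> j < k then (if i = j then 1 else 0) - u i * cnj (u j) / s else 0)"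
  have act: "mat_vec k A z i = z i - u i * (hip k u z / s)" if "i < k" for z i
  proof -
    have "mat_vec k A z i = (\<Sum>j<k. (if j = i then z j else 0) - u i * (cnj (u j) * z j) / s)"
      unfolding mat_vec_def A_def using that by (intro sum.cong) (auto simp: left_diff_distrib)
    also have "\<dots> = z i - u i * (hip k u z / s)"
      using that by (simp add: sum_subtractf hip_def sum_distrib_left sum_divide_distrib)
    finally show ?thesis .
  qed
  have "A \<in> unitary_group k"
  proof (rule unitary_groupI)
    show "is_cmat k A" by (auto simp: is_cmat_def A_def)
    fix i j assume ij: "i < k" "j < k"
    have "(\<Sum>l<k. cnj (A l i) * A l j) = (\<Sum>l<k. (if l = i then (if i = j then 1 else 0) - u i * cnj (u j) / s else 0)
       - (if l = j then cnj (u j) * u i / cnj s else 0) + (cnj (u l) * u l) * (u i * cnj (u j) / (cnj s * s)))"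
      using ij by (intro sum.cong refl) (auto simp: A_def algebra_simps)
    also have "\<dots> = (if i = j then 1 else 0) - u i * cnj (u j) / s - cnj (u j) * u i / cnj s
        + hip k u u * (u i * cnj (u j) / (cnj s * s))"
      using ij unfolding sum.distrib sum_subtractf hip_def sum_distrib_right[symmetric] by simp
    also have "\<dots> = (if i = j then 1 else 0)"
      unfolding N using s0 by (simp add: field_simps)
    finally show "(\<Sum>l<k. cnj (A l i) * A l j) = (if i = j then 1 else 0)" .
  qed
  moreover have "mat_vec k A x i = y i" if "i < k" for i
    unfolding act[OF that] s_def[symmetric] using s0 by (simp add: u_def)
  moreover have "mat_vec k A z i = z i" if "hip k (\<lambda>i. x i - y i) z = 0" "i < k" for z i
    using act[OF that(2), of z] that(1) by (simp add: u_def)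
  moreover have "A i j \<in> \<real>" if "\<forall>i. x i \<in> \<real> \<and> y i \<in> \<real>" for i j
  proof -
    have "u i \<in> \<real>" for i using that by (auto simp: u_def)
    then have r: "u i \<in> \<real>" "cnj (u i) \<in> \<real>" for i by (metis Reals_cnj_iff)+
    then have "s \<in> \<real>" using that by (auto simp: s_def hip_def intro!: sum_in_Reals Reals_mult)
    then show ?thesis using r by (auto simp: A_def intro!: Reals_diff Reals_divide Reals_mult)
  qed
  ultimately show ?thesis by blast
qed

lemma mat_vec_real: "(\<forall>i j. A i j \<in> \<real>) \<Longrightarrow> (\<forall>i. x i \<in> \<real>) \<Longrightarrow> mat_vec k A x i \<in> \<real>"
  unfolding mat_vec_def by (intro sum_in_Reals Reals_mult) auto

lemma cmat_mult_real: "(\<forall>i j. A i j \<in> \<real>) \<Longrightarrow> (\<forall>i j. B i j \<in> \<real>) \<Longrightarrow> cmat_mult k A B i j \<in> \<real>"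
  unfolding cmat_mult_def by (intro sum_in_Reals Reals_mult) auto

text \<open>One reflection carries \<open>x\<close> to \<open>x'\<close>, a second carries the moved
  \<open>w\<close> to \<open>w'\<close>. Equality of the mixed products makes the vector of the
  second reflection orthogonal to \<open>x'\<close>, so \<open>x'\<close> stays fixed.\<close>

lemma unitary_pair_transitive:
  assumes "hip k x x = hip k x' x'" "hip k w w = hip k w' w'" "hip k w x = hip k w' x'"
  shows "\<exists>A\<in>unitary_group k. (\<forall>i<k. mat_vec k A x i = x' i) \<and> (\<forall>i<k. mat_vec k A w i = w' i)
    \<and> ((\<forall>i. x i \<in> \<real> \<and> x' i \<in> \<real> \<and> w i \<in> \<real> \<and> w' i \<in> \<real>) \<longrightarrow> (\<forall>i j. A i j \<in> \<real>))"
proof -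
  obtain A1 where A1: "A1 \<in> unitary_group k" "\<And>i. i < k \<Longrightarrow> mat_vec k A1 x i = x' i"
    "(\<forall>i. x i \<in> \<real> \<and> x' i \<in> \<real>) \<longrightarrow> (\<forall>i j. A1 i j \<in> \<real>)"
    using unitary_reflection[OF assms(1)] by blast
  define w1 where "w1 = mat_vec k A1 w"
  have "hip k w1 w1 = hip k w' w'" unfolding w1_def hip_mat_vec[OF A1(1)] by (rule assms)
  from unitary_reflection[OF this] obtain A2 where A2: "A2 \<in> unitary_group k"
    "\<And>i. i < k \<Longrightarrow> mat_vec k A2 w1 i = w' i"
    "\<And>z. hip k (\<lambda>i. w1 i - w' i) z = 0 \<longrightarrow> (\<forall>i<k. mat_vec k A2 z i = z i)"
    "(\<forall>i. w1 i \<in> \<real> \<and> w' i \<in> \<real>) \<longrightarrow> (\<forall>i j. A2 i j \<in> \<real>)" by blast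
  have "hip k w1 x' = hip k w1 (mat_vec k A1 x)" by (rule hip_cong) (simp_all add: A1(2))
  also have "\<dots> = hip k w' x'" unfolding w1_def hip_mat_vec[OF A1(1)] by (rule assms)
  finally have fixed: "hip k (\<lambda>i. w1 i - w' i) x' = 0" by (simp add: hip_diff_left)
  show ?thesis
  proof (intro bexI[of _ "cmat_mult k A2 A1"] conjI allI impI)
    show "cmat_mult k A2 A1 \<in> unitary_group k" by (rule unitary_group_mult[OF A2(1) A1(1)])
    fix i assume i: "i < k"
    have "mat_vec k A2 (mat_vec k A1 x) = mat_vec k A2 x'" by (rule mat_vec_cong) (rule A1(2))
    then show "mat_vec k (cmat_mult k A2 A1) x i = x' i"
      unfolding mat_vec_cmat_mult using A2(3)[of x'] fixed i by simp
    show "mat_vec k (cmat_mult k A2 A1) w i = w' i"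
      unfolding mat_vec_cmat_mult w1_def[symmetric] by (rule A2(2)[OF i])
  next
    assume r: "\<forall>i. x i \<in> \<real> \<and> x' i \<in> \<real> \<and> w i \<in> \<real> \<and> w' i \<in> \<real>"
    then have 1: "\<forall>i j. A1 i j \<in> \<real>" using A1(3) by blast
    then have "\<forall>i. w1 i \<in> \<real>" unfolding w1_def using mat_vec_real r by blast
    then have "\<forall>i j. A2 i j \<in> \<real>" using A2(4) r by blast
    with 1 show "cmat_mult k A2 A1 i j \<in> \<real>" for i j using cmat_mult_real by blast
  qed
qed

section \<open>Index blocks and the compact symplectic group\<close>

lemma sum_lessThan_split: "(\<Sum>l<a + b. f l) = (\<Sum>l<a. f l) + (\<Sum>l<b. f (a + l))" for f :: "nat \<Rightarrow> 'a::comm_monoid_add"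
  by (induction b) (auto simp: add.assoc)

lemma sum_lessThan_single:
  fixes h :: "nat \<Rightarrow> 'a::comm_monoid_add"
  assumes "i < N" "\<And>l. l < N \<Longrightarrow> l \<noteq> i \<Longrightarrow> h l = 0"
  shows "(\<Sum>l<N. h l) = h i"
proof -
  have "(\<Sum>l<N. h l) = (\<Sum>l\<in>{i}. h l)"
    by (rule sum.mono_neutral_right) (use assms in auto)
  then show ?thesis by simp
qed

lemma sum_lessThan_pair:
  fixes h :: "nat \<Rightarrow> 'a::comm_monoid_add"
  assumes "2 \<le> N" "\<And>l. 2 \<le> l \<Longrightarrow> l < N \<Longrightarrow> h l = 0"
  shows "(\<Sum>l<N. h l) = h 0 + h 1"
proof -
  have "(\<Sum>l<N. h l) = (\<Sum>l\<in>{0, 1}. h l)"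
    by (rule sum.mono_neutral_right) (use assms in auto)
  then show ?thesis by simp
qed

text \<open>The last two hypotheses say that \<open>A\<close> commutes with the quaternionic structure.\<close>

lemma compact_symplectic_groupI:
  assumes U: "A \<in> unitary_group (2*m)"
    and c1: "\<And>i l. i < m \<Longrightarrow> l < m \<Longrightarrow> A (m + i) (m + l) = cnj (A i l)"
    and c2: "\<And>i l. i < m \<Longrightarrow> l < m \<Longrightarrow> A (m + i) l = - cnj (A i (m + l))"
  shows "A \<in> compact_symplectic_group m"
proof -
  \<comment> \<open>Commutation with the quaternionic structure turns \<open>A\<^sup>T J\<close>
    into the rows of the adjoint of \<open>A\<close>, up to order and sign; the remaining product is
    then an instance of unitarity.\<close>
  have row: "cmat_mult (2*m) (cmat_transp A) (symp_J m) i p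
     = (if i < m then cnj (A p (m + i)) else - cnj (A p (i - m)))" if "i < 2*m" "p < 2*m" for i p
  proof -
    have "cmat_mult (2*m) (cmat_transp A) (symp_J m) i p = (\<Sum>q<2*m. A q i * symp_J m q p)"
      by (simp add: cmat_mult_def cmat_transp_def)
    also have "\<dots> = (\<Sum>q<2*m. if q = (if p < m then p + m else p - m) then (if p < m then - A q i else A q i) else 0)"
      using that by (intro sum.cong refl) (auto simp: symp_J_def)
    also have "\<dots> = (if p < m then - A (p + m) i else A (p - m) i)"
      using that by auto
    also have "\<dots> = (if i < m then cnj (A p (m + i)) else - cnj (A p (i - m)))"
      using that c1[of p "i - m"] c2[of p i] c1[of "p - m" i] c2[of "p - m" "i - m"]
      by (auto simp: add.commute)
    finally show ?thesis .
  qed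
  have "cmat_mult (2*m) (cmat_mult (2*m) (cmat_transp A) (symp_J m)) A i l = symp_J m i l" for i l
  proof (cases "i < 2*m")
    case True
    have "cmat_mult (2*m) (cmat_mult (2*m) (cmat_transp A) (symp_J m)) A i l
       = (\<Sum>p<2*m. (if i < m then cnj (A p (m + i)) else - cnj (A p (i - m))) * A p l)"
      unfolding cmat_mult_def[of _ _ A] using row True by (intro sum.cong) auto
    also have "\<dots> = (if i < m then (\<Sum>p<2*m. cnj (A p (m + i)) * A p l) else - (\<Sum>p<2*m. cnj (A p (i - m)) * A p l))"
      by (simp add: sum_negf)
    also have "\<dots> = symp_J m i l"
      using True unitary_groupD(2)[OF U, of "m + i" l] unitary_groupD(2)[OF U, of "i - m" l]
      by (auto simp: symp_J_def)
    finally show ?thesis .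
  next
    case False
    have "A q i = 0" for q using unitary_groupD(1)[OF U] False by (auto simp: is_cmat_def)
    then show ?thesis using False by (simp add: cmat_mult_def cmat_transp_def symp_J_def)
  qed
  then show ?thesis using U by (auto simp: compact_symplectic_group_def fun_eq_iff)
qed

text \<open>The action of the quaternion unit j on C^(2m), antilinear with square -1. A non-zero
  \<open>u\<close> and \<open>quat_j m u\<close> form an orthogonal basis of the quaternionic line
  through \<open>u\<close>.\<close>

definition quat_j :: "nat \<Rightarrow> (nat \<Rightarrow> complex) \<Rightarrow> nat \<Rightarrow> complex" where
  "quat_j m z i = (if i < m then - cnj (z (m + i)) else cnj (z (i - m)))"

lemma hip_quat_j: "hip (2*m) (quat_j m x) (quat_j m y) = hip (2*m) y x"
  unfolding hip_def mult_2 sum_lessThan_split by (simp add: quat_j_def mult.commute)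

lemma hip_quat_j_self: "hip (2*m) (quat_j m x) x = 0"
  unfolding hip_def mult_2 sum_lessThan_split by (simp add: quat_j_def sum_negf mult.commute)

text \<open>The quaternionic analogue \<open>I - u s\<^sup>-\<^sup>1 u\<^sup>*\<close> of the reflection above, with the quaternion
  \<open>s = u\<^sup>* x\<close> written as the pair \<open>(a, b)\<close>.\<close>

lemma symplectic_transitive:
  assumes "hip (2*m) x x = hip (2*m) y y"
  obtains A where "A \<in> compact_symplectic_group m" "\<And>i. i < 2*m \<Longrightarrow> mat_vec (2*m) A x i = y i"
proof (cases "\<forall>i<2*m. x i = y i")
  case True
  have "cmat_id (2*m) \<in> compact_symplectic_group m"
    by (rule compact_symplectic_groupI[OF unitary_group_id]) (auto simp: cmat_id_def)
  then show ?thesis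
    by (rule that) (use True mat_vec_id in auto)
next
  case False
  define u where "u = (\<lambda>i. x i - y i)"
  define v where "v = quat_j m u"
  define a where "a = hip (2*m) u x"
  define b where "b = hip (2*m) v x"
  \<comment> \<open>The inverse of the squared modulus of the quaternion \<open>(a, b)\<close>, so
    that its inverse is \<open>K\<close> times its conjugate.\<close>
  define K where "K = inverse (a * cnj a + b * cnj b)"
  have "cnj a = hip (2*m) x u" by (simp only: a_def cnj_hip)
  then have N: "hip (2*m) u u = a + cnj a"
    using assms unfolding a_def u_def hip_diff_left hip_diff_right by simp
  have Nv: "hip (2*m) v v = a + cnj a" unfolding v_def hip_quat_j by (rule N)
  have vu: "hip (2*m) v u = 0" unfolding v_def by (rule hip_quat_j_self)
  have uv: "hip (2*m) u v = 0" using cnj_hip[of "2*m" v u] vu by simp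
  have "hip (2*m) u u \<noteq> 0"
  proof
    assume "hip (2*m) u u = 0"
    then have "\<forall>i<2*m. u i = 0" using hip_self_eq_0 by blast
    with False show False by (auto simp: u_def)
  qed
  then have "a \<noteq> 0" using N by auto
  then have "(cmod a)\<^sup>2 + (cmod b)\<^sup>2 \<noteq> 0" by (simp add: add_nonneg_eq_0_iff)
  moreover have "a * cnj a + b * cnj b = of_real ((cmod a)\<^sup>2 + (cmod b)\<^sup>2)"
    by (simp only: of_real_add complex_norm_square)
  ultimately have "a * cnj a + b * cnj b \<noteq> 0" by (simp only: of_real_eq_0_iff not_False_eq_True)
  then have K: "K * (a * cnj a + b * cnj b) = 1" by (simp add: K_def)
  have cK: "cnj K = K" by (simp add: K_def mult.commute)
  \<comment> \<open>\<open>P\<close> and \<open>R\<close> are the coefficients of \<open>u\<close>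
    and \<open>v\<close> in \<open>u s\<^sup>-\<^sup>1 u\<^sup>*\<close>, a map of quaternionic rank
    one.\<close>
  define P where "P l = K * (cnj a * cnj (u l) + cnj b * cnj (v l))" for l
  define R where "R l = K * (a * cnj (v l) - b * cnj (u l))" for l
  have cP: "cnj (P l) = K * (a * u l + b * v l)" and cR: "cnj (R l) = K * (cnj a * v l - cnj b * u l)" for l
    by (simp_all add: P_def R_def cK)
  define A where "A = (\<lambda>i l. if i < 2*m \<and> l < 2*m then (if i = l then 1 else 0) - (u i * P l + v i * R l) else 0)"
  have U: "A \<in> unitary_group (2*m)"
  proof (rule unitary_groupI)
    show "is_cmat (2*m) A" by (auto simp: is_cmat_def A_def)
    fix i j assume ij: "i < 2*m" "j < 2*m"
    have "(\<Sum>l<2*m. cnj (A l i) * A l j) = (\<Sum>l<2*m. (if l = i then (if i = j then 1 else 0) - (u i * P j + v i * R j) else 0)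
       - (if l = j then cnj (u j) * cnj (P i) + cnj (v j) * cnj (R i) else 0)
       + ((cnj (u l) * u l) * (cnj (P i) * P j) + (cnj (u l) * v l) * (cnj (P i) * R j)
          + (cnj (v l) * u l) * (cnj (R i) * P j) + (cnj (v l) * v l) * (cnj (R i) * R j)))"
      using ij by (intro sum.cong refl) (auto simp: A_def algebra_simps)
    also have "\<dots> = (if i = j then 1 else 0) - (u i * P j + v i * R j) - (cnj (u j) * cnj (P i) + cnj (v j) * cnj (R i))
        + (hip (2*m) u u * (cnj (P i) * P j) + hip (2*m) u v * (cnj (P i) * R j)
          + hip (2*m) v u * (cnj (R i) * P j) + hip (2*m) v v * (cnj (R i) * R j))"
      using ij unfolding sum.distrib sum_subtractf hip_def sum_distrib_right[symmetric] by simp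
    also have "\<dots> = (if i = j then 1 else 0) - (u i * P j + v i * R j) - (cnj (u j) * cnj (P i) + cnj (v j) * cnj (R i))
        + (a + cnj a) * (cnj (P i) * P j + cnj (R i) * R j)"
      unfolding N Nv uv vu by (simp add: algebra_simps)
    also have "(a + cnj a) * (cnj (P i) * P j + cnj (R i) * R j)
        = (u i * P j + v i * R j) + (cnj (u j) * cnj (P i) + cnj (v j) * cnj (R i))"
    proof -
      \<comment> \<open>Conjugates enter as independent variables; both sides become
        \<open>K * (a + a') * (ui * uj + vi * vj)\<close> once \<open>K * (a * a' + b * b')\<close>
        is 1.\<close>
      have "(a + a') * (K * (a * ui + b * vi) * (K * (a' * uj + b' * vj)) + K * (a' * vi - b' * ui) * (K * (a * vj - b * uj)))
          = (K * (a * a' + b * b')) * (K * (a + a') * (ui * uj + vi * vj))"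
        "(ui * (K * (a' * uj + b' * vj)) + vi * (K * (a * vj - b * uj)))
          + (uj * (K * (a * ui + b * vi)) + vj * (K * (a' * vi - b' * ui))) = K * (a + a') * (ui * uj + vi * vj)"
        for a' b' ui vi uj vj
        by (simp_all add: algebra_simps)
      then show ?thesis
        unfolding cP cR unfolding P_def R_def K mult_1_left by (simp only: K mult_1_left)
    qed
    finally show "(\<Sum>l<2*m. cnj (A l i) * A l j) = (if i = j then 1 else 0)" by simp
  qed
  have vm: "v i = - cnj (u (i + m))" "v (i + m) = cnj (u i)" if "i < m" for i
    using that by (auto simp: v_def quat_j_def add.commute)
  have "A \<in> compact_symplectic_group m"
  proof (rule compact_symplectic_groupI[OF U])
    fix i l assume il: "i < m" "l < m"
    show "A (m + i) (m + l) = cnj (A i l)" "A (m + i) l = - cnj (A i (m + l))"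
      unfolding add.commute[of m] using il by (auto simp: A_def P_def R_def vm cK algebra_simps)
  qed
  moreover have "mat_vec (2*m) A x i = y i" if "i < 2*m" for i
  proof -
    have "mat_vec (2*m) A x i = (\<Sum>j<2*m. (if j = i then x j else 0)
       - (u i * K * cnj a - v i * K * b) * (cnj (u j) * x j) - (u i * K * cnj b + v i * K * a) * (cnj (v j) * x j))"
      unfolding mat_vec_def A_def P_def R_def using that by (intro sum.cong refl) (auto simp: algebra_simps)
    also have "\<dots> = x i - (u i * K * cnj a - v i * K * b) * a - (u i * K * cnj b + v i * K * a) * b"
      using that unfolding sum_subtractf sum_distrib_left[symmetric] by (simp add: a_def b_def hip_def)
    also have "\<dots> = x i - u i * (K * (a * cnj a + b * cnj b))" by (simp add: algebra_simps)
    also have "\<dots> = y i" unfolding K by (simp add: u_def)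
    finally show ?thesis .
  qed
  ultimately show ?thesis using that by blast
qed

section \<open>Determinants and the special orthogonal group\<close>

lemma cmat_det_eq: "cmat_det k A = Determinant.det (Matrix.mat k k (\<lambda>(i, j). A i j))"
proof -
  have "(\<Prod>i = 0..<k. Matrix.mat k k (\<lambda>(i, j). A i j) $$ (i, p i)) = (\<Prod>i<k. A i (p i))"
    if "p permutes {..<k}" for p
    using permutes_in_image[OF that] by (auto simp: lessThan_atLeast0 intro!: prod.cong)
  then show ?thesis
    unfolding cmat_det_def Determinant.det_def by (auto simp: lessThan_atLeast0 intro!: sum.cong)
qed

lemma cmat_det_mult: "cmat_det k (cmat_mult k A B) = cmat_det k A * cmat_det k B"
proof -
  have "Matrix.mat k k (\<lambda>(i, j). cmat_mult k A B i j)
      = Matrix.mat k k (\<lambda>(i, j). A i j) * Matrix.mat k k (\<lambda>(i, j). B i j)"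
    by (rule eq_matI) (auto simp: cmat_mult_def scalar_prod_def lessThan_atLeast0)
  then show ?thesis
    unfolding cmat_det_eq by (simp add: det_mult[of _ k])
qed

lemma cmat_det_id: "cmat_det k (cmat_id k) = 1"
proof -
  have "Matrix.mat k k (\<lambda>(i, j). cmat_id k i j) = 1\<^sub>m k"
    by (rule eq_matI) (auto simp: cmat_id_def)
  then show ?thesis unfolding cmat_det_eq by simp
qed

lemma cmat_det_transp: "cmat_det k (cmat_transp A) = cmat_det k A"
proof -
  have "Matrix.mat k k (\<lambda>(i, j). cmat_transp A i j) = transpose_mat (Matrix.mat k k (\<lambda>(i, j). A i j))"
    by (rule eq_matI) (auto simp: cmat_transp_def)
  then show ?thesis unfolding cmat_det_eq by (simp add: det_transpose[of _ k])
qed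

lemma cmat_det_real_unitary:
  assumes "A \<in> unitary_group k" "\<forall>i j. A i j \<in> \<real>"
  shows "cmat_det k A = 1 \<or> cmat_det k A = -1"
proof -
  have "cmat_adj A = cmat_transp A"
    using assms(2) by (auto simp: cmat_adj_def cmat_transp_def fun_eq_iff Reals_cnj_iff)
  then have "cmat_mult k (cmat_transp A) A = cmat_id k"
    using assms(1) by (simp add: unitary_group_def)
  then have "cmat_det k A * cmat_det k A = 1"
    using cmat_det_mult[of k "cmat_transp A" A] by (simp add: cmat_det_transp cmat_det_id)
  then show ?thesis by (simp add: square_eq_1_iff)
qed

text \<open>A real orthogonal matrix of determinant -1 (for \<open>k > 0\<close>) that fixes vectors
  with last coordinate 0; it corrects determinants without moving such vectors.\<close>

definition last_flip :: "nat \<Rightarrow> nat \<Rightarrow> nat \<Rightarrow> complex" where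
  "last_flip k = (\<lambda>i j. if i = j \<and> i < k then (if Suc i = k then -1 else 1) else 0)"

lemma last_flip_unitary: "last_flip k \<in> unitary_group k"
proof (rule unitary_groupI)
  fix i j assume "i < k" "j < k"
  have "(\<Sum>l<k. cnj (last_flip k l i) * last_flip k l j) = (\<Sum>l<k. if l = i then (if i = j then 1 else 0) else 0)"
    by (intro sum.cong refl) (auto simp: last_flip_def)
  then show "(\<Sum>l<k. cnj (last_flip k l i) * last_flip k l j) = (if i = j then 1 else 0)"
    using \<open>i < k\<close> by simp
qed (auto simp: is_cmat_def last_flip_def)

lemma last_flip_real: "last_flip k i j \<in> \<real>"
  by (auto simp: last_flip_def)

lemma cmat_det_last_flip:
  assumes "k > 0"
  shows "cmat_det k (last_flip k) = -1"
proof -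
  obtain k' where k: "k = Suc k'" using assms gr0_conv_Suc by auto
  let ?M = "Matrix.mat k k (\<lambda>(i, j). last_flip k i j)"
  have "upper_triangular ?M" by (auto simp: last_flip_def)
  then have "Determinant.det ?M = prod_list (diag_mat ?M)"
    by (rule det_upper_triangular) auto
  also have "\<dots> = (\<Prod>i = 0..<k. if Suc i = k then -1 else 1)"
    unfolding prod_list_diag_prod by (auto simp: last_flip_def intro!: prod.cong)
  also have "\<dots> = -1" unfolding k by simp
  finally show ?thesis unfolding cmat_det_eq .
qed

lemma mat_vec_last_flip:
  assumes "i < k" "x (k - 1) = 0"
  shows "mat_vec k (last_flip k) x i = x i"
proof -
  have "mat_vec k (last_flip k) x i = (\<Sum>j<k. if j = i then x j else 0)"
    unfolding mat_vec_def using assms by (intro sum.cong) (auto simp: last_flip_def)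
  then show ?thesis using assms by simp
qed

lemma special_orthogonal_group_mult:
  assumes "A \<in> special_orthogonal_group k" "B \<in> special_orthogonal_group k"
  shows "cmat_mult k A B \<in> special_orthogonal_group k"
  using assms unitary_group_mult cmat_mult_real[of A B]
  by (auto simp: special_orthogonal_group_def cmat_det_mult)

text \<open>\<open>x\<close> is turned onto the first axis and \<open>w\<close> into the plane of
  the first two axes; as \<open>k \<ge> 3\<close>, the last coordinate of both is 0, which leaves
  room for \<open>last_flip\<close>.\<close>

lemma real_pair_normal_form:
  assumes "k \<ge> 3" "\<forall>i. x i \<in> \<real>" "\<forall>i. w i \<in> \<real>"
  obtains A where "A \<in> unitary_group k" "\<forall>i j. A i j \<in> \<real>"
    "mat_vec k A x (k - 1) = 0" "mat_vec k A w (k - 1) = 0"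
proof -
  have norm: "\<exists>r::real. hip k x x = of_real r \<and> r \<ge> 0" for x
    by (rule exI[of _ "\<Sum>i<k. (cmod (x i))\<^sup>2"]) (simp only: hip_self sum_nonneg zero_le_power2)
  obtain r where r: "hip k x x = of_real r" "r \<ge> 0" using norm by blast
  define t where "t = (\<lambda>i::nat. if i = 0 then complex_of_real (sqrt r) else 0)"
  have "hip k t t = (\<Sum>i<k. if i = 0 then complex_of_real r else 0)"
    unfolding hip_def t_def using r(2) by (intro sum.cong) (auto simp flip: of_real_mult)
  then have "hip k x x = hip k t t" using assms(1) r(1) by simp
  from unitary_reflection[OF this] obtain A1 where A1: "A1 \<in> unitary_group k"
    "\<And>i. i < k \<Longrightarrow> mat_vec k A1 x i = t i"
    "(\<forall>i. x i \<in> \<real> \<and> t i \<in> \<real>) \<longrightarrow> (\<forall>i j. A1 i j \<in> \<real>)" by blast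
  have tr: "t i \<in> \<real>" for i by (simp add: t_def)
  then have A1r: "\<forall>i j. A1 i j \<in> \<real>" using A1(3) assms(2) by blast
  define w1 where "w1 = mat_vec k A1 w"
  have w1r: "\<forall>i. w1 i \<in> \<real>" unfolding w1_def using mat_vec_real[OF A1r assms(3)] by blast
  define q where "q = (\<Sum>i\<in>{1..<k}. (cmod (w1 i))\<^sup>2)"
  have q0: "q \<ge> 0" unfolding q_def by (intro sum_nonneg) auto
  \<comment> \<open>The target keeps entry 0 of \<open>w1\<close> and collects the norm of the other
    entries in entry 1. Then \<open>w1 - t2\<close> vanishes at 0, hence is orthogonal to
    \<open>t\<close>, and the second reflection fixes \<open>t\<close>.\<close>
  define t2 where "t2 = (\<lambda>i::nat. if i = 0 then w1 0 else if i = 1 then complex_of_real (sqrt q) else 0)"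
  have split: "(\<Sum>i<k. f i) = f 0 + (\<Sum>i\<in>{1..<k}. f i)" for f :: "nat \<Rightarrow> real"
    using assms(1) by (simp add: lessThan_atLeast0 sum.atLeast_Suc_lessThan)
  have "(\<Sum>i\<in>{1..<k}. (cmod (t2 i))\<^sup>2) = (\<Sum>i\<in>{1..<k}. if i = 1 then q else 0)"
    using q0 by (intro sum.cong) (auto simp: t2_def)
  also have "\<dots> = q" using assms(1) by simp
  finally have "hip k w1 w1 = hip k t2 t2"
    unfolding hip_self split by (simp add: q_def t2_def)
  from unitary_reflection[OF this] obtain A2 where A2: "A2 \<in> unitary_group k"
    "\<And>i. i < k \<Longrightarrow> mat_vec k A2 w1 i = t2 i"
    "\<And>z. hip k (\<lambda>i. w1 i - t2 i) z = 0 \<longrightarrow> (\<forall>i<k. mat_vec k A2 z i = z i)"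
    "(\<forall>i. w1 i \<in> \<real> \<and> t2 i \<in> \<real>) \<longrightarrow> (\<forall>i j. A2 i j \<in> \<real>)" by blast
  have A2r: "\<forall>i j. A2 i j \<in> \<real>" using A2(4) w1r by (auto simp: t2_def)
  have fixed: "hip k (\<lambda>i. w1 i - t2 i) t = 0"
    unfolding hip_def by (intro sum.neutral) (auto simp: t_def t2_def)
  have k1: "k - 1 < k" "k - 1 \<noteq> 0" "k - 1 \<noteq> 1" using assms(1) by auto
  show ?thesis
  proof (rule that[of "cmat_mult k A2 A1"])
    show "cmat_mult k A2 A1 \<in> unitary_group k" by (rule unitary_group_mult[OF A2(1) A1(1)])
    show "\<forall>i j. cmat_mult k A2 A1 i j \<in> \<real>" using cmat_mult_real[OF A2r A1r] by blast
    have "mat_vec k A2 (mat_vec k A1 x) = mat_vec k A2 t" by (rule mat_vec_cong) (rule A1(2))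
    then show "mat_vec k (cmat_mult k A2 A1) x (k - 1) = 0"
      unfolding mat_vec_cmat_mult using A2(3)[of t] fixed k1 by (simp add: t_def)
    show "mat_vec k (cmat_mult k A2 A1) w (k - 1) = 0"
      unfolding mat_vec_cmat_mult w1_def[symmetric] using A2(2)[OF k1(1)] k1 by (simp add: t2_def)
  qed
qed

text \<open>The map is factored through a pair with last coordinate 0. At that pair each factor may
  be multiplied by \<open>last_flip\<close>, so both can be given determinant 1.\<close>

lemma special_orthogonal_pair_transitive:
  assumes "k \<ge> 3" "\<forall>i. x i \<in> \<real> \<and> x' i \<in> \<real> \<and> w i \<in> \<real> \<and> w' i \<in> \<real>"
    and "hip k x x = hip k x' x'" "hip k w w = hip k w' w'" "hip k w x = hip k w' x'"
  obtains C where "C \<in> special_orthogonal_group k" "\<And>i. i < k \<Longrightarrow> mat_vec k C x i = x' i"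
    "\<And>i. i < k \<Longrightarrow> mat_vec k C w i = w' i"
proof -
  have xw: "\<forall>i. x i \<in> \<real>" "\<forall>i. w i \<in> \<real>" using assms(2) by auto
  obtain A where A: "A \<in> unitary_group k" "\<forall>i j. A i j \<in> \<real>"
    "mat_vec k A x (k - 1) = 0" "mat_vec k A w (k - 1) = 0"
    using real_pair_normal_form[OF assms(1) xw] by blast
  define s t where "s = mat_vec k A x" and "t = mat_vec k A w"
  have str: "\<forall>i. s i \<in> \<real> \<and> t i \<in> \<real>" unfolding s_def t_def using mat_vec_real[OF A(2)] xw by blast
  have "hip k s s = hip k x' x'" "hip k t t = hip k w' w'" "hip k t s = hip k w' x'"
    unfolding s_def t_def hip_mat_vec[OF A(1)] using assms by auto
  from unitary_pair_transitive[OF this] obtain B where B: "B \<in> unitary_group k"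
    "\<And>i. i < k \<Longrightarrow> mat_vec k B s i = x' i" "\<And>i. i < k \<Longrightarrow> mat_vec k B t i = w' i"
    "(\<forall>i. s i \<in> \<real> \<and> x' i \<in> \<real> \<and> t i \<in> \<real> \<and> w' i \<in> \<real>) \<longrightarrow> (\<forall>i j. B i j \<in> \<real>)" by blast
  have Br: "\<forall>i j. B i j \<in> \<real>" using B(4) str assms(2) by blast
  have k0: "k > 0" using assms(1) by simp
  let ?R = "last_flip k"
  have Rs: "mat_vec k ?R s i = s i" "mat_vec k ?R t i = t i" if "i < k" for i
    using mat_vec_last_flip[OF that] A(3,4) by (auto simp: s_def t_def)
  define A' where "A' = (if cmat_det k A = 1 then A else cmat_mult k ?R A)"
  define B' where "B' = (if cmat_det k B = 1 then B else cmat_mult k B ?R)"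
  have A': "A' \<in> special_orthogonal_group k"
    using A(1,2) cmat_det_real_unitary[OF A(1,2)] unitary_group_mult[OF last_flip_unitary A(1)]
      cmat_mult_real[of ?R A] last_flip_real
    by (auto simp: A'_def special_orthogonal_group_def cmat_det_mult cmat_det_last_flip[OF k0])
  have B': "B' \<in> special_orthogonal_group k"
    using B(1) Br cmat_det_real_unitary[OF B(1) Br] unitary_group_mult[OF B(1) last_flip_unitary]
      cmat_mult_real[of B ?R] last_flip_real
    by (auto simp: B'_def special_orthogonal_group_def cmat_det_mult cmat_det_last_flip[OF k0])
  have a: "mat_vec k A' x i = s i" "mat_vec k A' w i = t i" if "i < k" for i
    using Rs[OF that] by (auto simp: A'_def s_def t_def mat_vec_cmat_mult)
  have b: "mat_vec k B' s i = x' i" "mat_vec k B' t i = w' i" if "i < k" for i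
    using B(2,3)[OF that] mat_vec_cong[of k "mat_vec k ?R s" s B] mat_vec_cong[of k "mat_vec k ?R t" t B] Rs
    by (auto simp: B'_def mat_vec_cmat_mult)
  show ?thesis
  proof (rule that[OF special_orthogonal_group_mult[OF B' A']])
    fix i assume "i < k"
    then show "mat_vec k (cmat_mult k B' A') x i = x' i" "mat_vec k (cmat_mult k B' A') w i = w' i"
      unfolding mat_vec_cmat_mult
      using b mat_vec_cong[of k "mat_vec k A' x" s B'] mat_vec_cong[of k "mat_vec k A' w" t B'] a by auto
  qed
qed

text \<open>A complex vector is a pair of real ones. |z|^2 is the sum of their squared norms; the
  sum of the squares of the entries has the difference of these norms as real part and twice the
  inner product as imaginary part. Together they give the Gram matrix of the pair.\<close>

lemma special_orthogonal_transitive: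
  assumes "k \<ge> 3" "hip k z z = hip k z' z'" "(\<Sum>i<k. (z i)\<^sup>2) = (\<Sum>i<k. (z' i)\<^sup>2)"
  obtains C where "C \<in> special_orthogonal_group k" "\<And>i. i < k \<Longrightarrow> mat_vec k C z i = z' i"
proof -
  define re im where "re = (\<lambda>(z::nat \<Rightarrow> complex) i. complex_of_real (Re (z i)))"
    and "im = (\<lambda>(z::nat \<Rightarrow> complex) i. complex_of_real (Im (z i)))"
  have dec: "z i = re z i + \<i> * im z i" for z i
    by (simp add: re_def im_def complex_eq_iff)
  define a b c where "a = (\<lambda>z. \<Sum>i<k. (Re (z i :: complex))\<^sup>2)" and "b = (\<lambda>z. \<Sum>i<k. (Im (z i :: complex))\<^sup>2)"
    and "c = (\<lambda>z. \<Sum>i<k. Im (z i :: complex) * Re (z i))"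
  have h: "hip k (re z) (re z) = of_real (a z)" "hip k (im z) (im z) = of_real (b z)"
    "hip k (im z) (re z) = of_real (c z)" for z
    by (simp_all add: hip_def re_def im_def a_def b_def c_def power2_eq_square)
  have "hip k z z = of_real (a z + b z)" for z
    unfolding hip_self by (simp add: a_def b_def cmod_power2 sum.distrib)
  then have 1: "a z + b z = a z' + b z'" using assms(2) by (metis of_real_eq_iff)
  have "(\<Sum>i<k. (z i)\<^sup>2) = Complex (a z - b z) (2 * c z)" for z
    by (simp add: complex_eq_iff a_def b_def c_def sum_subtractf power2_eq_square sum_distrib_left mult_ac)
  then have 2: "a z - b z = a z' - b z'" "c z = c z'" using assms(3) by auto
  have "hip k (re z) (re z) = hip k (re z') (re z')" "hip k (im z) (im z) = hip k (im z') (im z')"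
    "hip k (im z) (re z) = hip k (im z') (re z')"
    unfolding h using 1 2 by auto
  moreover have "\<forall>i. re z i \<in> \<real> \<and> re z' i \<in> \<real> \<and> im z i \<in> \<real> \<and> im z' i \<in> \<real>"
    by (simp add: re_def im_def)
  ultimately obtain C where C: "C \<in> special_orthogonal_group k"
    "\<And>i. i < k \<Longrightarrow> mat_vec k C (re z) i = re z' i" "\<And>i. i < k \<Longrightarrow> mat_vec k C (im z) i = im z' i"
    using special_orthogonal_pair_transitive[OF assms(1)] by blast
  have "mat_vec k C z i = mat_vec k C (re z) i + \<i> * mat_vec k C (im z) i" for i
    unfolding mat_vec_def sum_distrib_left sum.distrib[symmetric]
    by (intro sum.cong refl) (subst dec[of z], simp add: algebra_simps)
  then show ?thesis using that[OF C(1)] C(2,3) dec[of z'] by auto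
qed

section \<open>The two orbit spaces\<close>

text \<open>Common form of the invariants. For U(n), \<open>a\<close> is 1 and -1 on the two halves,
  \<open>d\<close> is 1 and \<open>s\<close> swaps the halves; for the product group,
  \<open>a = d\<close> is the indicator of the second block and \<open>s\<close> is the
  identity.\<close>

definition gram_map :: "('k::finite \<Rightarrow> real) \<Rightarrow> ('k \<Rightarrow> real) \<Rightarrow> ('k \<Rightarrow> 'k) \<Rightarrow> complex^'k \<Rightarrow> real \<times> complex" where
  "gram_map a d s y = (\<Sum>i\<in>UNIV. a i * (cmod (vec_nth y i))\<^sup>2,
     \<Sum>i\<in>UNIV. of_real (d i) * (vec_nth y i * vec_nth y (s i)))"

definition gram_op :: "('k::finite \<Rightarrow> real) \<Rightarrow> ('k \<Rightarrow> real) \<Rightarrow> ('k \<Rightarrow> 'k) \<Rightarrow> real \<times> complex \<Rightarrow> complex^'k \<Rightarrow> complex^'k" where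
  "gram_op a d s b y = (\<chi> i. of_real (fst b * a i) * vec_nth y i + snd b * of_real (d i) * cnj (vec_nth y (s i)))"

lemma cmod_sq: "(cmod z)\<^sup>2 = Re z * Re z + Im z * Im z"
  unfolding cmod_power2 by (simp only: power2_eq_square)

lemma linear_gram_op: "linear (gram_op a d s b)"
proof (rule linearI)
  show "gram_op a d s b (x + y) = gram_op a d s b x + gram_op a d s b y" for x y
    unfolding Finite_Cartesian_Product.vec_eq_iff by (simp add: gram_op_def algebra_simps)
  have "vec_nth (gram_op a d s b (r *\<^sub>R x)) i = vec_nth (r *\<^sub>R gram_op a d s b x) i" for r x i
    unfolding gram_op_def vec_lambda_beta vector_scaleR_component
    by (simp add: scaleR_conv_of_real algebra_simps)
  then show "gram_op a d s b (r *\<^sub>R x) = r *\<^sub>R gram_op a d s b x" for r x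
    unfolding Finite_Cartesian_Product.vec_eq_iff by blast
qed

lemma inner_cvec: "(x::complex^'k::finite) \<bullet> y = (\<Sum>i\<in>UNIV. Re (cnj (vec_nth x i) * vec_nth y i))"
  unfolding inner_vec_def by (simp add: inner_complex_def)

lemma gram_op_self_adjoint:
  assumes s: "\<And>i. s (s i) = i" and d: "\<And>i. d (s i) = d i"
  shows "gram_op a d s b x \<bullet> y = x \<bullet> gram_op a d s b y"
proof -
  let ?g = "snd b"
  have "(\<Sum>i\<in>UNIV. Re (cnj ?g * of_real (d i) * vec_nth x (s i) * vec_nth y i))
      = (\<Sum>i\<in>UNIV. Re (cnj ?g * of_real (d i) * vec_nth x i * vec_nth y (s i)))"
    by (rule sum.reindex_bij_witness[of _ s s]) (auto simp: s d)
  moreover have "gram_op a d s b x \<bullet> y = (\<Sum>i\<in>UNIV. fst b * a i * Re (cnj (vec_nth x i) * vec_nth y i)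
       + Re (cnj ?g * of_real (d i) * vec_nth x (s i) * vec_nth y i))"
    unfolding inner_cvec by (intro sum.cong refl) (simp add: gram_op_def algebra_simps)
  moreover have "x \<bullet> gram_op a d s b y = (\<Sum>i\<in>UNIV. fst b * a i * Re (cnj (vec_nth x i) * vec_nth y i)
       + Re (cnj ?g * of_real (d i) * vec_nth x i * vec_nth y (s i)))"
    unfolding inner_cvec by (intro sum.cong refl) (simp add: gram_op_def algebra_simps)
  ultimately show ?thesis by (simp only: sum.distrib)
qed

lemma gram_map_eq: "gram_map a d s y \<bullet> b = y \<bullet> gram_op a d s b y"
proof -
  have "gram_map a d s y \<bullet> b = (\<Sum>i\<in>UNIV. a i * (cmod (vec_nth y i))\<^sup>2) * fst b
      + (\<Sum>i\<in>UNIV. (of_real (d i) * (vec_nth y i * vec_nth y (s i))) \<bullet> snd b)"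
    by (simp add: gram_map_def inner_prod_def inner_sum_left)
  also have "\<dots> = (\<Sum>i\<in>UNIV. a i * (cmod (vec_nth y i))\<^sup>2 * fst b
      + (of_real (d i) * (vec_nth y i * vec_nth y (s i))) \<bullet> snd b)"
    by (simp add: sum_distrib_right sum.distrib)
  also have "\<dots> = y \<bullet> gram_op a d s b y"
    unfolding inner_cvec
    by (intro sum.cong refl)
       (simp add: gram_op_def inner_complex_def cmod_sq algebra_simps)
  finally show ?thesis .
qed

lemma norm_sq_cvec: "(norm (x::complex^'k::finite))\<^sup>2 = (\<Sum>i\<in>UNIV. (cmod (vec_nth x i))\<^sup>2)"
  unfolding power2_norm_eq_inner[of x] inner_cvec by (simp add: cmod_sq)

text \<open>\<open>a\<close> changes sign under \<open>s\<close>, so the mixed terms cancel in pairs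
  and a Clifford relation remains. It yields \<open>prod_closed\<close> with
  \<open>l = 0\<close>.\<close>

lemma gram_op_inner_alternating:
  assumes s: "\<And>i. s (s i) = i" and a: "\<And>i. a i = 1 \<or> a i = -1" "\<And>i. a (s i) = - a i"
  shows "gram_op a (\<lambda>_. 1) s b y \<bullet> gram_op a (\<lambda>_. 1) s c y = (b \<bullet> c) * (y \<bullet> y)"
proof -
  define N where "N = (\<lambda>i. (cmod (vec_nth y i))\<^sup>2)"
  define C where "C = (\<lambda>i. Re ((fst b * snd c + fst c * snd b) * cnj (vec_nth y i * vec_nth y (s i))))"
  have NN: "(\<Sum>i\<in>UNIV. N i) = y \<bullet> y"
    using norm_sq_cvec[of y] power2_norm_eq_inner[of y] by (simp only: N_def)
  have aa: "a i * a i = 1" for i using a(1)[of i] by auto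
  have "gram_op a (\<lambda>_. 1) s b y \<bullet> gram_op a (\<lambda>_. 1) s c y
     = (\<Sum>i\<in>UNIV. fst b * fst c * (a i * a i) * N i + (snd b \<bullet> snd c) * N (s i) + a i * C i)"
    unfolding inner_cvec
    by (intro sum.cong refl)
       (simp add: gram_op_def inner_complex_def cmod_sq algebra_simps N_def C_def)
  also have "\<dots> = (\<Sum>i\<in>UNIV. fst b * fst c * N i) + (\<Sum>i\<in>UNIV. (snd b \<bullet> snd c) * N (s i)) + (\<Sum>i\<in>UNIV. a i * C i)"
    by (simp only: aa sum.distrib mult_1_right)
  also have "(\<Sum>i\<in>UNIV. (snd b \<bullet> snd c) * N (s i)) = (\<Sum>i\<in>UNIV. (snd b \<bullet> snd c) * N i)"
    by (rule sum.reindex_bij_witness[of _ s s]) (auto simp: s)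
  also have "(\<Sum>i\<in>UNIV. a i * C i) = 0"
  proof -
    have "(\<Sum>i\<in>UNIV. a i * C i) = (\<Sum>i\<in>UNIV. a (s i) * C (s i))"
      by (rule sum.reindex_bij_witness[of _ s s]) (auto simp: s)
    moreover have "C (s i) = C i" for i
      unfolding C_def s by (simp only: mult.commute[of "vec_nth y (s i)"])
    then have "(\<Sum>i\<in>UNIV. a (s i) * C (s i)) = - (\<Sum>i\<in>UNIV. a i * C i)"
      by (simp add: a(2) sum_negf)
    ultimately show ?thesis by simp
  qed
  finally show ?thesis
    unfolding sum_distrib_left[symmetric] NN by (simp add: inner_prod_def algebra_simps)
qed

text \<open>\<open>d\<close> takes the values 0 and 1 and is idempotent, so the products are again
  given by the same forms. It yields \<open>prod_closed\<close> with \<open>l0 = 0\<close>.\<close>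

lemma gram_op_inner_projection:
  assumes d: "\<And>i. d i = 0 \<or> d i = (1::real)"
  shows "gram_op d d (\<lambda>i. i) b y \<bullet> gram_op d d (\<lambda>i. i) c y
     = (b \<bullet> c, fst b *\<^sub>R snd c + fst c *\<^sub>R snd b) \<bullet> gram_map d d (\<lambda>i. i) y"
proof -
  have "gram_op d d (\<lambda>i. i) b y \<bullet> gram_op d d (\<lambda>i. i) c y
     = (\<Sum>i\<in>UNIV. (b \<bullet> c) * (d i * (cmod (vec_nth y i))\<^sup>2)
        + (fst b *\<^sub>R snd c + fst c *\<^sub>R snd b) \<bullet> (of_real (d i) * (vec_nth y i * vec_nth y i)))"
    unfolding inner_cvec
  proof (intro sum.cong refl)
    fix i
    show "Re (cnj (vec_nth (gram_op d d (\<lambda>i. i) b y) i) * vec_nth (gram_op d d (\<lambda>i. i) c y) i)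
      = (b \<bullet> c) * (d i * (cmod (vec_nth y i))\<^sup>2)
        + (fst b *\<^sub>R snd c + fst c *\<^sub>R snd b) \<bullet> (of_real (d i) * (vec_nth y i * vec_nth y i))"
      using d[of i]
      by (elim disjE) (simp_all add: gram_op_def inner_complex_def inner_prod_def cmod_sq algebra_simps)
  qed
  also have "\<dots> = (b \<bullet> c, fst b *\<^sub>R snd c + fst c *\<^sub>R snd b) \<bullet> gram_map d d (\<lambda>i. i) y"
    unfolding gram_map_def by (simp add: sum.distrib sum_distrib_left inner_sum_right)
  finally show ?thesis .
qed

section \<open>The invariants in coordinates and the interior of their images\<close>

locale coordinates =
  fixes e :: "'k::finite \<Rightarrow> nat" and n :: nat
  assumes bij: "bij_betw e UNIV {..<2*n}"
begin

definition co :: "complex^'k \<Rightarrow> nat \<Rightarrow> complex" where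
  "co x l = vec_nth x (inv_into UNIV e l)"

definition of_co :: "(nat \<Rightarrow> complex) \<Rightarrow> complex^'k" where
  "of_co f = (\<chi> i. f (e i))"

lemma inv_e: "inv_into UNIV e (e i) = i" and e_inv: "l < 2*n \<Longrightarrow> e (inv_into UNIV e l) = l" and e_less: "e i < 2*n"
  using bij by (auto simp: bij_betw_def inv_f_f intro!: f_inv_into_f)

lemma co_e: "co x (e i) = vec_nth x i"
  by (simp add: co_def inv_e)

lemma co_of_co: "l < 2*n \<Longrightarrow> co (of_co f) l = f l"
  by (simp add: co_def of_co_def e_inv)

lemma co_ext: "(\<And>l. l < 2*n \<Longrightarrow> co x l = co y l) \<Longrightarrow> x = y"
  unfolding Finite_Cartesian_Product.vec_eq_iff by (metis co_e e_less)

lemma sum_e: "(\<Sum>i\<in>UNIV. f (e i)) = (\<Sum>l<2*n. f l)"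
  using sum.reindex_bij_betw[OF bij, of f] .

lemma norm_sq_co: "(norm x)\<^sup>2 = (\<Sum>l<2*n. (cmod (co x l))\<^sup>2)"
  using sum_e[of "\<lambda>l. (cmod (co x l))\<^sup>2"] by (simp add: norm_sq_cvec co_e)

lemma inner_co: "x \<bullet> y = Re (\<Sum>l<2*n. cnj (co x l) * co y l)"
  using sum_e[of "\<lambda>l. Re (cnj (co x l) * co y l)"] by (simp add: inner_cvec co_e)

lemma co_mat_act:
  assumes "l < 2*n"
  shows "co (mat_act e M x) l = (\<Sum>j<2*n. M l j * co x j)"
proof -
  have "co (mat_act e M x) l = (\<Sum>i\<in>UNIV. M l (e i) * co x (e i))"
    unfolding co_e by (simp add: co_def mat_act_def e_inv[OF assms])
  then show ?thesis using sum_e[of "\<lambda>j. M l j * co x j"] by simp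
qed

lemma co_block_act:
  assumes ab: "a + b = 2*n"
  shows "i < a \<Longrightarrow> co (mat_act e (block_diag a b A B) x) i = mat_vec a A (co x) i"
    and "i < b \<Longrightarrow> co (mat_act e (block_diag a b A B) x) (a + i) = mat_vec b B (\<lambda>l. co x (a + l)) i"
  using ab by (auto simp: co_mat_act mat_vec_def block_diag_def ab[symmetric] sum_lessThan_split intro!: sum.cong)

definition p1 :: "complex^'k \<Rightarrow> real \<times> complex" where
  "p1 = gram_map (\<lambda>i. if e i < n then 1 else -1) (\<lambda>_. 1) (\<lambda>i. inv_into UNIV e (if e i < n then n + e i else e i - n))"

definition Q1 :: "real \<times> complex \<Rightarrow> complex^'k \<Rightarrow> complex^'k" where
  "Q1 = gram_op (\<lambda>i. if e i < n then 1 else -1) (\<lambda>_. 1) (\<lambda>i. inv_into UNIV e (if e i < n then n + e i else e i - n))"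

definition p2 :: "nat \<Rightarrow> complex^'k \<Rightarrow> real \<times> complex" where
  "p2 a = gram_map (\<lambda>i. if e i < a then 0 else 1) (\<lambda>i. if e i < a then 0 else 1) (\<lambda>i. i)"

definition Q2 :: "nat \<Rightarrow> real \<times> complex \<Rightarrow> complex^'k \<Rightarrow> complex^'k" where
  "Q2 a = gram_op (\<lambda>i. if e i < a then 0 else 1) (\<lambda>i. if e i < a then 0 else 1) (\<lambda>i. i)"

text \<open>The swap of the halves meets each product of paired entries twice, whence the factor
  2.\<close>

lemma p1_co: "p1 x = ((\<Sum>l<n. (cmod (co x l))\<^sup>2) - (\<Sum>l<n. (cmod (co x (n + l)))\<^sup>2),
    2 * (\<Sum>l<n. co x l * co x (n + l)))"
proof -
  have "fst (p1 x) = (\<Sum>l<2*n. (if l < n then 1 else -1) * (cmod (co x l))\<^sup>2)"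
    using sum_e[of "\<lambda>l. (if l < n then 1 else -1) * (cmod (co x l))\<^sup>2"]
    by (simp add: p1_def gram_map_def co_e)
  also have "\<dots> = (\<Sum>l<n. (cmod (co x l))\<^sup>2) - (\<Sum>l<n. (cmod (co x (n + l)))\<^sup>2)"
    unfolding mult_2 sum_lessThan_split by (simp add: sum_negf)
  finally have 1: "fst (p1 x) = (\<Sum>l<n. (cmod (co x l))\<^sup>2) - (\<Sum>l<n. (cmod (co x (n + l)))\<^sup>2)" .
  have "snd (p1 x) = (\<Sum>l<2*n. co x l * co x (if l < n then n + l else l - n))"
    using sum_e[of "\<lambda>l. co x l * co x (if l < n then n + l else l - n)"]
    by (simp add: p1_def gram_map_def co_def inv_e)
  also have "\<dots> = (\<Sum>l<n. co x l * co x (n + l)) + (\<Sum>l<n. co x (n + l) * co x l)"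
    unfolding mult_2 sum_lessThan_split by simp
  also have "\<dots> = 2 * (\<Sum>l<n. co x l * co x (n + l))"
    by (simp add: mult.commute)
  finally have 2: "snd (p1 x) = 2 * (\<Sum>l<n. co x l * co x (n + l))" .
  from 1 2 show ?thesis by (simp add: prod_eq_iff)
qed

lemma p2_co:
  assumes "a + b = 2*n"
  shows "p2 a x = ((\<Sum>l<b. (cmod (co x (a + l)))\<^sup>2), (\<Sum>l<b. (co x (a + l))\<^sup>2))"
proof -
  have "fst (p2 a x) = (\<Sum>l<2*n. (if l < a then 0 else 1) * (cmod (co x l))\<^sup>2)"
    using sum_e[of "\<lambda>l. (if l < a then 0 else 1) * (cmod (co x l))\<^sup>2"]
    by (simp add: p2_def gram_map_def co_e)
  moreover have "snd (p2 a x) = (\<Sum>l<2*n. (if l < a then 0 else 1) * (co x l)\<^sup>2)"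
    using sum_e[of "\<lambda>l. (if l < a then 0 else 1) * (co x l)\<^sup>2"]
    by (simp add: p2_def gram_map_def co_e power2_eq_square if_distrib cong: if_cong)
  ultimately show ?thesis
    unfolding assms[symmetric] sum_lessThan_split by (simp add: prod_eq_iff)
qed

lemma norm_sq_split:
  assumes "a + b = 2*n"
  shows "(norm x)\<^sup>2 = (\<Sum>l<a. (cmod (co x l))\<^sup>2) + (\<Sum>l<b. (cmod (co x (a + l)))\<^sup>2)"
  unfolding norm_sq_co assms[symmetric] sum_lessThan_split ..

lemma quadratic_invariants_p1:
  assumes "n \<ge> 2"
  shows "quadratic_invariants p1 Q1"
proof (rule quadratic_invariants.intro)
  let ?s = "\<lambda>i. inv_into UNIV e (if e i < n then n + e i else e i - n)"
  have es: "e (?s i) = (if e i < n then n + e i else e i - n)" for i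
    using e_less[of i] by (intro e_inv) auto
  have s: "?s (?s i) = i" for i
    unfolding es using e_less[of i] by (auto simp: inv_e)
  show "linear (Q1 b)" for b unfolding Q1_def by (rule linear_gram_op)
  show "Q1 b x \<bullet> y = x \<bullet> Q1 b y" for b x y
    unfolding Q1_def by (rule gram_op_self_adjoint[OF s]) simp
  show "p1 y \<bullet> b = y \<bullet> Q1 b y" for b y
    unfolding p1_def Q1_def by (rule gram_map_eq)
  have "Q1 b y \<bullet> Q1 c y = (b \<bullet> c) * (y \<bullet> y)" for b c y
    unfolding Q1_def
  proof (rule gram_op_inner_alternating[OF s])
    show "(if e (?s i) < n then 1 else - 1) = - (if e i < n then 1 else - (1::real))" for i
      unfolding es using e_less[of i] by auto
  qed auto
  then show "\<exists>l0 l. \<forall>y. Q1 b y \<bullet> Q1 c y = l0 * (y \<bullet> y) + l \<bullet> p1 y" for b c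
    by (intro exI[of _ "b \<bullet> c"] exI[of _ 0]) simp
  \<comment> \<open>The radius 1/2 keeps \<open>1 + q\<close> positive and q^2 + |c|^2 below 1, so
    that \<open>t\<close> and \<open>g\<close> below are square roots and norms of real
    vectors.\<close>
  have "ball 0 (1/2) \<subseteq> p1 ` sphere 0 1"
  proof
    fix v :: "real \<times> complex" assume "v \<in> ball 0 (1/2)"
    obtain q c where v: "v = (q, c)" by fastforce
    have nv: "norm v < 1/2" using \<open>v \<in> ball 0 (1/2)\<close> by simp
    have qc: "q\<^sup>2 + (cmod c)\<^sup>2 < 1/4"
    proof -
      have "(norm v)\<^sup>2 < (1/2)\<^sup>2" using nv by (intro power_strict_mono) auto
      then show ?thesis by (simp add: v norm_Pair power2_eq_square)
    qed
    have q: "\<bar>q\<bar> < 1/2"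
    proof (rule power_less_imp_less_base)
      have "q\<^sup>2 < 1/4" using qc zero_le_power2[of "cmod c"] by linarith
      then show "\<bar>q\<bar>\<^sup>2 < (1/2)\<^sup>2" by (simp add: power_divide)
    qed simp
    \<comment> \<open>Norm 1 and difference \<open>q\<close> force the squared norms (1 + q)/2 and
      (1 - q)/2 of the halves. \<open>\<beta>\<close> solves \<open>2 * t * \<beta> = c\<close>, and
      \<open>g\<close> is the squared norm left for one more entry of the second half.\<close>
    define t where "t = sqrt ((1 + q) / 2)"
    have t: "t > 0" "t\<^sup>2 = (1 + q) / 2" using q by (auto simp: t_def)
    define \<beta> where "\<beta> = c / of_real (2 * t)"
    have b: "(cmod \<beta>)\<^sup>2 = (cmod c)\<^sup>2 / (2 * (1 + q))"
      using t by (simp add: \<beta>_def norm_divide power_divide power_mult_distrib)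
    define g where "g = (1 - q) / 2 - (cmod \<beta>)\<^sup>2"
    have "g = (1 - q\<^sup>2 - (cmod c)\<^sup>2) / (2 * (1 + q))"
      unfolding g_def b using q by (simp add: field_simps power2_eq_square)
    then have g: "g \<ge> 0" using q qc by simp
    define f where "f l = (if l = 0 then of_real t else if l = n then \<beta> else if l = n + 1 then of_real (sqrt g) else 0)" for l
    define x where "x = of_co f"
    have lo: "co x l = (if l = 0 then of_real t else 0)" if "l < n" for l
      using that by (simp add: x_def co_of_co f_def)
    have hi: "co x (n + l) = (if l = 0 then \<beta> else if l = 1 then of_real (sqrt g) else 0)" if "l < n" for l
      using that by (simp add: x_def co_of_co f_def)
    have hi01: "co x n = \<beta>" "co x (Suc n) = of_real (sqrt g)" using hi[of 0] hi[of 1] assms by auto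
    note sum01 = sum_lessThan_pair[OF assms]
    have S1: "(\<Sum>l<n. (cmod (co x l))\<^sup>2) = t\<^sup>2"
      using assms by (subst sum01) (auto simp: lo)
    have S2: "(\<Sum>l<n. (cmod (co x (n + l)))\<^sup>2) = (cmod \<beta>)\<^sup>2 + g"
      using assms g by (subst sum01) (auto simp: hi hi01)
    have S3: "(\<Sum>l<n. co x l * co x (n + l)) = of_real t * \<beta>"
      using assms by (subst sum01) (auto simp: lo hi hi01)
    have "(norm x)\<^sup>2 = 1"
      unfolding norm_sq_split[OF mult_2[symmetric]] S1 S2 t(2) g_def by (simp add: field_simps)
    then have "x \<in> sphere 0 1" using norm_ge_zero[of x] by (simp add: power2_eq_1_iff)
    moreover have "p1 x = v"
      unfolding p1_co S1 S2 S3 v t(2) g_def using t(1) by (simp add: \<beta>_def field_simps)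
    ultimately show "v \<in> p1 ` sphere 0 1" by blast
  qed
  then show "\<exists>U. open U \<and> U \<noteq> {} \<and> U \<subseteq> p1 ` sphere 0 1"
    by (intro exI[of _ "ball 0 (1/2)"]) auto
qed

lemma quadratic_invariants_p2:
  assumes ab: "a + b = 2*n" and "a \<ge> 1" "b \<ge> 2"
  shows "quadratic_invariants (p2 a) (Q2 a)"
proof (rule quadratic_invariants.intro)
  show "linear (Q2 a b)" for b unfolding Q2_def by (rule linear_gram_op)
  show "Q2 a b x \<bullet> y = x \<bullet> Q2 a b y" for b x y
    unfolding Q2_def by (rule gram_op_self_adjoint) auto
  show "p2 a y \<bullet> b = y \<bullet> Q2 a b y" for b y
    unfolding p2_def Q2_def by (rule gram_map_eq)
  have "Q2 a b y \<bullet> Q2 a c y = (b \<bullet> c, fst b *\<^sub>R snd c + fst c *\<^sub>R snd b) \<bullet> p2 a y" for b c y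
    unfolding Q2_def p2_def by (rule gram_op_inner_projection) auto
  then show "\<exists>l0 l. \<forall>y. Q2 a b y \<bullet> Q2 a c y = l0 * (y \<bullet> y) + l \<bullet> p2 a y" for b c
    by (intro exI[of _ 0] exI[of _ "(b \<bullet> c, fst b *\<^sub>R snd c + fst c *\<^sub>R snd b)"]) simp
  \<comment> \<open>A vector with |z|^2 = q has a sum of squares of modulus at most
    \<open>q\<close>. The strict inequalities make the set open, and \<open>c \<noteq> 0\<close>
    permits the quotient \<open>q / cmod c\<close>.\<close>
  define U :: "(real \<times> complex) set" where "U = {v. cmod (snd v) < fst v} \<inter> {v. fst v < 1} \<inter> {v. snd v \<noteq> 0}"
  have "open U" unfolding U_def
    by (intro open_Int open_Collect_less open_Collect_neq continuous_intros)
  moreover have "(1/2, 1/4) \<in> U" by (simp add: U_def)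
  moreover have "U \<subseteq> p2 a ` sphere 0 1"
  proof
    fix v assume "v \<in> U"
    obtain q c where v: "v = (q, c)" by fastforce
    have qc: "cmod c < q" "q < 1" "c \<noteq> 0" using \<open>v \<in> U\<close> by (auto simp: U_def v)
    define r where "r = q / cmod c"
    have r: "r > 1" "cmod c * r = q" using qc by (auto simp: r_def field_simps)
    \<comment> \<open>The squares of \<open>z1\<close> and \<open>z2\<close> are c(r + 1)/2 and -c(r
      - 1)/2 with sum \<open>c\<close>; their moduli add up to |c| r = q.\<close>
    define z1 where "z1 = csqrt c * of_real (sqrt ((r + 1) / 2))"
    define z2 where "z2 = \<i> * csqrt c * of_real (sqrt ((r - 1) / 2))"
    have nc: "(cmod (csqrt c))\<^sup>2 = cmod c" by (simp flip: norm_power)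
    have n1: "(cmod z1)\<^sup>2 = cmod c * ((r + 1) / 2)" and n2: "(cmod z2)\<^sup>2 = cmod c * ((r - 1) / 2)"
      using r by (simp_all add: z1_def z2_def norm_mult power_mult_distrib nc)
    have s1: "z1\<^sup>2 = c * of_real ((r + 1) / 2)" and s2: "z2\<^sup>2 = - c * of_real ((r - 1) / 2)"
      using r by (simp_all add: z1_def z2_def power_mult_distrib flip: of_real_power)
    define f where "f l = (if l = 0 then of_real (sqrt (1 - q)) else if l = a then z1 else if l = a + 1 then z2 else 0)" for l
    define x where "x = of_co f"
    have lo: "co x l = (if l = 0 then of_real (sqrt (1 - q)) else 0)" if "l < a" for l
      using that ab by (simp add: x_def co_of_co f_def)
    have hi: "co x (a + l) = (if l = 0 then z1 else if l = 1 then z2 else 0)" if "l < b" for l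
      using that ab assms by (simp add: x_def co_of_co f_def)
    have hi01: "co x a = z1" "co x (Suc a) = z2" using hi[of 0] hi[of 1] assms by auto
    note sum0 = sum_lessThan_single[of 0 a]
    note sum01 = sum_lessThan_pair[OF assms(3)]
    have S0: "(\<Sum>l<a. (cmod (co x l))\<^sup>2) = 1 - q"
      using assms qc by (subst sum0) (auto simp: lo)
    have S1: "(\<Sum>l<b. (cmod (co x (a + l)))\<^sup>2) = q"
    proof -
      have "(\<Sum>l<b. (cmod (co x (a + l)))\<^sup>2) = (cmod z1)\<^sup>2 + (cmod z2)\<^sup>2"
        using assms by (subst sum01) (auto simp: hi hi01)
      also have "\<dots> = cmod c * r" unfolding n1 n2 by (simp add: field_simps)
      finally show ?thesis using r by simp
    qed
    have S2: "(\<Sum>l<b. (co x (a + l))\<^sup>2) = c"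
    proof -
      have "(\<Sum>l<b. (co x (a + l))\<^sup>2) = z1\<^sup>2 + z2\<^sup>2"
        using assms by (subst sum01) (auto simp: hi hi01)
      also have "\<dots> = c" unfolding s1 s2 by (simp add: field_simps)
      finally show ?thesis .
    qed
    have "(norm x)\<^sup>2 = 1" unfolding norm_sq_split[OF ab] S0 S1 by simp
    then have "x \<in> sphere 0 1" using norm_ge_zero[of x] by (simp add: power2_eq_1_iff)
    moreover have "p2 a x = v" unfolding p2_co[OF ab] S1 S2 v ..
    ultimately show "v \<in> p2 a ` sphere 0 1" by blast
  qed
  ultimately show "\<exists>U. open U \<and> U \<noteq> {} \<and> U \<subseteq> p2 a ` sphere 0 1" by blast
qed

end

section \<open>Orbits as fibres, and the two conclusions\<close>

context coordinates
begin

lemma sq_sum_eq_hip: "(\<Sum>l<k. (cmod (f l))\<^sup>2) = Re (hip k f f)"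
  unfolding hip_self by simp

lemma hip_self_eq_iff: "hip k f f = hip k g g \<longleftrightarrow> (\<Sum>l<k. (cmod (f l))\<^sup>2) = (\<Sum>l<k. (cmod (g l))\<^sup>2)"
  unfolding hip_self of_real_eq_iff ..

lemma norm_one_iff: "norm (x::complex^'k) = 1 \<longleftrightarrow> (norm x)\<^sup>2 = 1"
  unfolding power2_eq_1_iff by (smt (verit) norm_ge_zero)

text \<open>Conjugation turns the action of the conjugate of \<open>A\<close> on the second half
  into that of \<open>A\<close>, so \<open>co x\<close> and \<open>lower x\<close> are moved by the
  same unitary matrix.\<close>

definition lower :: "complex^'k \<Rightarrow> nat \<Rightarrow> complex" where
  "lower x l = cnj (co x (n + l))"

lemma p1_norm_hip:
  "(norm x)\<^sup>2 = Re (hip n (co x) (co x)) + Re (hip n (lower x) (lower x))"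
  "p1 x = (Re (hip n (co x) (co x)) - Re (hip n (lower x) (lower x)), 2 * hip n (lower x) (co x))"
proof -
  have "(\<Sum>l<n. (cmod (co x (n + l)))\<^sup>2) = Re (hip n (lower x) (lower x))"
    unfolding sq_sum_eq_hip[symmetric] lower_def by simp
  moreover have "(\<Sum>l<n. co x l * co x (n + l)) = hip n (lower x) (co x)"
    unfolding hip_def lower_def by (simp add: mult.commute)
  ultimately show "(norm x)\<^sup>2 = Re (hip n (co x) (co x)) + Re (hip n (lower x) (lower x))"
    "p1 x = (Re (hip n (co x) (co x)) - Re (hip n (lower x) (lower x)), 2 * hip n (lower x) (co x))"
    unfolding p1_co norm_sq_split[OF mult_2[symmetric]] sq_sum_eq_hip[where f = "co x"] by simp_all
qed

lemma cnj_mat_vec_conj: "cnj (mat_vec k (cmat_conj A) f i) = mat_vec k A (\<lambda>l. cnj (f l)) i"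
  unfolding mat_vec_def cmat_conj_def by simp

text \<open>A unitary orbit of pairs of vectors is determined by the Gram matrix. The norm and the
  first component of \<open>p1\<close> give its diagonal, the second component the mixed
  product.\<close>

lemma orbit_H1:
  assumes "norm x = 1"
  shows "orbit e (H1_image n) x = {y. norm y = 1 \<and> p1 y = p1 x}"
proof (rule equalityI; rule subsetI)
  fix y assume "y \<in> orbit e (H1_image n) x"
  then obtain A where A: "A \<in> unitary_group n" and y: "y = mat_act e (block_diag n n A (cmat_conj A)) x"
    unfolding orbit_def H1_image_def by blast
  have nn: "n + n = 2 * n" by simp
  have c: "co y i = mat_vec n A (co x) i" "lower y i = mat_vec n A (lower x) i" if "i < n" for i
    unfolding y lower_def[of "mat_act e (block_diag n n A (cmat_conj A)) x"]
      co_block_act(1)[OF nn that] co_block_act(2)[OF nn that] cnj_mat_vec_conj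
    by (simp_all add: lower_def[abs_def])
  have "hip n (co y) (co y) = hip n (co x) (co x)" "hip n (lower y) (lower y) = hip n (lower x) (lower x)"
    "hip n (lower y) (co y) = hip n (lower x) (co x)"
    using hip_cong[of n "co y" "mat_vec n A (co x)" "co y" "mat_vec n A (co x)"]
      hip_cong[of n "lower y" "mat_vec n A (lower x)" "lower y" "mat_vec n A (lower x)"]
      hip_cong[of n "lower y" "mat_vec n A (lower x)" "co y" "mat_vec n A (co x)"] c
    by (simp_all add: hip_mat_vec[OF A])
  then show "y \<in> {y. norm y = 1 \<and> p1 y = p1 x}"
    using assms unfolding norm_one_iff mem_Collect_eq p1_norm_hip by simp
next
  fix y assume "y \<in> {y. norm y = 1 \<and> p1 y = p1 x}"
  then have y: "(norm y)\<^sup>2 = (norm x)\<^sup>2" "p1 y = p1 x" using assms by auto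
  then have "hip n (lower x) (co x) = hip n (lower y) (co y)"
    "Re (hip n (co x) (co x)) = Re (hip n (co y) (co y))" "Re (hip n (lower x) (lower x)) = Re (hip n (lower y) (lower y))"
    unfolding p1_norm_hip by auto
  then have "hip n (co x) (co x) = hip n (co y) (co y)" "hip n (lower x) (lower x) = hip n (lower y) (lower y)"
    "hip n (lower x) (co x) = hip n (lower y) (co y)"
    unfolding hip_self_eq_iff sq_sum_eq_hip by auto
  from unitary_pair_transitive[OF this] obtain A where A: "A \<in> unitary_group n"
    "\<And>i. i < n \<Longrightarrow> mat_vec n A (co x) i = co y i" "\<And>i. i < n \<Longrightarrow> mat_vec n A (lower x) i = lower y i"
    by blast
  have nn: "n + n = 2 * n" by simp
  let ?z = "mat_act e (block_diag n n A (cmat_conj A)) x"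
  have "co ?z (n + i) = co y (n + i)" if "i < n" for i
  proof -
    have "cnj (co ?z (n + i)) = mat_vec n A (lower x) i"
      unfolding co_block_act(2)[OF nn that] cnj_mat_vec_conj lower_def[abs_def] ..
    then show ?thesis using A(3)[OF that] unfolding lower_def by simp
  qed
  moreover have "co ?z i = co y i" if "i < n" for i
    unfolding co_block_act(1)[OF nn that] by (rule A(2)[OF that])
  ultimately have "co ?z l = co y l" if "l < 2*n" for l
    using that by (cases "l < n") (auto dest!: le_Suc_ex simp: not_less)
  then have "?z = y" by (rule co_ext)
  then show "y \<in> orbit e (H1_image n) x"
    unfolding orbit_def H1_image_def using A(1) by blast
qed

text \<open>The blocks move independently: the symplectic factor is transitive on spheres, the
  orbits of the orthogonal factor are read off from \<open>p2\<close>, and the norm of the first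
  block follows from \<open>norm x = 1\<close>.\<close>

lemma orbit_H2:
  assumes "norm x = 1" and mk: "2*m + k = 2*n" "k \<ge> 3"
  shows "orbit e (H2_image n m) x = {y. norm y = 1 \<and> p2 (2*m) y = p2 (2*m) x}"
proof -
  define up where "up x l = co x (2*m + l)" for x l
  have k: "2*n - 2*m = k" using mk by simp
  have nrm: "(norm x)\<^sup>2 = Re (hip (2*m) (co x) (co x)) + Re (hip k (up x) (up x))" for x
    unfolding norm_sq_split[OF mk(1)] sq_sum_eq_hip[symmetric] up_def ..
  have p2: "p2 (2*m) x = (Re (hip k (up x) (up x)), \<Sum>l<k. (up x l)\<^sup>2)" for x
    unfolding p2_co[OF mk(1)] sq_sum_eq_hip[symmetric] up_def ..
  show ?thesis
  proof (rule equalityI; rule subsetI)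
    fix y assume "y \<in> orbit e (H2_image n m) x"
    then obtain B C where B: "B \<in> compact_symplectic_group m" and C: "C \<in> special_orthogonal_group k"
      and y: "y = mat_act e (block_diag (2*m) k B C) x"
      unfolding orbit_def H2_image_def k by auto
    have BU: "B \<in> unitary_group (2*m)" using B by (simp add: compact_symplectic_group_def)
    have CU: "C \<in> unitary_group k" and Cr: "\<And>i j. C i j \<in> \<real>" using C by (auto simp: special_orthogonal_group_def)
    have c: "i < 2*m \<Longrightarrow> co y i = mat_vec (2*m) B (co x) i" "i < k \<Longrightarrow> up y i = mat_vec k C (up x) i" for i
      unfolding y up_def using co_block_act[OF mk(1)] by auto
    have 1: "hip (2*m) (co y) (co y) = hip (2*m) (co x) (co x)"
      using hip_cong[of "2*m" "co y" "mat_vec (2*m) B (co x)" "co y" "mat_vec (2*m) B (co x)"] c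
      by (simp add: hip_mat_vec[OF BU])
    have 2: "hip k (up y) (up y) = hip k (up x) (up x)"
      using hip_cong[of k "up y" "mat_vec k C (up x)" "up y" "mat_vec k C (up x)"] c
      by (simp add: hip_mat_vec[OF CU])
    \<comment> \<open>\<open>C\<close> is real and commutes with conjugation, so the sum of squares,
      being the Hermitian product of the conjugate vector with the vector, is preserved.\<close>
    have "cnj (C i j) = C i j" for i j using Cr Reals_cnj_iff by blast
    then have "cnj (up y i) = mat_vec k C (\<lambda>l. cnj (up x l)) i" if "i < k" for i
      unfolding c(2)[OF that] mat_vec_def by simp
    then have "hip k (\<lambda>l. cnj (up y l)) (up y) = hip k (\<lambda>l. cnj (up x l)) (up x)"
      using hip_cong[of k "\<lambda>l. cnj (up y l)" "mat_vec k C (\<lambda>l. cnj (up x l))" "up y" "mat_vec k C (up x)"] c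
      by (simp add: hip_mat_vec[OF CU])
    then have "(\<Sum>l<k. (up y l)\<^sup>2) = (\<Sum>l<k. (up x l)\<^sup>2)"
      unfolding hip_def by (simp add: power2_eq_square)
    then show "y \<in> {y. norm y = 1 \<and> p2 (2*m) y = p2 (2*m) x}"
      using assms(1) 1 2 unfolding norm_one_iff mem_Collect_eq nrm p2 by simp
  next
    fix y assume "y \<in> {y. norm y = 1 \<and> p2 (2*m) y = p2 (2*m) x}"
    then have y: "(norm y)\<^sup>2 = (norm x)\<^sup>2" "p2 (2*m) y = p2 (2*m) x" using assms by auto
    then have "Re (hip (2*m) (co x) (co x)) = Re (hip (2*m) (co y) (co y))" "Re (hip k (up x) (up x)) = Re (hip k (up y) (up y))"
      and sq: "(\<Sum>l<k. (up x l)\<^sup>2) = (\<Sum>l<k. (up y l)\<^sup>2)"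
      unfolding nrm p2 by auto
    then have h: "hip (2*m) (co x) (co x) = hip (2*m) (co y) (co y)" "hip k (up x) (up x) = hip k (up y) (up y)"
      unfolding hip_self_eq_iff sq_sum_eq_hip by auto
    obtain B where B: "B \<in> compact_symplectic_group m" "\<And>i. i < 2*m \<Longrightarrow> mat_vec (2*m) B (co x) i = co y i"
      using symplectic_transitive[OF h(1)] by blast
    obtain C where C: "C \<in> special_orthogonal_group k" "\<And>i. i < k \<Longrightarrow> mat_vec k C (up x) i = up y i"
      using special_orthogonal_transitive[OF mk(2) h(2) sq] by blast
    let ?z = "mat_act e (block_diag (2*m) k B C) x"
    have "co ?z i = co y i" if "i < 2*m" for i
      unfolding co_block_act(1)[OF mk(1) that] by (rule B(2)[OF that])
    moreover have "co ?z (2*m + i) = co y (2*m + i)" if "i < k" for i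
      using C(2)[OF that] unfolding co_block_act(2)[OF mk(1) that] up_def .
    ultimately have "co ?z l = co y l" if "l < 2*n" for l
      using that mk(1) by (cases "l < 2*m") (auto dest!: le_Suc_ex simp: not_less)
    then have "?z = y" by (rule co_ext)
    then show "y \<in> orbit e (H2_image n m) x"
      unfolding orbit_def H2_image_def k using B(1) C(1) by force
  qed
qed

lemma inv_eigenspace_eq_fibre_eigenspace:
  assumes orb: "\<And>x. norm x = 1 \<Longrightarrow> orbit e H x = {y. norm y = 1 \<and> p y = p x}"
  shows "inv_eigenspace e H lam = fibre_eigenspace p lam"
proof -
  have "invariant_fun e H f \<longleftrightarrow> (\<forall>x y. norm x = 1 \<longrightarrow> norm y = 1 \<longrightarrow> p x = p y \<longrightarrow> f x = f y)" for f
  proof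
    assume inv: "invariant_fun e H f"
    show "\<forall>x y. norm x = 1 \<longrightarrow> norm y = 1 \<longrightarrow> p x = p y \<longrightarrow> f x = f y"
    proof (intro allI impI)
      fix x y :: "complex^'k" assume xy: "norm x = 1" "norm y = 1" "p x = p y"
      then have "y \<in> orbit e H x" unfolding orb[OF xy(1)] by simp
      then obtain h where "h \<in> H" "y = mat_act e h x" unfolding orbit_def by blast
      then show "f x = f y" using inv xy(1) unfolding invariant_fun_def unit_sphere_def by simp
    qed
  next
    assume fib: "\<forall>x y. norm x = 1 \<longrightarrow> norm y = 1 \<longrightarrow> p x = p y \<longrightarrow> f x = f y"
    show "invariant_fun e H f"
      unfolding invariant_fun_def unit_sphere_def
    proof (intro ballI, unfold mem_Collect_eq)
      fix h and x :: "complex^'k" assume h: "h \<in> H" "norm x = 1"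
      then have "mat_act e h x \<in> orbit e H x" unfolding orbit_def by blast
      then have "norm (mat_act e h x) = 1" "p (mat_act e h x) = p x" unfolding orb[OF h(2)] by auto
      then show "f (mat_act e h x) = f x" using fib h(2) by blast
    qed
  qed
  then show ?thesis
    unfolding inv_eigenspace_def fibre_eigenspace_def unit_sphere_def by simp
qed

lemma isospectral:
  assumes "2*m + k = 2*n" "k \<ge> 3" "m \<ge> 1" "n \<ge> 2"
  shows "isospectral_orbit_spaces e (H1_image n) (H2_image n m)"
proof -
  have q1: "quadratic_invariants p1 Q1" by (rule quadratic_invariants_p1[OF assms(4)])
  have q2: "quadratic_invariants (p2 (2*m)) (Q2 (2*m))"
    by (rule quadratic_invariants_p2[OF assms(1)]) (use assms in auto)
  have "inv_eigenspace e (H1_image n) lam = fibre_eigenspace p1 lam" for lam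
    by (rule inv_eigenspace_eq_fibre_eigenspace[OF orbit_H1])
  moreover have "inv_eigenspace e (H2_image n m) lam = fibre_eigenspace (p2 (2*m)) lam" for lam
    by (rule inv_eigenspace_eq_fibre_eigenspace[OF orbit_H2[OF _ assms(1,2)]])
  ultimately show ?thesis
    unfolding isospectral_orbit_spaces_def inv_multiplicity_def
    using fun_dim_fibre_eigenspace_le[OF q1 q2] fun_dim_fibre_eigenspace_le[OF q2 q1]
    by (simp add: antisym)
qed

text \<open>Test with a transposition matrix whose entries carry the phases of \<open>M\<close>.\<close>

lemma zero_of_unitary_pairing_nonpos:
  fixes M :: "nat \<Rightarrow> nat \<Rightarrow> complex"
  assumes "\<And>A. A \<in> unitary_group k \<Longrightarrow> Re (\<Sum>i<k. \<Sum>j<k. A i j * M i j) \<le> 0" and ij: "i0 < k" "j0 < k"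
  shows "M i0 j0 = 0"
proof -
  \<comment> \<open>\<open>t i0 = j0\<close>, so the tested matrix selects the entry in question;
    the phases make all selected entries contribute their moduli, so a non-positive total kills each
    of them.\<close>
  define t where "t = Transposition.transpose i0 j0"
  have tk: "t i < k \<longleftrightarrow> i < k" for i using ij by (auto simp: t_def Transposition.transpose_def)
  have tt: "t (t i) = i" for i by (simp add: t_def)
  define ph where "ph i = (if M i (t i) = 0 then 1 else cnj (M i (t i)) / of_real (cmod (M i (t i))))" for i
  have ph1: "cnj (ph i) * ph i = 1" for i
  proof -
    have "cmod (ph i) = 1" by (simp add: ph_def norm_divide)
    then show ?thesis using complex_norm_square[of "ph i"] by (simp add: mult.commute)
  qed
  have phM: "ph i * M i (t i) = of_real (cmod (M i (t i)))" for i
  proof (cases "M i (t i) = 0")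
    case False
    then have "ph i * M i (t i) = (M i (t i) * cnj (M i (t i))) / of_real (cmod (M i (t i)))"
      by (simp add: ph_def mult.commute)
    also have "\<dots> = of_real ((cmod (M i (t i)))\<^sup>2) / of_real (cmod (M i (t i)))"
      by (simp only: complex_norm_square)
    also have "\<dots> = of_real (cmod (M i (t i)))"
      by (simp only: of_real_divide[symmetric] power2_eq_square nonzero_mult_div_cancel_right norm_eq_zero False
          not_False_eq_True)
    finally show ?thesis .
  qed (simp add: ph_def)
  define A where "A = (\<lambda>i j. if i < k \<and> j = t i then ph i else 0)"
  have "A \<in> unitary_group k"
  proof (rule unitary_groupI)
    have "\<not> (i < k \<and> j = t i)" if "k \<le> i \<or> k \<le> j" for i j
      using that tk[of i] by linarith
    then show "is_cmat k A" unfolding is_cmat_def A_def by (metis (full_types))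
    fix i j assume "i < k" "j < k"
    have "(\<Sum>l<k. cnj (A l i) * A l j) = (\<Sum>l<k. if l = t i then (if i = j then 1 else 0) else 0)"
      by (intro sum.cong refl) (auto simp: A_def tt ph1)
    then show "(\<Sum>l<k. cnj (A l i) * A l j) = (if i = j then 1 else 0)"
      using tk \<open>i < k\<close> by simp
  qed
  from assms(1)[OF this] have "Re (\<Sum>i<k. \<Sum>j<k. A i j * M i j) \<le> 0" .
  also have "(\<Sum>i<k. \<Sum>j<k. A i j * M i j) = (\<Sum>i<k. of_real (cmod (M i (t i))))"
  proof (intro sum.cong refl)
    fix i assume "i \<in> {..<k}"
    then have "(\<Sum>j<k. A i j * M i j) = (\<Sum>j<k. if j = t i then ph i * M i (t i) else 0)"
      by (intro sum.cong) (auto simp: A_def)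
    then show "(\<Sum>j<k. A i j * M i j) = of_real (cmod (M i (t i)))"
      using tk \<open>i \<in> {..<k}\<close> phM by simp
  qed
  finally have "(\<Sum>i<k. cmod (M i (t i))) \<le> 0" by simp
  then have "cmod (M i0 (t i0)) = 0"
    using ij sum_nonneg_eq_0_iff[of "{..<k}" "\<lambda>i. cmod (M i (t i))"]
    by (simp add: antisym sum_nonneg)
  then show ?thesis by (simp add: t_def)
qed

lemma sphere_dist_nonneg: "norm (x::'b::real_inner) = 1 \<Longrightarrow> norm y = 1 \<Longrightarrow> 0 \<le> sphere_dist x y"
  unfolding sphere_dist_def using Cauchy_Schwarz_ineq2[of x y] by (intro arccos_lbound) auto

text \<open>The right-hand side does not involve \<open>y\<close>: in \<open>S\<^sup>4\<^sup>n\<^sup>-\<^sup>1/U(n)\<close> a point has at most one point at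
  distance \<open>\<pi>/2\<close>.\<close>

lemma p1_of_far_point:
  assumes x: "norm x = 1" and y: "norm y = 1"
    and dist: "orbit_dist (orbit e (H1_image n) x) (orbit e (H1_image n) y) = pi / 2"
    and j: "j < n" "co x j \<noteq> 0 \<or> co x (n + j) \<noteq> 0"
  shows "p1 y = (((cmod (co x (n + j)))\<^sup>2 - (cmod (co x j))\<^sup>2) / ((cmod (co x j))\<^sup>2 + (cmod (co x (n + j)))\<^sup>2),
      - 2 * (co x j * co x (n + j)) / of_real ((cmod (co x j))\<^sup>2 + (cmod (co x (n + j)))\<^sup>2))"
proof -
  let ?O = "orbit e (H1_image n)"
  \<comment> \<open>Distance pi/2 makes the inner product of \<open>y\<close> with every point of
    the orbit of \<open>x\<close> non-positive; as a function of \<open>A\<close> it is the real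
    part of a linear form.\<close>
  have "Re (\<Sum>i<n. \<Sum>l<n. A i l * (co x l * cnj (co y i) + cnj (co x (n + l)) * co y (n + i))) \<le> 0"
    if A: "A \<in> unitary_group n" for A
  proof -
    let ?z = "mat_act e (block_diag n n A (cmat_conj A)) x"
    have z: "?z \<in> ?O x" unfolding orbit_def H1_image_def using A by blast
    then have nz: "norm ?z = 1" unfolding orbit_H1[OF x] by simp
    have "y \<in> ?O y" unfolding orbit_H1[OF y] using y by simp
    let ?S = "{sphere_dist a b | a b. a \<in> ?O x \<and> b \<in> ?O y}"
    have bdd: "bdd_below ?S"
    proof (rule bdd_belowI[of _ 0])
      fix r assume "r \<in> ?S"
      then obtain a b where "r = sphere_dist a b" "a \<in> ?O x" "b \<in> ?O y" by blast
      then show "0 \<le> r" unfolding orbit_H1[OF x] orbit_H1[OF y] by (simp add: sphere_dist_nonneg)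
    qed
    have "sphere_dist ?z y \<in> ?S" using z \<open>y \<in> ?O y\<close> by blast
    from cInf_lower[OF this bdd] have "pi / 2 \<le> sphere_dist ?z y"
      unfolding dist[unfolded orbit_dist_def] .
    moreover have "\<bar>?z \<bullet> y\<bar> \<le> 1" using Cauchy_Schwarz_ineq2[of ?z y] nz y by simp
    ultimately have "?z \<bullet> y \<le> 0"
      using arccos_less_arccos[of 0 "?z \<bullet> y"] unfolding sphere_dist_def arccos_0 by linarith
    moreover have "?z \<bullet> y = Re (\<Sum>i<n. \<Sum>l<n. A i l * (co x l * cnj (co y i) + cnj (co x (n + l)) * co y (n + i)))"
    proof -
      have nn: "n + n = 2 * n" by simp
      have "?z \<bullet> y = (\<Sum>i<n. Re (cnj (co ?z i) * co y i)) + (\<Sum>i<n. Re (cnj (co ?z (n + i)) * co y (n + i)))"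
        unfolding inner_co nn[symmetric] sum_lessThan_split by simp
      also have "(\<Sum>i<n. Re (cnj (co ?z i) * co y i)) = (\<Sum>i<n. Re (mat_vec n A (co x) i * cnj (co y i)))"
        by (intro sum.cong refl) (simp add: co_block_act(1)[OF nn])
      also have "(\<Sum>i<n. Re (cnj (co ?z (n + i)) * co y (n + i)))
          = (\<Sum>i<n. Re (mat_vec n A (\<lambda>l. cnj (co x (n + l))) i * co y (n + i)))"
        by (intro sum.cong refl) (simp only: lessThan_iff co_block_act(2)[OF nn] cnj_mat_vec_conj)
      finally show ?thesis
        unfolding Re_sum[symmetric] mat_vec_def sum_distrib_right plus_complex.sel(1)[symmetric] sum.distrib[symmetric]
        by (simp add: algebra_simps)
    qed
    ultimately show ?thesis by simp
  qed
  from zero_of_unitary_pairing_nonpos[OF this _ j(1)]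
  \<comment> \<open>All coefficients of that linear form vanish. For the chosen \<open>j\<close>
    they tie the two halves of \<open>y\<close> to each other in a fixed ratio.\<close>
  have M0: "co x j * cnj (co y i) + cnj (co x (n + j)) * co y (n + i) = 0" if "i < n" for i
    using that by blast
  define \<alpha> \<beta> where "\<alpha> = co x j" and "\<beta> = cnj (co x (n + j))"
  define G1 G2 c where "G1 = (\<Sum>i<n. (cmod (co y i))\<^sup>2)" and "G2 = (\<Sum>i<n. (cmod (co y (n + i)))\<^sup>2)"
    and "c = (\<Sum>i<n. co y i * co y (n + i))"
  have E: "\<alpha> * cnj (co y i) = - (\<beta> * co y (n + i))" if "i < n" for i
    using M0[OF that] by (simp add: \<alpha>_def \<beta>_def add_eq_0_iff)
  have sum1: "G1 + G2 = 1"
    using norm_sq_split[OF mult_2[symmetric], of y] y by (simp add: G1_def G2_def)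
  \<comment> \<open>Multiplying \<open>E\<close> by \<open>co y i\<close>, or its conjugate by
    \<open>co y (n + i)\<close>, and summing gives two linear equations; with
    \<open>G1 + G2 = 1\<close> they determine \<open>G1\<close>, \<open>G2\<close> and
    \<open>c\<close>, hence \<open>p1 y\<close>.\<close>
  have e1: "\<alpha> * of_real G1 = - (\<beta> * c)"
  proof -
    have "\<alpha> * of_real G1 = (\<Sum>i<n. (\<alpha> * cnj (co y i)) * co y i)"
      unfolding G1_def of_real_sum sum_distrib_left
      by (intro sum.cong refl) (simp only: complex_norm_square mult_ac)
    also have "\<dots> = (\<Sum>i<n. - (\<beta> * (co y i * co y (n + i))))"
      by (intro sum.cong refl) (simp add: E mult_ac)
    finally show ?thesis by (simp add: c_def sum_negf sum_distrib_left)
  qed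
  have e2: "cnj \<alpha> * c = - (cnj \<beta> * of_real G2)"
  proof -
    have "cnj \<alpha> * c = (\<Sum>i<n. cnj (\<alpha> * cnj (co y i)) * co y (n + i))"
      unfolding c_def sum_distrib_left by (intro sum.cong refl) simp
    also have "\<dots> = (\<Sum>i<n. - (cnj \<beta> * (co y (n + i) * cnj (co y (n + i)))))"
      by (intro sum.cong refl) (simp add: E mult_ac)
    also have "\<dots> = - (cnj \<beta> * of_real G2)"
      unfolding G2_def of_real_sum complex_norm_square sum_distrib_left sum_negf ..
    finally show ?thesis .
  qed
  define D where "D = (cmod \<alpha>)\<^sup>2 + (cmod \<beta>)\<^sup>2"
  have "D > 0" using j(2) by (auto simp: D_def \<alpha>_def \<beta>_def intro: add_pos_nonneg add_nonneg_pos)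
  have "of_real ((cmod \<alpha>)\<^sup>2 * G1) = (of_real ((cmod \<beta>)\<^sup>2 * G2) :: complex)"
  proof -
    have "of_real ((cmod \<alpha>)\<^sup>2 * G1) = cnj \<alpha> * (\<alpha> * of_real G1)"
      by (simp only: of_real_mult complex_norm_square mult_ac)
    also have "\<dots> = - (\<beta> * (cnj \<alpha> * c))" unfolding e1 by simp
    also have "\<dots> = of_real ((cmod \<beta>)\<^sup>2 * G2)"
      unfolding e2 by (simp only: of_real_mult complex_norm_square mult_minus_right minus_minus mult_ac)
    finally show ?thesis .
  qed
  then have "(cmod \<alpha>)\<^sup>2 * G1 = (cmod \<beta>)\<^sup>2 * G2" unfolding of_real_eq_iff .
  then have "D * G1 = (cmod \<beta>)\<^sup>2 * (G1 + G2)" by (simp add: D_def algebra_simps)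
  then have "D * G1 = (cmod \<beta>)\<^sup>2" unfolding sum1 by simp
  moreover have "D * (G1 - G2) = 2 * (D * G1) - D * (G1 + G2)" by (simp add: algebra_simps)
  ultimately have "(G1 - G2) * D = (cmod \<beta>)\<^sup>2 - (cmod \<alpha>)\<^sup>2"
    unfolding sum1 by (simp add: mult.commute D_def)
  then have diff: "G1 - G2 = ((cmod \<beta>)\<^sup>2 - (cmod \<alpha>)\<^sup>2) / D"
    using \<open>D > 0\<close> by (intro eq_divide_imp) auto
  have "of_real D * c = \<alpha> * (cnj \<alpha> * c) + cnj \<beta> * (\<beta> * c)"
    unfolding D_def of_real_add complex_norm_square by (simp add: algebra_simps)
  also have "\<beta> * c = - (\<alpha> * of_real G1)" unfolding e1 by simp
  also have "\<alpha> * (cnj \<alpha> * c) + cnj \<beta> * - (\<alpha> * of_real G1) = - (\<alpha> * cnj \<beta>) * of_real (G1 + G2)"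
    unfolding e2 by (simp add: algebra_simps)
  finally have "c = - (\<alpha> * cnj \<beta>) / of_real D"
    using \<open>D > 0\<close> sum1 by (simp add: field_simps)
  with diff show ?thesis
    unfolding p1_co G1_def[symmetric] G2_def[symmetric] c_def[symmetric] D_def \<alpha>_def \<beta>_def by simp
qed

text \<open>The orbits of \<open>b1\<close> and \<open>b2\<close> are distinct and both far from
  that of \<open>a\<close>. By uniqueness of far points their preimages under \<open>\<phi>\<close>
  coincide, so \<open>\<phi>\<close> would have two values there.\<close>

lemma not_isometric:
  assumes mk: "2*m + k = 2*n" "k \<ge> 3" and "m \<ge> 1"
  shows "\<not> isometric_orbit_spaces e (H1_image n) (H2_image n m)"
proof
  let ?O1 = "orbit e (H1_image n)" and ?O2 = "orbit e (H2_image n m)"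
  assume "isometric_orbit_spaces e (H1_image n) (H2_image n m)"
  then obtain \<phi> where bij\<phi>: "bij_betw \<phi> (orbit_space e (H1_image n)) (orbit_space e (H2_image n m))"
    and iso: "\<And>A B. A \<in> orbit_space e (H1_image n) \<Longrightarrow> B \<in> orbit_space e (H1_image n) \<Longrightarrow>
      orbit_dist (\<phi> A) (\<phi> B) = orbit_dist A B"
    unfolding isometric_orbit_spaces_def by blast
  \<comment> \<open>\<open>a\<close> has z'' = 0; \<open>b1\<close> and the isotropic
    \<open>b2\<close> have z' = 0 and |z''| = 1 with sums of squares 1 and 0.\<close>
  define a where "a = of_co (\<lambda>l. if l = 0 then 1 else 0)"
  define b1 where "b1 = of_co (\<lambda>l. if l = 2*m then 1 else 0)"
  define b2 where "b2 = of_co (\<lambda>l. if l = 2*m then of_real (sqrt (1/2)) else if l = 2*m + 1 then \<i> * of_real (sqrt (1/2)) else 0)"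
  note sum1 = sum_lessThan_single
  have "2 \<le> k" using mk(2) by simp
  note sum01 = sum_lessThan_pair[OF this]
  have ca: "co a l = (if l = 0 then 1 else 0)" if "l < 2*n" for l
    using that by (simp add: a_def co_of_co)
  have cb1: "co b1 (2*m + l) = (if l = 0 then 1 else 0)" if "l < k" for l
    using that mk by (simp add: b1_def co_of_co)
  have cb2: "co b2 (2*m + l) = (if l = 0 then of_real (sqrt (1/2)) else if l = 1 then \<i> * of_real (sqrt (1/2)) else 0)" if "l < k" for l
    using that mk by (simp add: b2_def co_of_co)
  have lo: "co b1 l = 0" "co b2 l = 0" if "l < 2*m" for l
    using that mk by (simp_all add: b1_def b2_def co_of_co)
  have na: "norm a = 1"
  proof -
    have "(norm a)\<^sup>2 = 1"
      unfolding norm_sq_co by (subst sum1[of 0]) (use assms ca in auto)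
    then show ?thesis unfolding norm_one_iff .
  qed
  have S1: "(\<Sum>l<k. (cmod (co b1 (2*m + l)))\<^sup>2) = 1" "(\<Sum>l<k. (co b1 (2*m + l))\<^sup>2) = 1"
    by (subst sum1[of 0]; use assms cb1 cb1[of 0] in force)+
  have S2: "(\<Sum>l<k. (cmod (co b2 (2*m + l)))\<^sup>2) = 1" "(\<Sum>l<k. (co b2 (2*m + l))\<^sup>2) = 0"
  proof -
    have c01: "co b2 (2*m + 0) = of_real (sqrt (1/2))" "co b2 (2*m + 1) = \<i> * of_real (sqrt (1/2))"
      using cb2[of 0] cb2[of 1] mk(2) by auto
    have z: "co b2 (2*m + l) = 0" if "2 \<le> l" "l < k" for l using cb2[OF that(2)] that(1) by simp
    have "(\<Sum>l<k. (cmod (co b2 (2*m + l)))\<^sup>2) = (cmod (co b2 (2*m + 0)))\<^sup>2 + (cmod (co b2 (2*m + 1)))\<^sup>2"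
      by (rule sum01) (simp add: z)
    then show "(\<Sum>l<k. (cmod (co b2 (2*m + l)))\<^sup>2) = 1"
      unfolding c01 by (simp add: norm_mult)
    have "(\<Sum>l<k. (co b2 (2*m + l))\<^sup>2) = (co b2 (2*m + 0))\<^sup>2 + (co b2 (2*m + 1))\<^sup>2"
      by (rule sum01) (simp add: z)
    then show "(\<Sum>l<k. (co b2 (2*m + l))\<^sup>2) = 0"
      unfolding c01 by (simp add: power_mult_distrib)
  qed
  have nb: "norm b1 = 1" "norm b2 = 1"
    unfolding norm_one_iff norm_sq_split[OF mk(1)] S1 S2 using lo by auto
  have pa: "p2 (2*m) a = (0, 0)"
    unfolding p2_co[OF mk(1)] using ca mk(1) assms(3) by simp
  have pb: "p2 (2*m) b1 = (1, 1)" "p2 (2*m) b2 = (1, 0)"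
    unfolding p2_co[OF mk(1)] S1 S2 by auto
  \<comment> \<open>|w| = 1 and |w''| = 1 force w' = 0, so the two orbits lie in complementary
    coordinate blocks.\<close>
  have orth: "v \<bullet> w = 0" if v: "v \<in> ?O2 a" and w: "w \<in> ?O2 b" and b: "b = b1 \<or> b = b2" for v w b
  proof -
    have "fst (p2 (2*m) v) = 0" using v pa unfolding orbit_H2[OF na mk] by auto
    then have "(\<Sum>l<k. (cmod (co v (2*m + l)))\<^sup>2) = 0" unfolding p2_co[OF mk(1)] by simp
    then have v0: "co v (2*m + l) = 0" if "l < k" for l
      using that by (subst (asm) sum_nonneg_eq_0_iff) auto
    have "norm w = 1" "fst (p2 (2*m) w) = 1"
      using w b pb nb orbit_H2[OF _ mk] by auto
    then have "(\<Sum>l<2*m. (cmod (co w l))\<^sup>2) = 0"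
      using norm_sq_split[OF mk(1), of w] unfolding p2_co[OF mk(1)] by simp
    then have w0: "co w l = 0" if "l < 2*m" for l
      using that by (subst (asm) sum_nonneg_eq_0_iff) auto
    show ?thesis
      unfolding inner_co mk(1)[symmetric] sum_lessThan_split by (simp add: v0 w0)
  qed
  have refl2: "v \<in> ?O2 v" if "norm v = 1" for v
    unfolding orbit_H2[OF that mk] using that by simp
  have far: "orbit_dist (?O2 a) (?O2 b) = pi / 2" if b: "b = b1 \<or> b = b2" for b
  proof -
    have "norm b = 1" using b nb by auto
    have "{sphere_dist v w | v w. v \<in> ?O2 a \<and> w \<in> ?O2 b} = {pi / 2}"
    proof (rule equalityI; rule subsetI)
      fix r assume "r \<in> {sphere_dist v w | v w. v \<in> ?O2 a \<and> w \<in> ?O2 b}"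
      then show "r \<in> {pi / 2}" using orth[OF _ _ b] by (auto simp: sphere_dist_def)
    next
      fix r assume "r \<in> {pi / 2}"
      then have "r = sphere_dist a b"
        using orth[OF refl2[OF na] refl2[OF \<open>norm b = 1\<close>] b] by (simp add: sphere_dist_def)
      then show "r \<in> {sphere_dist v w | v w. v \<in> ?O2 a \<and> w \<in> ?O2 b}"
        using refl2[OF na] refl2[OF \<open>norm b = 1\<close>] by blast
    qed
    then show ?thesis unfolding orbit_dist_def by simp
  qed
  have surj: "\<exists>x. norm x = 1 \<and> \<phi> (?O1 x) = ?O2 v" if "norm v = 1" for v
  proof -
    have "?O2 v \<in> \<phi> ` orbit_space e (H1_image n)"
      using bij_betw_imp_surj_on[OF bij\<phi>] that unfolding orbit_space_def unit_sphere_def by blast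
    then show ?thesis unfolding orbit_space_def unit_sphere_def by auto
  qed
  obtain x where x: "norm x = 1" "\<phi> (?O1 x) = ?O2 a" using surj[OF na] by blast
  obtain y1 where y1: "norm y1 = 1" "\<phi> (?O1 y1) = ?O2 b1" using surj[OF nb(1)] by blast
  obtain y2 where y2: "norm y2 = 1" "\<phi> (?O1 y2) = ?O2 b2" using surj[OF nb(2)] by blast
  have mem: "?O1 v \<in> orbit_space e (H1_image n)" if "norm v = 1" for v
    using that unfolding orbit_space_def unit_sphere_def by blast
  have d1: "orbit_dist (?O1 x) (?O1 y1) = pi / 2"
    using iso[OF mem[OF x(1)] mem[OF y1(1)]] far[of b1] unfolding x(2) y1(2) by simp
  have d2: "orbit_dist (?O1 x) (?O1 y2) = pi / 2"
    using iso[OF mem[OF x(1)] mem[OF y2(1)]] far[of b2] unfolding x(2) y2(2) by simp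
  obtain j where j: "j < n" "co x j \<noteq> 0 \<or> co x (n + j) \<noteq> 0"
  proof (rule ccontr)
    assume "\<not> thesis"
    then have "co x i = 0" "co x (n + i) = 0" if "i < n" for i using that \<open>\<And>j. j < n \<Longrightarrow> co x j \<noteq> 0 \<or> co x (n + j) \<noteq> 0 \<Longrightarrow> thesis\<close> by blast+
    then have "(norm x)\<^sup>2 = 0" unfolding norm_sq_split[OF mult_2[symmetric]] by simp
    then show False using x(1) by simp
  qed
  have "p1 y1 = p1 y2"
    using p1_of_far_point[OF x(1) y1(1) d1 j] p1_of_far_point[OF x(1) y2(1) d2 j] by simp
  then have "?O1 y1 = ?O1 y2" unfolding orbit_H1[OF y1(1)] orbit_H1[OF y2(1)] by simp
  then have "?O2 b1 = ?O2 b2" using y1(2) y2(2) by simp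
  then have "b1 \<in> ?O2 b2" using refl2[OF nb(1)] by simp
  then have "p2 (2*m) b1 = p2 (2*m) b2" unfolding orbit_H2[OF nb(2) mk] by simp
  then show False using pb by simp
qed

end

theorem theorem1p1:
  fixes n m :: nat and e :: "'k::finite \<Rightarrow> nat"
  assumes "odd n" and "n \<ge> 3" and "m = (n - 1) div 2"
    and "bij_betw e UNIV {..<2*n}"
  shows "isospectral_orbit_spaces e (H1_image n) (H2_image n m)
       \<and> \<not> isometric_orbit_spaces e (H1_image n) (H2_image n m)"
proof -
  interpret coordinates e n by unfold_locales fact
  \<comment> \<open>Oddness gives \<open>2 * m = n - 1\<close>, so the orthogonal factor has size
    \<open>n + 1\<close>, at least 4.\<close>
  have "2*m + (n + 1) = 2*n" using assms(1,2,3) by (auto elim!: oddE)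
  moreover have "m \<ge> 1" using assms(2,3) by auto
  ultimately show ?thesis
    using isospectral[of m "n + 1"] not_isometric[of m "n + 1"] assms(2) by simp
qed

end
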